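(* Let $D\subset\mathbb{R}^n$ be a simply connected open set containing $0$, and let $\{\phi_1,\dots,\phi_n\}$ be a Combescure sequence of Guichard$_k$ orthogonal co-ordinate systems on $D$ with $\phi_i(0)=0$ for all $i$. Then there exist a solution $F$ of the $\frac{\mathrm{O}(2n-k,k)}{\mathrm{O}(n)\times\mathrm{O}(n-k,k)}$-system on $D$, an extended frame $E$ for $F$, and a null basis $\{{\vec{c}}_1,\dots,{\vec{c}}_n\}$ of $\mathbb{R}^{n-k,k}$ such that, writing $\frac{\partial E}{\partial\lambda}E^{-1}\big|_{\lambda=0}=\begin{pmatrix}0&Y\\-JY^T&0\end{pmatrix}$ with $Y$ an $n\times n$-matrix-valued map, one has $\phi_\ell=Y{\vec{c}}_\ell$ for all $1\le\ell\le n$.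
   Context: Fix integers $n\ge2$ and $1\le k\le n-1$. Let $\epsilon_i=1$ for $1\le i\le n-k$ and $\epsilon_i=-1$ for $n-k<i\le n$, $J=\operatorname{diag}(\epsilon_1,\dots,\epsilon_n)$, and $(\vec x,\vec y)_k=\vec x^TJ\vec y$ on $\mathbb{R}^n$ (denoted $\mathbb{R}^{n-k,k}$). A null basis of $\mathbb{R}^{n-k,k}$ is a basis of vectors ${\vec{c}}$ with $({\vec{c}},{\vec{c}})_k=0$. $\delta=\operatorname{diag}(\mathrm{d} x_1,\dots,\mathrm{d} x_n)$. Let $G=\operatorname{diag}(\mathrm{I}_n,J)$; $\mathrm{O}(2n-k,k)^{\mathbb{C}}$ is the group of complex $2n\times2n$ matrices $A$ with $A^TGA=G$; $\mathrm{I}_{n,n}=\operatorname{diag}(\mathrm{I}_n,-\mathrm{I}_n)$. The $\frac{\mathrm{O}(2n-k,k)}{\mathrm{O}(n)\times\mathrm{O}(n-k,k)}$-system is the PDE for a smooth map $F=(f_{ij})$ into real $n\times n$ matrices with $f_{ii}=0$, requiring that $\omega=-\delta JF+F^TJ\delta$ and $\tau=-\delta F^TJ+F\delta J$ are both flat; equivalently $\theta_\lambda=\begin{pmatrix}\omega&-\lambda\delta J\\ \lambda\delta&\tau\end{pmatrix}$ is flat for all $\lambda\in\mathbb{C}$. An extended frame for $F$ is a smooth map $E:D\times\mathbb{C}\to\mathrm{O}(2n-k,k)^{\mathbb{C}}$, holomorphic in $\lambda$, with $E(\cdot,\lambda)^{-1}\mathrm{d} E(\cdot,\lambda)=\theta_\lambda$,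 $\overline{E(x,\bar\lambda)}=E(x,\lambda)$ and $\mathrm{I}_{n,n}E(x,-\lambda)\mathrm{I}_{n,n}^{-1}=E(x,\lambda)$. An orthogonal co-ordinate system on an open $U\subset\mathbb{R}^n$ is a smooth $\phi:U\to\mathbb{R}^n$ with nonzero mutually orthogonal partials; a metric field is $\vec u$ with $\phi^*(\mathrm{d} s_0^2)=\sum u_i^2\mathrm{d} x_i^2$. $\phi$ is Guichard$_k$ if $\sum_{i\le n-k}u_i^2=\sum_{i>n-k}u_i^2$. $\phi\mapsto\psi$ is a Combescure transform if $\phi_{x_i}(x)\parallel\psi_{x_i}(x)$ for all $i,x$. A sequence $\{\phi_1,\dots,\phi_n\}$ of Guichard$_k$ orthogonal co-ordinate systems is a Combescure sequence if each $\phi_i\mapsto\phi_{i+1}$ is a Combescure transform and the metric fields $\vec u_i=(u_{i1},\dots,u_{in})^T$ of $\phi_i$, chosen so that $(\phi_i)_{x_j}/u_{ij}=(\phi_1)_{x_j}/u_{1j}$ for all $i,j$, are linearly independent at every point. *)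

theory Defs
  imports "HOL-Analysis.Analysis" "HOL-Complex_Analysis.Complex_Analysis"
begin

text \<open>Conventions. Points of R^n are vectors real^'n, where the index type 'n is finite
and linearly ordered; its ordering gives the numbering 1..n of the coordinates
(the i-th coordinate, 1-based, is the index with exactly i-1 smaller indices).
Matrices of size 2n x 2n are indexed by 'n + 'n: Inl i is the i-th index of the
first block, Inr i the i-th index of the second block.\<close>

fun Ck_on :: "nat \<Rightarrow> 'a::real_normed_vector set \<Rightarrow> ('a \<Rightarrow> 'b::real_normed_vector) \<Rightarrow> bool" where
  "Ck_on 0 S f \<longleftrightarrow> continuous_on S f"
| "Ck_on (Suc m) S f \<longleftrightarrow> f differentiable_on S \<and>
      (\<forall>v. Ck_on m S (\<lambda>x. frechet_derivative f (at x) v))"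

definition smooth_on :: "'a::real_normed_vector set \<Rightarrow> ('a \<Rightarrow> 'b::real_normed_vector) \<Rightarrow> bool" where
  "smooth_on S f \<longleftrightarrow> (\<forall>m. Ck_on m S f)"

definition pd :: "(real^'n \<Rightarrow> 'b::real_normed_vector) \<Rightarrow> 'n \<Rightarrow> real^'n \<Rightarrow> 'b" where
  "pd f i x = frechet_derivative f (at x) (axis i 1)"

definition rank_idx :: "'n::{finite,linorder} \<Rightarrow> nat" where
  "rank_idx i = card {j. j < i}"

definition eps :: "nat \<Rightarrow> 'n::{finite,linorder} \<Rightarrow> real" where
  "eps k i = (if rank_idx i < CARD('n) - k then 1 else -1)"

definition Jmat :: "nat \<Rightarrow> real^'n::{finite,linorder}^'n::{finite,linorder}" where
  "Jmat k = (\<chi> i j. if i = j then eps k i else 0)"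

definition kform :: "nat \<Rightarrow> real^'n::{finite,linorder} \<Rightarrow> real^'n::{finite,linorder} \<Rightarrow> real" where
  "kform k x y = x \<bullet> (Jmat k *v y)"

definition null_basis :: "nat \<Rightarrow> (nat \<Rightarrow> real^'n::{finite,linorder}) \<Rightarrow> bool" where
  "null_basis k c \<longleftrightarrow> (\<forall>l\<in>{1..CARD('n)}. kform k (c l) (c l) = 0) \<and>
     inj_on c {1..CARD('n)} \<and> independent (c ` {1..CARD('n)}) \<and>
     span (c ` {1..CARD('n)}) = UNIV"

text \<open>delta evaluated on a tangent vector h: diag(h_1,...,h_n).\<close>
definition diagv :: "real^'n \<Rightarrow> real^'n^'n" where
  "diagv h = (\<chi> i j. if i = j then h $ i else 0)"

definition omega :: "nat \<Rightarrow> (real^'n::{finite,linorder} \<Rightarrow> real^'n::{finite,linorder}^'n::{finite,linorder}) \<Rightarrow> real^'n::{finite,linorder} \<Rightarrow> real^'n::{finite,linorder} \<Rightarrow> real^'n::{finite,linorder}^'n::{finite,linorder}" where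
  "omega k F x h = - (diagv h ** Jmat k ** F x) + transpose (F x) ** Jmat k ** diagv h"

definition tau :: "nat \<Rightarrow> (real^'n::{finite,linorder} \<Rightarrow> real^'n::{finite,linorder}^'n::{finite,linorder}) \<Rightarrow> real^'n::{finite,linorder} \<Rightarrow> real^'n::{finite,linorder} \<Rightarrow> real^'n::{finite,linorder}^'n::{finite,linorder}" where
  "tau k F x h = - (diagv h ** transpose (F x) ** Jmat k) + F x ** diagv h ** Jmat k"

text \<open>Flatness of a matrix-valued 1-form A (A x h = value at x on tangent vector h):
 dA + A \<and> A = 0.\<close>
definition flat_on :: "(real^'n) set \<Rightarrow> (real^'n \<Rightarrow> real^'n \<Rightarrow> real^'m^'m) \<Rightarrow> bool" where
  "flat_on D A \<longleftrightarrow> (\<forall>x\<in>D. \<forall>i j.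
     pd (\<lambda>y. A y (axis j 1)) i x - pd (\<lambda>y. A y (axis i 1)) j x
     + (A x (axis i 1) ** A x (axis j 1) - A x (axis j 1) ** A x (axis i 1)) = 0)"

definition system_solution :: "nat \<Rightarrow> (real^'n::{finite,linorder}) set \<Rightarrow> (real^'n::{finite,linorder} \<Rightarrow> real^'n::{finite,linorder}^'n::{finite,linorder}) \<Rightarrow> bool" where
  "system_solution k D F \<longleftrightarrow> smooth_on D F \<and> (\<forall>x\<in>D. \<forall>i. F x $ i $ i = 0) \<and>
     flat_on D (omega k F) \<and> flat_on D (tau k F)"

definition block_mat :: "'a^'n^'n \<Rightarrow> 'a^'n^'n \<Rightarrow> 'a^'n^'n \<Rightarrow> 'a^'n^'n \<Rightarrow> 'a^('n + 'n)^('n + 'n)" where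
  "block_mat A B C D = (\<chi> a b. case a of
       Inl i \<Rightarrow> (case b of Inl j \<Rightarrow> A $ i $ j | Inr j \<Rightarrow> B $ i $ j)
     | Inr i \<Rightarrow> (case b of Inl j \<Rightarrow> C $ i $ j | Inr j \<Rightarrow> D $ i $ j))"

definition cmat :: "real^'n^'m \<Rightarrow> complex^'n^'m" where
  "cmat A = map_matrix complex_of_real A"

definition Gmat :: "nat \<Rightarrow> complex^('n::{finite,linorder} + 'n::{finite,linorder})^('n::{finite,linorder} + 'n::{finite,linorder})" where
  "Gmat k = block_mat (mat 1) 0 0 (cmat (Jmat k))"

definition Inn :: "complex^('n::finite + 'n)^('n + 'n)" where
  "Inn = block_mat (mat 1) 0 0 (- mat 1)"

definition in_O_complex :: "nat \<Rightarrow> complex^('n::{finite,linorder} + 'n::{finite,linorder})^('n::{finite,linorder} + 'n::{finite,linorder}) \<Rightarrow> bool" where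
  "in_O_complex k A \<longleftrightarrow> transpose A ** Gmat k ** A = Gmat k"

definition theta :: "nat \<Rightarrow> (real^'n::{finite,linorder} \<Rightarrow> real^'n::{finite,linorder}^'n::{finite,linorder}) \<Rightarrow> real^'n::{finite,linorder} \<Rightarrow> complex \<Rightarrow> real^'n::{finite,linorder}
     \<Rightarrow> complex^('n::{finite,linorder} + 'n::{finite,linorder})^('n::{finite,linorder} + 'n::{finite,linorder})" where
  "theta k F x l h = block_mat (cmat (omega k F x h))
      (map_matrix (\<lambda>z. - l * z) (cmat (diagv h ** Jmat k)))
      (map_matrix (\<lambda>z. l * z) (cmat (diagv h)))
      (cmat (tau k F x h))"

definition extended_frame :: "nat \<Rightarrow> (real^'n::{finite,linorder}) set \<Rightarrow> (real^'n::{finite,linorder} \<Rightarrow> real^'n::{finite,linorder}^'n::{finite,linorder})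
     \<Rightarrow> (real^'n::{finite,linorder} \<Rightarrow> complex \<Rightarrow> complex^('n::{finite,linorder} + 'n::{finite,linorder})^('n::{finite,linorder} + 'n::{finite,linorder})) \<Rightarrow> bool" where
  "extended_frame k D F E \<longleftrightarrow>
     smooth_on (D \<times> UNIV) (\<lambda>(x, l). E x l) \<and>
     (\<forall>x\<in>D. \<forall>a b. (\<lambda>l. E x l $ a $ b) holomorphic_on UNIV) \<and>
     (\<forall>x\<in>D. \<forall>l. in_O_complex k (E x l)) \<and>
     (\<forall>x\<in>D. \<forall>l. \<forall>h. matrix_inv (E x l) ** frechet_derivative (\<lambda>y. E y l) (at x) h
                       = theta k F x l h) \<and>
     (\<forall>x\<in>D. \<forall>l. map_matrix cnj (E x (cnj l)) = E x l) \<and>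
     (\<forall>x\<in>D. \<forall>l. Inn ** E x (- l) ** matrix_inv Inn = E x l)"

definition dlambda0 :: "(complex \<Rightarrow> complex^'m^'m) \<Rightarrow> complex^'m^'m" where
  "dlambda0 M = (\<chi> a b. deriv (\<lambda>l. M l $ a $ b) 0)"

definition orth_coords :: "(real^'n) set \<Rightarrow> (real^'n \<Rightarrow> real^'n) \<Rightarrow> bool" where
  "orth_coords U \<phi> \<longleftrightarrow> open U \<and> smooth_on U \<phi> \<and>
     (\<forall>x\<in>U. \<forall>i. pd \<phi> i x \<noteq> 0) \<and>
     (\<forall>x\<in>U. \<forall>i j. i \<noteq> j \<longrightarrow> pd \<phi> i x \<bullet> pd \<phi> j x = 0)"

text \<open>u is a metric field: phi^*(ds_0^2) = sum u_i^2 dx_i^2.\<close>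
definition metric_field :: "(real^'n) set \<Rightarrow> (real^'n \<Rightarrow> real^'n) \<Rightarrow> (real^'n \<Rightarrow> real^'n) \<Rightarrow> bool" where
  "metric_field U \<phi> u \<longleftrightarrow> (\<forall>x\<in>U. \<forall>h.
     (norm (frechet_derivative \<phi> (at x) h))\<^sup>2 = (\<Sum>i\<in>UNIV. (u x $ i)\<^sup>2 * (h $ i)\<^sup>2))"

definition guichard :: "nat \<Rightarrow> (real^'n::{finite,linorder}) set \<Rightarrow> (real^'n::{finite,linorder} \<Rightarrow> real^'n::{finite,linorder}) \<Rightarrow> bool" where
  "guichard k U \<phi> \<longleftrightarrow> orth_coords U \<phi> \<and>
     (\<exists>u. metric_field U \<phi> u \<and> (\<forall>x\<in>U.
        (\<Sum>i\<in>{i. rank_idx i < CARD('n) - k}. (u x $ i)\<^sup>2)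
      = (\<Sum>i\<in>{i. \<not> rank_idx i < CARD('n) - k}. (u x $ i)\<^sup>2)))"

definition parallel :: "real^'n \<Rightarrow> real^'n \<Rightarrow> bool" where
  "parallel a b \<longleftrightarrow> (\<exists>t. b = t *\<^sub>R a) \<or> (\<exists>t. a = t *\<^sub>R b)"

definition combescure :: "(real^'n) set \<Rightarrow> (real^'n \<Rightarrow> real^'n) \<Rightarrow> (real^'n \<Rightarrow> real^'n) \<Rightarrow> bool" where
  "combescure U \<phi> \<psi> \<longleftrightarrow> (\<forall>x\<in>U. \<forall>i. parallel (pd \<phi> i x) (pd \<psi> i x))"

definition combescure_sequence :: "nat \<Rightarrow> (real^'n::{finite,linorder}) set \<Rightarrow> (nat \<Rightarrow> real^'n::{finite,linorder} \<Rightarrow> real^'n::{finite,linorder}) \<Rightarrow> bool" where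
  "combescure_sequence k U \<phi> \<longleftrightarrow>
     (\<forall>l\<in>{1..CARD('n)}. guichard k U (\<phi> l)) \<and>
     (\<forall>l\<in>{1..<CARD('n)}. combescure U (\<phi> l) (\<phi> (l + 1))) \<and>
     (\<exists>u. (\<forall>l\<in>{1..CARD('n)}. metric_field U (\<phi> l) (u l)) \<and>
          (\<forall>l\<in>{1..CARD('n)}. \<forall>x\<in>U. \<forall>j.
              (1 / (u l x $ j)) *\<^sub>R pd (\<phi> l) j x = (1 / (u 1 x $ j)) *\<^sub>R pd (\<phi> 1) j x) \<and>
          (\<forall>x\<in>U. inj_on (\<lambda>l. u l x) {1..CARD('n)} \<and>
                  independent ((\<lambda>l. u l x) ` {1..CARD('n)})))"

end

theory Submission
  imports Defs
begin

text \<open>Since all members of a Combescure sequence share the unit tangents \<open>v\<^sub>j\<close>, they are encoded by the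
  orthogonal matrix \<open>V = (v\<^sub>1, \<dots>, v\<^sub>n)\<close> and the matrix \<open>U\<close> of metric fields. Symmetry of second derivatives
  together with the Guichard condition gives \<open>dV = V \<omega>\<close> and \<open>dU = - J \<tau> J U\<close>, where
  \<open>F\<^sub>i\<^sub>j = - \<epsilon>\<^sub>i (\<partial>\<^sub>i v\<^sub>j, v\<^sub>i)\<close>; hence \<open>B = (U U(0)\<inverse>)\<^sup>T\<close> satisfies \<open>dB = B \<tau>\<close>, and both forms are flat.
  With \<open>c\<^sub>l = - J u\<^sub>l(0)\<close> the matrix \<open>Y\<close> is determined by \<open>\<phi>\<^sub>l = Y c\<^sub>l\<close>. Gauging by \<open>g = diag(V, B)\<close> turns the
  equation of the extended frame into \<open>dT = \<lambda> T dZ\<close>, where \<open>Z\<close> has the off-diagonal blocks \<open>Y\<close> and \<open>- J Y\<^sup>T\<close>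
  and \<open>dZ \<and> dZ = 0\<close>. It is solved by the power series \<open>T = \<Sum> \<lambda>\<^sup>m P\<^sub>m\<close> with \<open>P\<^sub>0 = 1\<close> and \<open>dP\<^sub>m\<^sub>+\<^sub>1 = P\<^sub>m dZ\<close>; the
  right-hand sides are closed, hence exact on the simply connected domain. The extended frame is
  \<open>E = T g\<close>, and \<open>\<partial>E/\<partial>\<lambda> E\<inverse> = P\<^sub>1 = Z\<close> at \<open>\<lambda> = 0\<close>.\<close>

subsection \<open>Monodromy of additive cocycles\<close>

text \<open>The form \<open>theta\<close> is not integrated for each \<lambda> separately, because
  \<open>E\<close> must be smooth jointly and entire in \<lambda>. After gauging only \<lambda> dZ
  is left, so one sequence of real matrices, independent of \<lambda>, carries the whole family. The
  \<open>P m\<close> are iterated integrals that decay faster than every geometric sequence; this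
  gives convergence for all \<lambda>.

  The factor -J in \<open>c\<close> is forced: conjugating the block -\<lambda> \<delta> J by
  diag(V, B) gives dY = - V \<delta> B^T J, whereas d\<phi> = V \<delta> u = V \<delta> B^T u(0).

  The Guichard condition is needed because symmetry of mixed partials determines every first
  derivative of the metric coefficients except the diagonal ones; differentiating the null condition
  supplies those.

  Closed forms have potentials on balls at once. To pass to D, the increments of these potentials
  are viewed as a cocycle whose identity is known only for points of a common ball in D; it is
  continued along paths and over the squares of homotopies.\<close>

definition local_cocycle :: "'a::metric_space set \<Rightarrow> ('a \<Rightarrow> 'a \<Rightarrow> 'b::ab_group_add) \<Rightarrow> bool" where
  "local_cocycle D \<Delta> \<longleftrightarrow> (\<forall>c r. ball c r \<subseteq> D \<longrightarrow>
     (\<forall>x\<in>ball c r. \<forall>y\<in>ball c r. \<forall>z\<in>ball c r. \<Delta> x y + \<Delta> y z = \<Delta> x z))"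

text \<open>A potential \<open>G\<close> of the cocycle along a map \<open>h\<close> into the domain; \<open>h\<close> need not be injective, so \<open>G\<close> may
  be multivalued as a function of \<open>h\<close>.\<close>

definition develops :: "('a \<Rightarrow> 'a \<Rightarrow> 'b::ab_group_add) \<Rightarrow> 'z::metric_space set \<Rightarrow> ('z \<Rightarrow> 'a) \<Rightarrow> ('z \<Rightarrow> 'b) \<Rightarrow> bool" where
  "develops \<Delta> K h G \<longleftrightarrow>
     (\<forall>z\<in>K. \<exists>e>0. \<forall>w\<in>K \<inter> ball z e. \<forall>w'\<in>K \<inter> ball z e. G w' - G w = \<Delta> (h w) (h w'))"

lemma local_cocycleD:
  assumes "local_cocycle D \<Delta>" "ball c r \<subseteq> D" "x \<in> ball c r" "y \<in> ball c r" "z \<in> ball c r"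
  shows "\<Delta> x y + \<Delta> y z = \<Delta> x z"
  using assms unfolding local_cocycle_def by blast

lemma develops_compose:
  assumes "develops \<Delta> K h G" "continuous_on K' f" "f ` K' \<subseteq> K"
  shows "develops \<Delta> K' (h \<circ> f) (G \<circ> f)"
  unfolding develops_def
proof
  fix z assume z: "z \<in> K'"
  then have "f z \<in> K" using assms(3) by blast
  then obtain e where e: "e > 0" "\<forall>w\<in>K \<inter> ball (f z) e. \<forall>w'\<in>K \<inter> ball (f z) e. G w' - G w = \<Delta> (h w) (h w')"
    using assms(1) unfolding develops_def by blast
  obtain d where d: "d > 0" "\<forall>w\<in>K'. dist w z < d \<longrightarrow> dist (f w) (f z) < e"
    using assms(2) z e(1) unfolding continuous_on_iff by blast
  show "\<exists>e>0. \<forall>w\<in>K' \<inter> ball z e. \<forall>w'\<in>K' \<inter> ball z e. (G \<circ> f) w' - (G \<circ> f) w = \<Delta> ((h \<circ> f) w) ((h \<circ> f) w')"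
    using d e(2) assms(3) by (intro exI[of _ d]) (auto simp: dist_commute image_subset_iff)
qed

text \<open>Near each point both increments are values of the same \<Delta>, so
  \<open>G - G'\<close> is locally constant, hence constant on a connected set.\<close>

lemma develops_unique:
  assumes "connected K" "develops \<Delta> K h G" "develops \<Delta> K h G'" "a \<in> K" "b \<in> K"
  shows "G b - G a = G' b - G' a"
proof -
  have "G a - G' a = G b - G' b"
  proof (rule connected_local_const[OF assms(1,4,5)], rule)
    fix z assume z: "z \<in> K"
    obtain e where e: "e > 0" "\<forall>w\<in>K \<inter> ball z e. \<forall>w'\<in>K \<inter> ball z e. G w' - G w = \<Delta> (h w) (h w')"
      using assms(2) z unfolding develops_def by blast
    obtain e' where e': "e' > 0" "\<forall>w\<in>K \<inter> ball z e'. \<forall>w'\<in>K \<inter> ball z e'. G' w' - G' w = \<Delta> (h w) (h w')"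
      using assms(3) z unfolding develops_def by blast
    have "G z - G' z = G w - G' w" if "w \<in> K" "w \<in> ball z (min e e')" for w
    proof -
      have "G w - G z = \<Delta> (h z) (h w)" using e z that by auto
      moreover have "G' w - G' z = \<Delta> (h z) (h w)" using e' z that by auto
      ultimately show ?thesis by (simp add: algebra_simps)
    qed
    then show "\<forall>\<^sub>F w in at z within K. G z - G' z = G w - G' w"
      unfolding eventually_at using e(1) e'(1)
      by (intro exI[of _ "min e e'"]) (auto simp: dist_commute)
  qed
  then show ?thesis by (simp add: algebra_simps)
qed

lemma develops_shift:
  "develops \<Delta> K h G \<Longrightarrow> develops \<Delta> K h (\<lambda>w. G w + c)"
  unfolding develops_def by simp

text \<open>Within one ball the cocycle is a coboundary: based at the centre, \<Delta> x y is the
  difference of \<Delta> c y and \<Delta> c x.\<close>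

lemma develops_ball:
  assumes "local_cocycle D \<Delta>" "ball c r \<subseteq> D" "h ` K \<subseteq> ball c r"
  shows "develops \<Delta> K h (\<lambda>w. \<Delta> c (h w))"
  unfolding develops_def
proof
  fix z assume z: "z \<in> K"
  have "\<Delta> c (h w') - \<Delta> c (h w) = \<Delta> (h w) (h w')" if "w \<in> K" "w' \<in> K" for w w'
  proof -
    have "h w \<in> ball c r" "h w' \<in> ball c r" "c \<in> ball c r"
      using that assms(3) by (auto simp: image_subset_iff) (metis dist_self le_less_trans zero_le_dist)
    then show ?thesis using local_cocycleD[OF assms(1,2), of c "h w" "h w'"] by (metis add_diff_cancel_left')
  qed
  then show "\<exists>e>0. \<forall>w\<in>K \<inter> ball z e. \<forall>w'\<in>K \<inter> ball z e. \<Delta> c (h w') - \<Delta> c (h w) = \<Delta> (h w) (h w')"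
    by (intro exI[of _ 1]) auto
qed

text \<open>On the connected overlap the two developments differ by a constant, so shifting one of
  them makes them agree there. Closedness of the pieces ensures that points of different pieces need
  comparing only near the overlap.\<close>

lemma develops_glue:
  assumes coc: "local_cocycle D \<Delta>" and "open D"
    and K: "closed K1" "closed K2" "connected (K1 \<inter> K2)" 
    and h: "continuous_on (K1 \<union> K2) h" "h ` (K1 \<union> K2) \<subseteq> D"
    and G1: "develops \<Delta> K1 h G1" and G2: "develops \<Delta> K2 h G2"
  shows "\<exists>G. develops \<Delta> (K1 \<union> K2) h G"
proof -
  have D1: "develops \<Delta> (K1 \<inter> K2) h G1" 
    using develops_compose[OF G1, of "K1 \<inter> K2" id] by simp
  have D2: "develops \<Delta> (K1 \<inter> K2) h G2" 
    using develops_compose[OF G2, of "K1 \<inter> K2" id] by simp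
  obtain c where c: "\<And>z. z \<in> K1 \<inter> K2 \<Longrightarrow> G1 z = G2 z + c"
  proof (cases "K1 \<inter> K2 = {}")
    case False
    then obtain a where a: "a \<in> K1 \<inter> K2" by blast
    have "G1 z = G2 z + (G1 a - G2 a)" if "z \<in> K1 \<inter> K2" for z
      using develops_unique[OF K(3) D1 D2 a that]
      by (simp add: algebra_simps)
    then show ?thesis using that by blast
  qed (use that in blast)
  define H where "H w = G2 w + c" for w
  have H: "develops \<Delta> K2 h H" using develops_shift[OF G2] unfolding H_def .
  have eqH: "G1 z = H z" if "z \<in> K1" "z \<in> K2" for z using c that by (simp add: H_def)
  define G where "G w = (if w \<in> K1 then G1 w else H w)" for w
  have GK2: "G w = H w" if "w \<in> K2" for w using that eqH by (auto simp: G_def)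
  have GK1: "G w = G1 w" if "w \<in> K1" for w using that by (auto simp: G_def)
  have "develops \<Delta> (K1 \<union> K2) h G"
    unfolding develops_def
  proof
    fix z assume z: "z \<in> K1 \<union> K2"
    have a1: "\<exists>e>0. \<forall>w\<in>K1 \<inter> ball z e. \<forall>w'\<in>K1 \<inter> ball z e. G w' - G w = \<Delta> (h w) (h w')"
    proof (cases "z \<in> K1")
      case True
      then show ?thesis using G1 GK1 unfolding develops_def by fastforce
    next
      case False
      then obtain e where "e > 0" "ball z e \<subseteq> - K1" using K(1) open_contains_ball[of "-K1"] by blast
      then show ?thesis by (intro exI[of _ e]) auto
    qed
    have a2: "\<exists>e>0. \<forall>w\<in>K2 \<inter> ball z e. \<forall>w'\<in>K2 \<inter> ball z e. G w' - G w = \<Delta> (h w) (h w')"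
    proof (cases "z \<in> K2")
      case True
      then show ?thesis using H GK2 unfolding develops_def by fastforce
    next
      case False
      then obtain e where "e > 0" "ball z e \<subseteq> - K2" using K(2) open_contains_ball[of "-K2"] by blast
      then show ?thesis by (intro exI[of _ e]) auto
    qed
    obtain e1 where e1: "e1>0" "\<And>w w'. w\<in>K1 \<inter> ball z e1 \<Longrightarrow> w'\<in>K1 \<inter> ball z e1 \<Longrightarrow> G w' - G w = \<Delta> (h w) (h w')" using a1 by blast
    obtain e2 where e2: "e2>0" "\<And>w w'. w\<in>K2 \<inter> ball z e2 \<Longrightarrow> w'\<in>K2 \<inter> ball z e2 \<Longrightarrow> G w' - G w = \<Delta> (h w) (h w')" using a2 by blast
    have "h z \<in> D" using h(2) z by blast
    then obtain r where r: "r > 0" "ball (h z) r \<subseteq> D" using \<open>open D\<close> open_contains_ball by blast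
    obtain d where d: "d > 0" "\<And>w. w\<in>K1\<union>K2 \<Longrightarrow> dist w z < d \<Longrightarrow> dist (h w) (h z) < r"
      using h(1) z r(1) unfolding continuous_on_iff by blast
    \<comment> \<open>A point missing one of the closed pieces has a ball that avoids this piece, so
      near it only one development is in play.\<close>
    obtain e3 where e3: "e3 > 0" "z \<notin> K1 \<or> z \<notin> K2 \<Longrightarrow> (K1 \<inter> ball z e3 = {} \<or> K2 \<inter> ball z e3 = {})"
    proof -
      have "\<exists>e3>0. (z \<notin> K1 \<or> z \<notin> K2 \<longrightarrow> (K1 \<inter> ball z e3 = {} \<or> K2 \<inter> ball z e3 = {}))"
        using open_contains_ball[of "-K1"] open_contains_ball[of "-K2"] K 
        by (metis ComplI disjoint_eq_subset_Compl inf.commute open_Compl zero_less_one)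
      then show ?thesis using that by blast
    qed
    let ?e = "min (min e1 e2) (min d e3)"
    have key: "G w' - G w = \<Delta> (h w) (h w')" if w: "w \<in> K1 \<union> K2" "w \<in> ball z ?e" "w' \<in> K1 \<union> K2" "w' \<in> ball z ?e" for w w'
    proof (cases "z \<in> K1 \<and> z \<in> K2")
      case True
      \<comment> \<open>The points may lie in different pieces; both are compared with
        \<open>z\<close>, which lies in each, and the cocycle identity in a ball around
        \<open>h z\<close> composes the two increments.\<close>
      have "G z - G w = \<Delta> (h w) (h z)" using w(1,2) True e1(1) e2(1) e1(2)[of w z] e2(2)[of w z] by auto
      moreover have "G w' - G z = \<Delta> (h z) (h w')" using w(3,4) True e1(1) e2(1) e1(2)[of z w'] e2(2)[of z w'] by auto
      moreover have "h w \<in> ball (h z) r" "h w' \<in> ball (h z) r" "h z \<in> ball (h z) r"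
        using d w r by (auto simp: dist_commute)
      then have "\<Delta> (h w) (h z) + \<Delta> (h z) (h w') = \<Delta> (h w) (h w')" using local_cocycleD[OF coc r(2)] by blast
      ultimately show ?thesis by (simp add: algebra_simps)
    next
      case False
      then have "(K1 \<inter> ball z e3 = {} \<or> K2 \<inter> ball z e3 = {})" using e3(2) by blast
      then have "w \<in> K1 \<and> w' \<in> K1 \<or> w \<in> K2 \<and> w' \<in> K2" using w by fastforce
      then show ?thesis using e1(2)[of w w'] e2(2)[of w w'] w by auto
    qed
    show "\<exists>e>0. \<forall>w\<in>(K1\<union>K2) \<inter> ball z e. \<forall>w'\<in>(K1\<union>K2) \<inter> ball z e. G w' - G w = \<Delta> (h w) (h w')"
      using key e1(1) e2(1) d(1) e3(1) by (intro exI[of _ ?e]) auto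
  qed
  then show ?thesis by blast
qed

text \<open>Small rectangles map into balls of D and are developed there. A bisection in the second
  coordinate yields narrow strips of full height, a bisection in the first glues the strips; the
  overlaps are edges, hence connected.\<close>

lemma develops_square_exists:
  fixes h :: "real \<times> real \<Rightarrow> 'a::metric_space"
  assumes coc: "local_cocycle D \<Delta>" and "open D"
    and h: "continuous_on ({0..1}\<times>{0..1}) h" "h ` ({0..1}\<times>{0..1}) \<subseteq> D"
  shows "\<exists>G. develops \<Delta> ({0..1}\<times>{0..1}) h G"
proof -
  \<comment> \<open>\<open>Bolzano\<close> asks about all short intervals around a point, also those
    that leave the unit interval; intersecting with it keeps such rectangles harmless.\<close>
  define Q where "Q s1 s2 t1 t2 \<longleftrightarrow> (\<exists>G. develops \<Delta> (({0..1} \<inter> {s1..s2}) \<times> ({0..1} \<inter> {t1..t2})) h G)" for s1 s2 t1 t2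
  have sub: "develops \<Delta> K h G \<Longrightarrow> K' \<subseteq> K \<Longrightarrow> develops \<Delta> K' h G" for K K' G
    using develops_compose[of \<Delta> K h G K' id] by simp
  have gluet: "Q s1 s2 t1 t3" if q: "Q s1 s2 t1 t2" "Q s1 s2 t2 t3" and "t1 \<le> t2" "t2 \<le> t3" for s1 s2 t1 t2 t3
  proof -
    let ?K1 = "({0..1} \<inter> {s1..s2}) \<times> ({0..1} \<inter> {t1..t2})" and ?K2 = "({0..1} \<inter> {s1..s2}) \<times> ({0..1} \<inter> {t2..t3})"
    have eq: "?K1 \<union> ?K2 = ({0..1} \<inter> {s1..s2}) \<times> ({0..1} \<inter> {t1..t3})" using that by auto
    have "?K1 \<inter> ?K2 = ({0..1} \<inter> {s1..s2}) \<times> ({0..1} \<inter> {t2})" using that by auto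
    then have "convex (?K1 \<inter> ?K2)" by (auto intro!: convex_Times convex_Int)
    then have con: "connected (?K1 \<inter> ?K2)" by (rule convex_connected)
    have "\<exists>G. develops \<Delta> (?K1 \<union> ?K2) h G"
    proof -
      obtain G1 where G1: "develops \<Delta> ?K1 h G1" using q(1) unfolding Q_def by blast
      obtain G2 where G2: "develops \<Delta> ?K2 h G2" using q(2) unfolding Q_def by blast
      have s: "?K1 \<union> ?K2 \<subseteq> {0..1} \<times> {0..1}" by auto
      show ?thesis
        apply (rule develops_glue[OF coc \<open>open D\<close> _ _ con _ _ G1 G2])
           apply (intro closed_Times closed_Int closed_atLeastAtMost)
          apply (intro closed_Times closed_Int closed_atLeastAtMost)
         apply (rule continuous_on_subset[OF h(1) s])
        using h(2) s by blast
    qed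
    then show ?thesis unfolding Q_def eq .
  qed
  have glues: "Q s1 s3 t1 t2" if q: "Q s1 s2 t1 t2" "Q s2 s3 t1 t2" and "s1 \<le> s2" "s2 \<le> s3" for s1 s2 s3 t1 t2
  proof -
    let ?K1 = "({0..1} \<inter> {s1..s2}) \<times> ({0..1} \<inter> {t1..t2})" and ?K2 = "({0..1} \<inter> {s2..s3}) \<times> ({0..1} \<inter> {t1..t2})"
    have eq: "?K1 \<union> ?K2 = ({0..1} \<inter> {s1..s3}) \<times> ({0..1} \<inter> {t1..t2})" using that by auto
    have "?K1 \<inter> ?K2 = ({0..1} \<inter> {s2}) \<times> ({0..1} \<inter> {t1..t2})" using that by auto
    then have "convex (?K1 \<inter> ?K2)" by (auto intro!: convex_Times convex_Int)
    then have con: "connected (?K1 \<inter> ?K2)" by (rule convex_connected)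
    have "\<exists>G. develops \<Delta> (?K1 \<union> ?K2) h G"
    proof -
      obtain G1 where G1: "develops \<Delta> ?K1 h G1" using q(1) unfolding Q_def by blast
      obtain G2 where G2: "develops \<Delta> ?K2 h G2" using q(2) unfolding Q_def by blast
      have s: "?K1 \<union> ?K2 \<subseteq> {0..1} \<times> {0..1}" by auto
      show ?thesis
        apply (rule develops_glue[OF coc \<open>open D\<close> _ _ con _ _ G1 G2])
           apply (intro closed_Times closed_Int closed_atLeastAtMost)
          apply (intro closed_Times closed_Int closed_atLeastAtMost)
         apply (rule continuous_on_subset[OF h(1) s])
        using h(2) s by blast
    qed
    then show ?thesis unfolding Q_def eq .
  qed
  have small: "\<exists>d>0. \<forall>s1 s2 t1 t2. s1 \<le> s \<and> s \<le> s2 \<and> s2 - s1 < d \<longrightarrow> t1 \<le> t \<and> t \<le> t2 \<and> t2 - t1 < d \<longrightarrow> Q s1 s2 t1 t2"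
    if st: "s \<in> {0..1}" "t \<in> {0..1}" for s t
  proof -
    have "h (s,t) \<in> D" using h(2) st by auto
    then obtain r where r: "r > 0" "ball (h (s,t)) r \<subseteq> D" using \<open>open D\<close> open_contains_ball by blast
    obtain d where d: "d > 0" "\<And>w. w\<in>{0..1}\<times>{0..1} \<Longrightarrow> dist w (s,t) < d \<Longrightarrow> dist (h w) (h (s,t)) < r"
      using h(1) st r(1) unfolding continuous_on_iff by (metis SigmaI)
    \<comment> \<open>Side lengths below d/2 keep every point of the rectangle within d of (s,t),
      since the distance is at most the sum of the coordinate distances.\<close>
    have "Q s1 s2 t1 t2" if as: "s1 \<le> s \<and> s \<le> s2 \<and> s2 - s1 < d/2" "t1 \<le> t \<and> t \<le> t2 \<and> t2 - t1 < d/2" for s1 s2 t1 t2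
    proof -
      have "h ` (({0..1} \<inter> {s1..s2}) \<times> ({0..1} \<inter> {t1..t2})) \<subseteq> ball (h (s,t)) r"
      proof
        fix y assume "y \<in> h ` (({0..1} \<inter> {s1..s2}) \<times> ({0..1} \<inter> {t1..t2}))"
        then obtain a b where ab: "y = h (a,b)" "a \<in> {0..1}" "a \<in> {s1..s2}" "b \<in> {0..1}" "b \<in> {t1..t2}" by auto
        have "dist (a,b) (s,t) \<le> dist a s + dist b t"
          by (metis (no_types, lifting) dist_Pair_Pair sqrt_sum_squares_le_sum zero_le_dist)
        also have "\<dots> < d" using ab as by (auto simp: dist_real_def)
        finally show "y \<in> ball (h (s,t)) r" using d(2)[of "(a,b)"] ab by (auto simp: dist_commute)
      qed
      then show ?thesis using develops_ball[OF coc r(2)] unfolding Q_def by blast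
    qed
    then show ?thesis using d(1) by (intro exI[of _ "d/2"]) auto
  qed
  have strip: "\<exists>d>0. \<forall>s1 s2. s1 \<le> s \<and> s \<le> s2 \<and> s2 - s1 < d \<longrightarrow> Q s1 s2 0 1" if s: "s \<in> {0..1}" for s
  proof -
    define R where "R a b \<longleftrightarrow> (\<exists>d>0. \<forall>s1 s2. s1 \<le> s \<and> s \<le> s2 \<and> s2 - s1 < d \<longrightarrow> Q s1 s2 a b)" for a b
    have "R 0 1"
    proof (rule Bolzano)
      fix a b c :: real assume "R a b" "R b c" and le: "a \<le> b" "b \<le> c"
      then obtain d1 d2 where "d1>0" "d2>0" 
        and "\<And>s1 s2. s1 \<le> s \<and> s \<le> s2 \<and> s2 - s1 < d1 \<Longrightarrow> Q s1 s2 a b" 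
        and "\<And>s1 s2. s1 \<le> s \<and> s \<le> s2 \<and> s2 - s1 < d2 \<Longrightarrow> Q s1 s2 b c" 
        unfolding R_def by blast
      then show "R a c" unfolding R_def using gluet[OF _ _ le]
        by (intro exI[of _ "min d1 d2"]) (meson min_less_iff_conj)
    next
      fix t :: real assume t: "0 \<le> t" "t \<le> 1"
      then obtain d where "d>0" "\<forall>s1 s2 t1 t2. s1 \<le> s \<and> s \<le> s2 \<and> s2 - s1 < d \<longrightarrow> t1 \<le> t \<and> t \<le> t2 \<and> t2 - t1 < d \<longrightarrow> Q s1 s2 t1 t2"
        using small[OF s, of t] by auto
      then show "\<exists>d>0. \<forall>a b. a \<le> t \<and> t \<le> b \<and> b - a < d \<longrightarrow> R a b" unfolding R_def by blast
    qed simp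
    then show ?thesis unfolding R_def .
  qed
  have "Q 0 1 0 1"
  proof (rule Bolzano[where P = "\<lambda>a b. Q a b 0 1"])
    fix a b c :: real assume "Q a b 0 1" "Q b c 0 1" "a \<le> b" "b \<le> c"
    then show "Q a c 0 1" using glues by blast
  next
    fix s :: real assume "0 \<le> s" "s \<le> 1"
    then show "\<exists>d>0. \<forall>a b. a \<le> s \<and> s \<le> b \<and> b - a < d \<longrightarrow> Q a b 0 1" using strip[of s] by auto
  qed simp
  then show ?thesis unfolding Q_def by simp
qed

text \<open>A path is treated as a square that is constant in its first coordinate.\<close>

lemma develops_path_exists:
  fixes p :: "real \<Rightarrow> 'a::metric_space"
  assumes coc: "local_cocycle D \<Delta>" and "open D" and p: "path p" "path_image p \<subseteq> D"
  shows "\<exists>g. develops \<Delta> {0..1} p g"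
proof -
  have "continuous_on ({0..1::real} \<times> {0..1}) (p \<circ> snd)"
    using p(1) unfolding path_def by (intro continuous_on_compose continuous_intros) auto
  moreover have "(p \<circ> snd) ` ({0..1::real} \<times> {0..1}) \<subseteq> D" using p(2) unfolding path_image_def by auto
  ultimately have "\<exists>G. develops \<Delta> ({0..1::real} \<times> {0..1}) (p \<circ> snd) G"
    by (rule develops_square_exists[OF coc \<open>open D\<close>])
  then obtain G where G: "develops \<Delta> ({0..1::real} \<times> {0..1}) (p \<circ> snd) G" ..
  have c: "continuous_on {0..1} (\<lambda>t::real. (a,t))" "continuous_on {0..1} (\<lambda>t::real. (t,a))" for a :: real
    by (rule continuous_on_Pair continuous_on_const continuous_on_id)+
  have "develops \<Delta> {0..1} (p \<circ> snd \<circ> (\<lambda>t. (0::real,t))) (G \<circ> (\<lambda>t. (0::real,t)))"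
    by (rule develops_compose[OF G c(1)]) auto
  then show ?thesis by (auto simp: o_def)
qed

text \<open>Develop the whole homotopy square. Two opposite edges are the given paths; the other two
  are constant because endpoints stay fixed, and a constant path has increment 0. Comparing the
  edges gives equal increments.\<close>

lemma develops_homotopic:
  assumes coc: "local_cocycle D \<Delta>" and "open D" and hom: "homotopic_paths D p q"
    and g: "develops \<Delta> {0..1} p g" "develops \<Delta> {0..1} q g'"
  shows "g 1 - g 0 = g' 1 - g' 0"
proof -
  obtain h where h: "continuous_on ({0..1} \<times> {0..1}) h" "h \<in> ({0..1} \<times> {0..1}) \<rightarrow> D"
    "\<And>x. x \<in> {0..1} \<Longrightarrow> h (0,x) = p x" "\<And>x. x \<in> {0..1} \<Longrightarrow> h (1,x) = q x"
    "\<And>t::real. t \<in> {0..1} \<Longrightarrow> pathstart (h \<circ> Pair t) = pathstart p" 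
    "\<And>t::real. t \<in> {0..1} \<Longrightarrow> pathfinish (h \<circ> Pair t) = pathfinish p"
    using hom unfolding homotopic_paths by blast
  have im: "h ` ({0..1} \<times> {0..1}) \<subseteq> D" using h(2) by blast
  obtain G where G: "develops \<Delta> ({0..1} \<times> {0..1}) h G"
    using develops_square_exists[OF coc \<open>open D\<close> h(1) im] by blast
  have cong: "develops \<Delta> {0..1::real} k g \<Longrightarrow> (\<And>t. t \<in> {0..1} \<Longrightarrow> k t = k' t) \<Longrightarrow> develops \<Delta> {0..1} k' g" for k k' g
    unfolding develops_def by auto
  have I: "connected {0..1::real}" by simp
  have c: "continuous_on {0..1} (\<lambda>t::real. (a,t))" "continuous_on {0..1} (\<lambda>t::real. (t,a))" for a :: real
    by (rule continuous_on_Pair continuous_on_const continuous_on_id)+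
  have P: "develops \<Delta> {0..1} p (G \<circ> (\<lambda>t. (0,t)))"
    by (rule cong[OF develops_compose[OF G c(1)[of 0]]]) (auto simp: h(3))
  have Q: "develops \<Delta> {0..1} q (G \<circ> (\<lambda>t. (1,t)))"
    by (rule cong[OF develops_compose[OF G c(1)[of 1]]]) (auto simp: h(4))
  have const: "develops \<Delta> {0..1} (\<lambda>_. c) (\<lambda>_::real. 0)" if c: "c \<in> D" for c
  proof -
    obtain r where r: "r > 0" "ball c r \<subseteq> D" by (rule openE[OF \<open>open D\<close> c])
    have "\<Delta> c c + \<Delta> c c = \<Delta> c c" using local_cocycleD[OF coc r(2), of c c c] r(1) by simp
    then have "\<Delta> c c = 0" by simp
    then show ?thesis unfolding develops_def by (auto intro: exI[of _ 1])
  qed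
  have p0: "pathstart p \<in> D" "pathfinish p \<in> D"
    using homotopic_paths_imp_subset[OF hom] pathstart_in_path_image pathfinish_in_path_image by blast+
  have S: "develops \<Delta> {0..1} (\<lambda>_. pathstart p) (G \<circ> (\<lambda>s. (s,0)))"
    by (rule cong[OF develops_compose[OF G c(2)[of 0]]]) 
       (use h(5) in \<open>auto simp: pathstart_def\<close>)
  have T: "develops \<Delta> {0..1} (\<lambda>_. pathfinish p) (G \<circ> (\<lambda>s. (s,1)))"
    by (rule cong[OF develops_compose[OF G c(2)[of 1]]]) 
       (use h(6) in \<open>auto simp: pathfinish_def\<close>)
  have "G (1,0) - G (0,0) = 0" using develops_unique[OF I S const[OF p0(1)], of 0 1] by simp
  moreover have "G (1,1) - G (0,1) = 0" using develops_unique[OF I T const[OF p0(2)], of 0 1] by simp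
  moreover have "g 1 - g 0 = G (0,1) - G (0,0)" using develops_unique[OF I g(1) P, of 0 1] by simp
  moreover have "g' 1 - g' 0 = G (1,1) - G (1,0)" using develops_unique[OF I g(2) Q, of 0 1] by simp
  ultimately show ?thesis by simp
qed

text \<open>The potential at a point is the increment along some path from a base point, independent
  of the path by simple connectivity. Extending a path to x by the segment to y shows that the
  potential changes by \<Delta> x y.\<close>

proposition local_cocycle_trivial:
  fixes D :: "'a::real_normed_vector set"
  assumes coc: "local_cocycle D \<Delta>" and "open D" and sc: "simply_connected D"
  shows "\<exists>f. \<forall>c r. ball c r \<subseteq> D \<longrightarrow> (\<forall>x\<in>ball c r. \<forall>y\<in>ball c r. f y - f x = \<Delta> x y)"
proof (cases "D = {}")
  case False
  then obtain a where a: "a \<in> D" by blast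
  have pc: "path_connected D" 
    and hom: "\<And>p q. path p \<Longrightarrow> path_image p \<subseteq> D \<Longrightarrow> path q \<Longrightarrow> path_image q \<subseteq> D \<Longrightarrow>
       pathstart q = pathstart p \<Longrightarrow> pathfinish q = pathfinish p \<Longrightarrow> homotopic_paths D p q"
    using sc unfolding simply_connected_eq_homotopic_paths by blast+
  have "\<forall>x\<in>D. \<exists>p. path p \<and> path_image p \<subseteq> D \<and> pathstart p = a \<and> pathfinish p = x"
    using pc a unfolding path_connected_def by blast
  then obtain p where p: "\<And>x. x \<in> D \<Longrightarrow> path (p x) \<and> path_image (p x) \<subseteq> D \<and> pathstart (p x) = a \<and> pathfinish (p x) = x"
    by metis
  have "\<forall>x\<in>D. \<exists>g. develops \<Delta> {0..1} (p x) g" using develops_path_exists[OF coc \<open>open D\<close>] p by blast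
  then obtain g where g: "\<And>x. x \<in> D \<Longrightarrow> develops \<Delta> {0..1} (p x) (g x)" by metis
  define f where "f x = g x 1 - g x 0" for x
  have step: "f y - f x = \<Delta> x y" if B: "ball c r \<subseteq> D" and x: "x \<in> ball c r" and y: "y \<in> ball c r" for c r x y
  proof -
    have xD: "x \<in> D" and yD: "y \<in> D" using B x y by auto
    have seg: "closed_segment x y \<subseteq> ball c r" using x y by (simp add: closed_segment_subset)
    define q where "q = p x +++ linepath x y"
    have q: "path q" "path_image q \<subseteq> D" "pathstart q = a" "pathfinish q = y"
      using p[OF xD] seg B unfolding q_def by (auto simp: path_image_join)
    obtain G where G: "develops \<Delta> {0..1} q G" using develops_path_exists[OF coc \<open>open D\<close> q(1,2)] by blast
    have "f y = G 1 - G 0"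
      unfolding f_def using p[OF yD] q by (intro develops_homotopic[OF coc \<open>open D\<close> hom g[OF yD] G]) auto
    have cong: "develops \<Delta> {0..1::real} k g \<Longrightarrow> (\<And>t. t \<in> {0..1} \<Longrightarrow> k t = k' t) \<Longrightarrow> develops \<Delta> {0..1} k' g" for k k' g
      unfolding develops_def by auto
    \<comment> \<open>The development of the joined path is cut into its two halves by the
      reparametrisations t/2 and 1/2 + t/2.\<close>
    have G1: "develops \<Delta> {0..1} (p x) (G \<circ> (\<lambda>t. t/2))"
      by (rule cong[OF develops_compose[OF G, of "{0..1}" "\<lambda>t. t/2"]])
         (auto intro!: continuous_intros simp: q_def joinpaths_def)
    have G2: "develops \<Delta> {0..1} (linepath x y) (G \<circ> (\<lambda>t. 1/2 + t/2))"
    proof (rule cong[OF develops_compose[OF G, of "{0..1}" "\<lambda>t. 1/2+t/2"]])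
      fix t :: real assume t: "t \<in> {0..1}"
      show "(q \<circ> (\<lambda>t. 1/2 + t/2)) t = linepath x y t"
      \<comment> \<open>At parameter 1/2 the joined path is evaluated on its first half, so the
        starting point of the segment has to be recovered as the endpoint of
        \<open>p x\<close>.\<close>
      proof (cases "t = 0")
        case True
        then show ?thesis using p[OF xD] by (simp add: q_def joinpaths_def linepath_def pathfinish_def)
      next
        case False
        then show ?thesis using t by (simp add: q_def joinpaths_def)
      qed
    qed (auto intro!: continuous_intros)
    have I: "connected {0..1::real}" by simp
    have "G (1/2) - G 0 = f x" unfolding f_def using develops_unique[OF I G1 g[OF xD], of 0 1] by simp
    moreover have "G 1 - G (1/2) = \<Delta> c y - \<Delta> c x"
    proof -
      have "linepath x y ` {0..1} \<subseteq> ball c r" using seg path_image_linepath[of x y] unfolding path_image_def by simp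
      from develops_unique[OF I G2 develops_ball[OF coc B this], of 0 1] show ?thesis
        by (simp add: linepath_def)
    qed
    moreover have "\<Delta> c x + \<Delta> x y = \<Delta> c y"
      using x y by (intro local_cocycleD[OF coc B]) (auto intro: le_less_trans[OF zero_le_dist])
    ultimately have "\<Delta> x y = G 1 - G (1/2)" "f x = G (1/2) - G 0" by (metis add_diff_cancel_left')+
    then show ?thesis using \<open>f y = G 1 - G 0\<close> by simp
  qed
  then show ?thesis by blast
qed (auto simp: ball_empty intro!: exI[of _ "\<lambda>_. 0"])

subsection \<open>Calculus of smooth maps\<close>

lemma frechet_derivative_cong_open:
  assumes "open S" "x \<in> S" "\<And>y. y \<in> S \<Longrightarrow> f y = g y" "f differentiable (at x)"
  shows "g differentiable (at x)" "frechet_derivative g (at x) = frechet_derivative f (at x)"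
proof -
  have "(f has_derivative frechet_derivative f (at x)) (at x)"
    using assms(4) frechet_derivative_works by blast
  then have "(g has_derivative frechet_derivative f (at x)) (at x)"
    by (rule has_derivative_transform_within_open[OF _ assms(1,2,3)])
  then show "g differentiable (at x)" "frechet_derivative g (at x) = frechet_derivative f (at x)"
    using frechet_derivative_at differentiableI by (blast, metis)
qed

lemma Ck_on_cong:
  assumes "open S" "Ck_on m S f" "\<And>x. x \<in> S \<Longrightarrow> f x = g x"
  shows "Ck_on m S g"
  using assms(2,3)
proof (induction m arbitrary: f g)
  case 0
  then show ?case by (metis Ck_on.simps(1) continuous_on_cong)
next
  case (Suc m)
  have "f differentiable (at x)" if "x \<in> S" for x
    using Suc.prems(1) that \<open>open S\<close> by (simp add: differentiable_on_eq_differentiable_at)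
  note fr = frechet_derivative_cong_open[OF \<open>open S\<close> _ Suc.prems(2) this]
  have "g differentiable_on S"
    using fr(1) by (simp add: differentiable_at_imp_differentiable_on)
  moreover have "Ck_on m S (\<lambda>x. frechet_derivative g (at x) v)" for v
    by (rule Suc.IH[of "\<lambda>x. frechet_derivative f (at x) v"]) (use Suc.prems(1) fr(2) in auto)
  ultimately show ?case by simp
qed

lemma Ck_on_has_derivative:
  assumes "open S" "Ck_on (Suc m) S f" "x \<in> S"
  shows "(f has_derivative frechet_derivative f (at x)) (at x)"
  using assms by (simp add: differentiable_on_eq_differentiable_at flip: frechet_derivative_works)

text \<open>Replaces the chosen \<open>frechet_derivative\<close> in the recursion by any explicit
  derivative formula, which is how all later closure properties are proved.\<close>

lemma Ck_on_SucI:
  assumes "open S" "\<And>x. x \<in> S \<Longrightarrow> (f has_derivative f' x) (at x)" "\<And>v. Ck_on m S (\<lambda>x. f' x v)"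
  shows "Ck_on (Suc m) S f"
proof -
  have "f differentiable_on S"
    using assms(2) by (meson differentiable_at_imp_differentiable_on differentiableI)
  moreover have "Ck_on m S (\<lambda>x. frechet_derivative f (at x) v)" for v
    by (rule Ck_on_cong[OF assms(1) assms(3)[of v]]) (simp add: frechet_derivative_at[OF assms(2), symmetric])
  ultimately show ?thesis by simp
qed

lemma Ck_on_SucD: "Ck_on (Suc m) S f \<Longrightarrow> Ck_on m S f"
proof (induction m arbitrary: f)
  case 0
  then show ?case by (simp add: differentiable_imp_continuous_on)
next
  case (Suc m)
  then show ?case by (metis Ck_on.simps(2))
qed

lemma Ck_on_continuous_on: "Ck_on m S f \<Longrightarrow> continuous_on S f"
  by (induction m arbitrary: f) (auto simp: differentiable_imp_continuous_on)

lemma Ck_on_const: "open S \<Longrightarrow> Ck_on m S (\<lambda>x. c)"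
proof (induction m arbitrary: c)
  case (Suc m)
  then show ?case by (intro Ck_on_SucI[where f' = "\<lambda>x h. 0"]) auto
qed auto

lemma Ck_on_add:
  assumes "open S" "Ck_on m S f" "Ck_on m S g"
  shows "Ck_on m S (\<lambda>x. f x + g x)"
  using assms(2,3)
proof (induction m arbitrary: f g)
  case (Suc m)
  show ?case
  proof (rule Ck_on_SucI[OF assms(1)])
    show "((\<lambda>x. f x + g x) has_derivative (\<lambda>h. frechet_derivative f (at x) h + frechet_derivative g (at x) h)) (at x)"
      if "x \<in> S" for x
      using Suc.prems that by (intro has_derivative_add Ck_on_has_derivative[OF assms(1)])
  qed (use Suc in auto)
qed (auto intro: continuous_on_add)

lemma Ck_on_bounded_linear:
  assumes "open S" "bounded_linear L" "Ck_on m S f"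
  shows "Ck_on m S (\<lambda>x. L (f x))"
  using assms(3)
proof (induction m arbitrary: f)
  case 0
  then show ?case using assms(2) by (auto intro: bounded_linear.continuous_on)
next
  case (Suc m)
  show ?case
  proof (rule Ck_on_SucI[OF assms(1)])
    show "((\<lambda>x. L (f x)) has_derivative (\<lambda>h. L (frechet_derivative f (at x) h))) (at x)" if "x \<in> S" for x
      using Suc.prems that by (intro bounded_linear.has_derivative[OF assms(2)] Ck_on_has_derivative[OF assms(1)])
  qed (use Suc in auto)
qed

lemma Ck_on_bounded_bilinear:
  assumes "open S" "bounded_bilinear B" "Ck_on m S f" "Ck_on m S g"
  shows "Ck_on m S (\<lambda>x. B (f x) (g x))"
  using assms(3,4)
proof (induction m arbitrary: f g)
  case 0
  then show ?case using assms(2) by (auto intro: bounded_bilinear.continuous_on)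
next
  case (Suc m)
  show ?case
  proof (rule Ck_on_SucI[OF assms(1)])
    show "((\<lambda>x. B (f x) (g x)) has_derivative
       (\<lambda>h. B (f x) (frechet_derivative g (at x) h) + B (frechet_derivative f (at x) h) (g x))) (at x)" if "x \<in> S" for x
      using Suc.prems that by (intro bounded_bilinear.FDERIV[OF assms(2)] Ck_on_has_derivative[OF assms(1)])
    show "Ck_on m S (\<lambda>x. B (f x) (frechet_derivative g (at x) v) + B (frechet_derivative f (at x) v) (g x))" for v
      using Suc.prems Ck_on_SucD[OF Suc.prems(1)] Ck_on_SucD[OF Suc.prems(2)]
      by (intro Ck_on_add[OF assms(1)] Suc.IH) auto
  qed
qed

text \<open>Factors that do not depend on \<lambda> must still be smooth on the product of D with
  the \<lambda>-plane.\<close>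

lemma Ck_on_fst:
  assumes "open S" "Ck_on m S f"
  shows "Ck_on m (S \<times> UNIV) (\<lambda>z. f (fst z))"
  using assms(2)
proof (induction m arbitrary: f)
  case 0
  then show ?case by (auto intro!: continuous_on_compose2[of S f] continuous_intros)
next
  case (Suc m)
  have o: "open (S \<times> UNIV)" using assms(1) by (intro open_Times) auto
  show ?case
  proof (rule Ck_on_SucI[OF o])
    fix z :: "'a \<times> 'c" assume z: "z \<in> S \<times> UNIV"
    have "(f has_derivative frechet_derivative f (at (fst z))) (at (fst z))"
      using z by (intro Ck_on_has_derivative[OF assms(1) Suc.prems]) auto
    then show "((\<lambda>z. f (fst z)) has_derivative (\<lambda>h. frechet_derivative f (at (fst z)) (fst h))) (at z)"
      using has_derivative_compose[OF has_derivative_fst[OF has_derivative_ident], where g = f] by blast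
  qed (use Suc in auto)
qed

text \<open>The exponent is arbitrary because differentiation lowers it by one and the induction has
  to follow; the application is exponent -1/2, for normalising tangent vectors.\<close>

lemma Ck_on_powr:
  fixes f :: "'a::real_normed_vector \<Rightarrow> real"
  assumes "open S" "Ck_on m S f" "\<And>x. x \<in> S \<Longrightarrow> f x > 0"
  shows "Ck_on m S (\<lambda>x. f x powr a)"
  using assms(2)
proof (induction m arbitrary: a)
  case 0
  then show ?case using assms(3) by (auto intro!: continuous_intros) force
next
  case (Suc m)
  show ?case
  proof (rule Ck_on_SucI[OF assms(1)])
    fix x assume x: "x \<in> S"
    have "((\<lambda>t. t powr a) has_real_derivative a * f x powr (a - 1)) (at (f x))"
      using assms(3)[OF x] by (auto intro!: derivative_eq_intros)
    from has_derivative_compose[OF Ck_on_has_derivative[OF assms(1) Suc.prems x] this[unfolded has_field_derivative_def]]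
    show "((\<lambda>x. f x powr a) has_derivative (\<lambda>h. a * f x powr (a - 1) * frechet_derivative f (at x) h)) (at x)" .
  next
    show "Ck_on m S (\<lambda>x. a * f x powr (a - 1) * frechet_derivative f (at x) v)" for v
      using Suc.prems Ck_on_SucD[OF Suc.prems]
      by (intro Ck_on_bounded_bilinear[OF assms(1) bounded_bilinear_mult] Suc.IH Ck_on_const[OF assms(1)]) auto
  qed
qed

lemma smooth_on_Ck: "smooth_on S f \<Longrightarrow> Ck_on m S f"
  by (simp add: smooth_on_def)

lemma smooth_on_const: "open S \<Longrightarrow> smooth_on S (\<lambda>x. c)"
  by (simp add: smooth_on_def Ck_on_const)

lemma smooth_on_add: "open S \<Longrightarrow> smooth_on S f \<Longrightarrow> smooth_on S g \<Longrightarrow> smooth_on S (\<lambda>x. f x + g x)"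
  by (simp add: smooth_on_def Ck_on_add)

lemma smooth_on_bounded_linear: "open S \<Longrightarrow> bounded_linear L \<Longrightarrow> smooth_on S f \<Longrightarrow> smooth_on S (\<lambda>x. L (f x))"
  by (simp add: smooth_on_def Ck_on_bounded_linear)

lemma smooth_on_bounded_bilinear:
  "open S \<Longrightarrow> bounded_bilinear B \<Longrightarrow> smooth_on S f \<Longrightarrow> smooth_on S g \<Longrightarrow> smooth_on S (\<lambda>x. B (f x) (g x))"
  by (simp add: smooth_on_def Ck_on_bounded_bilinear)

lemma smooth_on_powr:
  fixes f :: "'a::real_normed_vector \<Rightarrow> real"
  shows "open S \<Longrightarrow> smooth_on S f \<Longrightarrow> (\<And>x. x \<in> S \<Longrightarrow> f x > 0) \<Longrightarrow> smooth_on S (\<lambda>x. f x powr a)"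
  by (simp add: smooth_on_def Ck_on_powr)

lemma smooth_on_frechet_derivative: "smooth_on S f \<Longrightarrow> smooth_on S (\<lambda>x. frechet_derivative f (at x) v)"
  unfolding smooth_on_def using Ck_on.simps(2) by blast

lemma smooth_on_has_derivative:
  "open S \<Longrightarrow> smooth_on S f \<Longrightarrow> x \<in> S \<Longrightarrow> (f has_derivative frechet_derivative f (at x)) (at x)"
  unfolding smooth_on_def using Ck_on_has_derivative by blast

lemma smooth_on_pd: "smooth_on S f \<Longrightarrow> smooth_on S (pd f i)"
  unfolding pd_def[abs_def] by (rule smooth_on_frechet_derivative)

lemma smooth_on_sum:
  assumes "open S" "\<And>i. i \<in> I \<Longrightarrow> smooth_on S (f i)"
  shows "smooth_on S (\<lambda>x. \<Sum>i\<in>I. f i x)"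
  using assms(2) by (induction I rule: infinite_finite_induct)
    (auto intro: smooth_on_add[OF assms(1)] smooth_on_const[OF assms(1)])

lemma bounded_linear_axis: "bounded_linear (axis i :: 'a::real_normed_vector \<Rightarrow> 'a^'n)"
proof
  show "axis i (x + y) = axis i x + axis i y" for x y :: 'a by (simp add: vec_eq_iff axis_def)
  show "axis i (r *\<^sub>R x) = r *\<^sub>R axis i x" for r and x :: 'a by (simp add: vec_eq_iff axis_def)
  show "\<exists>K. \<forall>x. norm (axis i x :: 'a^'n) \<le> norm x * K"
  proof (intro exI allI)
    fix x :: 'a
    have "norm (axis i x :: 'a^'n) \<le> (\<Sum>j\<in>UNIV. norm ((axis i x :: 'a^'n) $ j))" 
      unfolding norm_vec_def by (rule L2_set_le_sum) simp
    also have "\<dots> = norm x" by (simp add: axis_def if_distrib cong: if_cong)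
    finally show "norm (axis i x :: 'a^'n) \<le> norm x * 1" by simp
  qed
qed

text \<open>Writes a vector as a finite sum of bounded linear images of its entries, so smoothness
  and derivatives of vectors and matrices reduce to their entries.\<close>

lemma vec_lambda_sum_axis: "(\<chi> i. f i) = (\<Sum>i\<in>UNIV. axis i (f i :: 'a::real_normed_vector))"
  by (simp add: vec_eq_iff axis_def if_distrib sum.delta cong: if_cong)

lemma smooth_on_vec_lambda:
  assumes "open S" "\<And>i. smooth_on S (\<lambda>x. f x i)"
  shows "smooth_on S (\<lambda>x. \<chi> i. f x i)"
  unfolding vec_lambda_sum_axis
  by (intro smooth_on_sum smooth_on_bounded_linear[OF _ bounded_linear_axis] assms)

lemma smooth_on_vec_nth: "open S \<Longrightarrow> smooth_on S f \<Longrightarrow> smooth_on S (\<lambda>x. f x $ i)"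
  by (rule smooth_on_bounded_linear[OF _ bounded_linear_vec_nth])

lemma smooth_on_fst: "open S \<Longrightarrow> smooth_on S f \<Longrightarrow> smooth_on (S \<times> UNIV) (\<lambda>z. f (fst z))"
  by (simp add: smooth_on_def Ck_on_fst)

section \<open>Symmetry of second derivatives\<close>

lemma directional_mvt:
  fixes f :: "'a::real_normed_vector \<Rightarrow> real"
  assumes "s > 0" "\<And>t. 0 \<le> t \<Longrightarrow> t \<le> s \<Longrightarrow> (f has_derivative f' (y + t *\<^sub>R v)) (at (y + t *\<^sub>R v))"
  shows "\<exists>t. 0 < t \<and> t < s \<and> f (y + s *\<^sub>R v) - f y = s * f' (y + t *\<^sub>R v) v"
proof -
  have "((\<lambda>t. f (y + t *\<^sub>R v)) has_real_derivative f' (y + t *\<^sub>R v) v) (at t)" if "0 \<le> t" "t \<le> s" for t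
  proof -
    note d = assms(2)[OF that]
    have "((\<lambda>t. y + t *\<^sub>R v) has_derivative (\<lambda>h. h *\<^sub>R v)) (at t)" by (auto intro!: derivative_eq_intros)
    from has_derivative_compose[OF this d] have "((\<lambda>t. f (y + t *\<^sub>R v)) has_derivative (\<lambda>h. f' (y + t *\<^sub>R v) (h *\<^sub>R v))) (at t)" .
    moreover have "f' (y + t *\<^sub>R v) (h *\<^sub>R v) = f' (y + t *\<^sub>R v) v * h" for h
      using linear_cmul[OF has_derivative_linear[OF d], of h v] by simp
    ultimately show ?thesis by (simp add: has_field_derivative_def)
  qed
  from MVT2[OF assms(1) this] show ?thesis by (auto simp: mult.commute)
qed

text \<open>Two applications of the mean value theorem: along v to the increment of f by s w, then
  along w to the derivative of f in direction v.\<close>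

lemma second_difference:
  fixes f :: "'a::real_normed_vector \<Rightarrow> real"
  assumes "s > 0" and S: "\<And>a b. 0 \<le> a \<Longrightarrow> a \<le> s \<Longrightarrow> 0 \<le> b \<Longrightarrow> b \<le> s \<Longrightarrow> x + a *\<^sub>R v + b *\<^sub>R w \<in> S"
    and f: "\<And>y. y \<in> S \<Longrightarrow> (f has_derivative f' y) (at y)"
    and f': "\<And>y. y \<in> S \<Longrightarrow> ((\<lambda>z. f' z v) has_derivative f'' y) (at y)"
  shows "\<exists>a b. 0 < a \<and> a < s \<and> 0 < b \<and> b < s \<and>
     f (x + s *\<^sub>R v + s *\<^sub>R w) - f (x + s *\<^sub>R v) - (f (x + s *\<^sub>R w) - f x) = s * (s * f'' (x + a *\<^sub>R v + b *\<^sub>R w) w)"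
proof -
  have "((\<lambda>y. f (y + s *\<^sub>R w) - f y) has_derivative (\<lambda>h. f' (x + t *\<^sub>R v + s *\<^sub>R w) h - f' (x + t *\<^sub>R v) h)) (at (x + t *\<^sub>R v))"
    if t: "0 \<le> t" "t \<le> s" for t
  proof (rule has_derivative_diff)
    have "((\<lambda>y. y + s *\<^sub>R w) has_derivative (\<lambda>h. h)) (at (x + t *\<^sub>R v))" by (auto intro!: derivative_eq_intros)
    from has_derivative_compose[OF this f] show "((\<lambda>y. f (y + s *\<^sub>R w)) has_derivative f' (x + t *\<^sub>R v + s *\<^sub>R w)) (at (x + t *\<^sub>R v))"
      using S[of t s] t \<open>s > 0\<close> by auto
    show "(f has_derivative f' (x + t *\<^sub>R v)) (at (x + t *\<^sub>R v))" using S[of t 0] t f \<open>s > 0\<close> by auto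
  qed
  from directional_mvt[where f' = "\<lambda>y h. f' (y + s *\<^sub>R w) h - f' y h", OF \<open>s > 0\<close> this]
  obtain a where a: "0 < a" "a < s" and
    1: "f (x + s *\<^sub>R v + s *\<^sub>R w) - f (x + s *\<^sub>R v) - (f (x + s *\<^sub>R w) - f x) = s * (f' (x + a *\<^sub>R v + s *\<^sub>R w) v - f' (x + a *\<^sub>R v) v)"
    by auto
  have "((\<lambda>z. f' z v) has_derivative f'' (x + a *\<^sub>R v + t *\<^sub>R w)) (at (x + a *\<^sub>R v + t *\<^sub>R w))" if "0 \<le> t" "t \<le> s" for t
    using f' S[of a t] a that by auto
  from directional_mvt[where f' = f'', OF \<open>s > 0\<close> this] 1 a show ?thesis by metis
qed

text \<open>The second difference over a small parallelogram is symmetric in v and w, and divided by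
  s^2 it is a value of either mixed derivative at some nearby point; continuity brings both points
  to x.\<close>

lemma second_derivative_symmetric_real:
  fixes f :: "'a::real_normed_vector \<Rightarrow> real"
  assumes "open S" "x \<in> S" and f: "\<And>y. y \<in> S \<Longrightarrow> (f has_derivative f' y) (at y)"
    and fv: "\<And>y. y \<in> S \<Longrightarrow> ((\<lambda>z. f' z v) has_derivative fv y) (at y)"
    and fw: "\<And>y. y \<in> S \<Longrightarrow> ((\<lambda>z. f' z w) has_derivative fw y) (at y)"
    and cont: "continuous_on S (\<lambda>y. fv y w)" "continuous_on S (\<lambda>y. fw y v)"
  shows "fv x w = fw x v"
proof (rule ccontr)
  assume ne: "fv x w \<noteq> fw x v"
  \<comment> \<open>Half of the supposed gap: two numbers within this distance of the two values
    cannot coincide.\<close>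
  define e where "e = \<bar>fv x w - fw x v\<bar> / 2"
  have e: "e > 0" using ne by (simp add: e_def)
  obtain r where r: "r > 0" "ball x r \<subseteq> S" by (rule openE[OF assms(1,2)])
  obtain d1 where d1: "d1 > 0" "\<And>y. y \<in> S \<Longrightarrow> dist y x < d1 \<Longrightarrow> dist (fv y w) (fv x w) < e"
    using cont(1) e assms(2) unfolding continuous_on_iff by blast
  obtain d2 where d2: "d2 > 0" "\<And>y. y \<in> S \<Longrightarrow> dist y x < d2 \<Longrightarrow> dist (fw y v) (fw x v) < e"
    using cont(2) e assms(2) unfolding continuous_on_iff by blast
  define d where "d = min r (min d1 d2)"
  \<comment> \<open>Makes the parallelogram with sides s v and s w stay within d/2 of x; the summand
    1 keeps the denominator positive when both directions vanish.\<close>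
  define s where "s = d / (2 * (norm v + norm w + 1))"
  have pos: "norm v + norm w + 1 > 0" using norm_ge_zero[of v] norm_ge_zero[of w] by linarith
  have d: "d > 0" using r d1 d2 by (simp add: d_def)
  have s: "s > 0" using d pos by (simp add: s_def)
  have small: "dist (x + a *\<^sub>R v + b *\<^sub>R w) x < d" if "0 \<le> a" "a \<le> s" "0 \<le> b" "b \<le> s" for a b
  proof -
    have "dist (x + a *\<^sub>R v + b *\<^sub>R w) x \<le> a * norm v + b * norm w"
      using that norm_triangle_ineq[of "a *\<^sub>R v" "b *\<^sub>R w"] by (simp add: dist_norm add.assoc)
    also have "\<dots> \<le> s * norm v + s * norm w" using that by (intro add_mono mult_right_mono) auto
    also have "\<dots> \<le> s * (norm v + norm w + 1)" using s by (simp add: algebra_simps)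
    also have "\<dots> = d / 2" using pos unfolding s_def by (simp add: divide_simps)
    also have "\<dots> < d" using d by simp
    finally show ?thesis .
  qed
  have inS: "x + a *\<^sub>R v + b *\<^sub>R w \<in> S" if "0 \<le> a" "a \<le> s" "0 \<le> b" "b \<le> s" for a b
    using small[OF that] r(2) by (auto simp: d_def dist_commute)
  have inS': "x + a *\<^sub>R w + b *\<^sub>R v \<in> S" if "0 \<le> a" "a \<le> s" "0 \<le> b" "b \<le> s" for a b
    using inS[of b a] that by (simp add: algebra_simps)
  obtain a b where ab: "0 < a" "a < s" "0 < b" "b < s" and
     1: "f (x + s *\<^sub>R v + s *\<^sub>R w) - f (x + s *\<^sub>R v) - (f (x + s *\<^sub>R w) - f x) = s * (s * fv (x + a *\<^sub>R v + b *\<^sub>R w) w)"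
    using second_difference[OF s inS f fv] by blast
  obtain a' b' where ab': "0 < a'" "a' < s" "0 < b'" "b' < s" and
     2: "f (x + s *\<^sub>R w + s *\<^sub>R v) - f (x + s *\<^sub>R w) - (f (x + s *\<^sub>R v) - f x) = s * (s * fw (x + a' *\<^sub>R w + b' *\<^sub>R v) v)"
    using second_difference[OF s inS' f fw] by blast
  have swap: "x + s *\<^sub>R w + s *\<^sub>R v = x + s *\<^sub>R v + s *\<^sub>R w" by (simp add: algebra_simps)
  have "s * (s * fv (x + a *\<^sub>R v + b *\<^sub>R w) w) = s * (s * fw (x + a' *\<^sub>R w + b' *\<^sub>R v) v)"
    using 1 2[unfolded swap] by linarith
  then have "fv (x + a *\<^sub>R v + b *\<^sub>R w) w = fw (x + a' *\<^sub>R w + b' *\<^sub>R v) v"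
    using s by simp
  then have eq: "fv (x + a *\<^sub>R v + b *\<^sub>R w) w = fw (x + b' *\<^sub>R v + a' *\<^sub>R w) v"
    by (simp add: algebra_simps)
  have "dist (fv (x + a *\<^sub>R v + b *\<^sub>R w) w) (fv x w) < e"
    using small[of a b] inS[of a b] ab by (intro d1) (auto simp: d_def)
  moreover have "dist (fw (x + b' *\<^sub>R v + a' *\<^sub>R w) v) (fw x v) < e"
    using small[of b' a'] inS[of b' a'] ab' by (intro d2) (auto simp: d_def)
  ultimately show False using eq unfolding e_def dist_real_def by (auto simp: abs_if split: if_splits)
qed

proposition second_derivative_symmetric:
  fixes f :: "'a::real_normed_vector \<Rightarrow> 'b::euclidean_space"
  assumes S: "open S" "x \<in> S" and f: "Ck_on 2 S f"
  shows "frechet_derivative (\<lambda>y. frechet_derivative f (at y) v) (at x) w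
       = frechet_derivative (\<lambda>y. frechet_derivative f (at y) w) (at x) v"
proof (rule euclidean_eqI)
  fix b :: 'b assume "b \<in> Basis"
  have C: "Ck_on (Suc (Suc 0)) S f" using f by (simp add: numeral_2_eq_2 del: Ck_on.simps)
  have C': "Ck_on (Suc 0) S (\<lambda>y. frechet_derivative f (at y) v)" for v using C by simp
  have d: "((\<lambda>y. frechet_derivative f (at y) v \<bullet> b) has_derivative (\<lambda>h. frechet_derivative (\<lambda>y. frechet_derivative f (at y) v) (at y) h \<bullet> b)) (at y)" if "y \<in> S" for y v
    by (intro has_derivative_inner_left Ck_on_has_derivative[OF S(1) C' that])
  have c: "continuous_on S (\<lambda>y. frechet_derivative (\<lambda>y. frechet_derivative f (at y) v) (at y) w \<bullet> b)" for v w
    using C'[of v] by (intro continuous_intros) auto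
  show "frechet_derivative (\<lambda>y. frechet_derivative f (at y) v) (at x) w \<bullet> b
       = frechet_derivative (\<lambda>y. frechet_derivative f (at y) w) (at x) v \<bullet> b"
  proof (rule second_derivative_symmetric_real[OF S, where f = "\<lambda>y. f y \<bullet> b" and f' = "\<lambda>y h. frechet_derivative f (at y) h \<bullet> b"
      and fv = "\<lambda>y h. frechet_derivative (\<lambda>y. frechet_derivative f (at y) v) (at y) h \<bullet> b"
      and fw = "\<lambda>y h. frechet_derivative (\<lambda>y. frechet_derivative f (at y) w) (at y) h \<bullet> b"])
    show "((\<lambda>y. f y \<bullet> b) has_derivative (\<lambda>h. frechet_derivative f (at y) h \<bullet> b)) (at y)" if "y \<in> S" for y
      by (intro has_derivative_inner_left Ck_on_has_derivative[OF S(1) C that])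
  qed (rule d c; assumption?)+
qed

lemma pd_commute:
  fixes f :: "real^'n \<Rightarrow> 'b::euclidean_space"
  assumes "open S" "x \<in> S" "smooth_on S f"
  shows "pd (pd f i) j x = pd (pd f j) i x"
  using second_derivative_symmetric[OF assms(1,2) smooth_on_Ck[OF assms(3)]]
  unfolding pd_def[abs_def] .

subsection \<open>Exactness of closed one-forms\<close>

text \<open>The line integral along a straight segment, kept as a function of both endpoints because
  it is the cocycle fed into \<open>local_cocycle_trivial\<close>.\<close>

definition segment_integral :: "('a::real_normed_vector \<Rightarrow> 'a \<Rightarrow> 'b::euclidean_space) \<Rightarrow> 'a \<Rightarrow> 'a \<Rightarrow> 'b" where
  "segment_integral A x y = integral {0..1} (\<lambda>t. A (x + t *\<^sub>R (y - x)) (y - x))"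

lemma linear_basis_expansion:
  fixes f :: "'a::euclidean_space \<Rightarrow> 'b::real_vector"
  assumes "linear f"
  shows "f x = (\<Sum>b\<in>Basis. (x \<bullet> b) *\<^sub>R f b)"
proof -
  have "f x = f (\<Sum>b\<in>Basis. (x \<bullet> b) *\<^sub>R b)" by (simp add: euclidean_representation)
  also have "\<dots> = (\<Sum>b\<in>Basis. (x \<bullet> b) *\<^sub>R f b)"
    by (simp add: linear_sum[OF assms] linear_cmul[OF assms])
  finally show ?thesis .
qed

lemma segment_in_convex:
  assumes "convex U" "x \<in> U" "y \<in> U" "t \<in> {0..1::real}"
  shows "x + t *\<^sub>R (y - x) \<in> U"
proof -
  have "x + t *\<^sub>R (y - x) = (1 - t) *\<^sub>R x + t *\<^sub>R y" by (simp add: algebra_simps)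
  then show ?thesis using assms by (simp add: convexD)
qed

lemma has_vector_derivative_segment:
  assumes "(f has_derivative f') (at (x + t *\<^sub>R v))"
  shows "((\<lambda>t. f (x + t *\<^sub>R v)) has_vector_derivative f' v) (at t within T)"
proof -
  have "((\<lambda>t. x + t *\<^sub>R v) has_derivative (\<lambda>h. h *\<^sub>R v)) (at t within T)" by (auto intro!: derivative_eq_intros)
  from has_derivative_compose[OF this assms]
  show ?thesis
    using linear_cmul[OF has_derivative_linear[OF assms]] by (simp add: has_vector_derivative_def)
qed

lemma segment_integral_eq:
  assumes "convex U" "x \<in> U" "y \<in> U" "\<And>z. z \<in> U \<Longrightarrow> (f has_derivative A z) (at z)"
  shows "segment_integral A x y = f y - f x"
proof -
  have "((\<lambda>t. A (x + t *\<^sub>R (y - x)) (y - x)) has_integral f (x + 1 *\<^sub>R (y - x)) - f (x + 0 *\<^sub>R (y - x))) {0..1}"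
    by (rule fundamental_theorem_of_calculus[where f = "\<lambda>t. f (x + t *\<^sub>R (y - x))"])
       (use has_vector_derivative_segment[OF assms(4)[OF segment_in_convex[OF assms(1-3)]]] in auto)
  then show ?thesis unfolding segment_integral_def by (simp add: integral_unique)
qed

text \<open>The Poincare lemma on a convex set. Differentiating under the integral gives an
  integrand which, by the symmetry of \<open>A'\<close>, is the t-derivative of t A(x0 + t (y - x0))
  h; this primitive runs from 0 to A y h.\<close>

lemma segment_integral_has_derivative:
  fixes A :: "'a::euclidean_space \<Rightarrow> 'a \<Rightarrow> 'b::euclidean_space"
  assumes U: "open U" "convex U" "x0 \<in> U" "y \<in> U"
    and lin: "\<And>x. x \<in> U \<Longrightarrow> linear (A x)"
    and der: "\<And>x v. x \<in> U \<Longrightarrow> ((\<lambda>z. A z v) has_derivative (\<lambda>h. A' x h v)) (at x)"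
    and sym: "\<And>x h v. x \<in> U \<Longrightarrow> A' x h v = A' x v h"
    and cont: "\<And>h v. continuous_on U (\<lambda>x. A' x h v)"
  shows "(segment_integral A x0 has_derivative A y) (at y)"
proof -
  let ?p = "\<lambda>y t. x0 + t *\<^sub>R (y - x0)"
  have pU: "?p y t \<in> U" if "y \<in> U" "t \<in> {0..1}" for y t using segment_in_convex[OF U(2,3) that] .
  have lin1: "linear (\<lambda>h. A' x h v)" if "x \<in> U" for x v using has_derivative_linear[OF der[OF that]] .
  have lin2: "linear (A' x h)" if "x \<in> U" for x h 
  proof -
    have "A' x h = (\<lambda>v. A' x v h)" using sym[OF that] by blast
    then show ?thesis using lin1[OF that, of h] by simp
  qed
  have A_exp: "A x v = (\<Sum>b\<in>Basis. (v \<bullet> b) *\<^sub>R A x b)" if "x \<in> U" for x v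
    by (rule linear_basis_expansion[OF lin[OF that]])
  have A'_exp: "A' x h v = (\<Sum>b\<in>Basis. (v \<bullet> b) *\<^sub>R A' x h b)" if "x \<in> U" for x h v
    by (rule linear_basis_expansion[OF lin2[OF that]])
  have contA: "continuous_on U (\<lambda>x. A x v)" for v
    using der by (meson continuous_at_imp_continuous_on has_derivative_continuous)
  \<comment> \<open>The derivative in y of the integrand: one term from the vector argument, one
    from the base point, the latter with the chain rule factor t.\<close>
  define D where "D y t h = A (?p y t) h + t *\<^sub>R A' (?p y t) h (y - x0)" for y t h
  have blD: "bounded_linear (D y t)" if "y \<in> U" "t \<in> {0..1}" for y t
    unfolding D_def linear_conv_bounded_linear[symmetric]
    by (intro linear_compose_add linear_compose_scale_right lin lin1 pU that)
  have contD: "continuous_on (U \<times> {0..1}) (\<lambda>(y,t). D y t h)" for h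
  proof -
    have p: "continuous_on (U \<times> {0..1}) (\<lambda>z. ?p (fst z) (snd z))" by (intro continuous_intros)
    have pim: "(\<lambda>z. ?p (fst z) (snd z)) ` (U \<times> {0..1}) \<subseteq> U" using pU by auto
    \<comment> \<open>Continuity of \<open>A'\<close> is known only for fixed vectors, but here its
      last argument varies with y; expanding over \<open>Basis\<close> leaves fixed vectors and
      scalar coefficients.\<close>
    have "continuous_on (U \<times> {0..1}) (\<lambda>z. A (?p (fst z) (snd z)) h + snd z *\<^sub>R (\<Sum>b\<in>Basis. ((fst z - x0) \<bullet> b) *\<^sub>R A' (?p (fst z) (snd z)) h b))"
      by (intro continuous_intros continuous_on_compose2[OF contA p pim] continuous_on_compose2[OF cont p pim])
    then show ?thesis
      by (rule continuous_on_eq) (auto simp: D_def A'_exp[OF pU, symmetric])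
  qed
  have L: "((\<lambda>y. integral (cbox 0 1) (\<lambda>t. A (?p y t) (y - x0))) has_derivative integral (cbox 0 1) (\<lambda>t. Blinfun (D y t))) (at y within U)"
  proof (rule leibniz_rule[OF _ _ _ U(4,2)])
    fix y and t :: real assume y: "y \<in> U" and "t \<in> cbox 0 1"
    then have t: "t \<in> {0..1}" by simp
    have inner: "((\<lambda>y. ?p y t) has_derivative (\<lambda>h. t *\<^sub>R h)) (at y)" by (auto intro!: derivative_eq_intros)
    have "((\<lambda>y. A (?p y t) b) has_derivative (\<lambda>h. A' (?p y t) (t *\<^sub>R h) b)) (at y)" for b
      using has_derivative_compose[OF inner der[OF pU[OF y t]]] .
    then have d: "((\<lambda>y. \<Sum>b\<in>Basis. ((y - x0) \<bullet> b) *\<^sub>R A (?p y t) b) has_derivative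
        (\<lambda>h. \<Sum>b\<in>Basis. ((y - x0) \<bullet> b) *\<^sub>R A' (?p y t) (t *\<^sub>R h) b + (h \<bullet> b) *\<^sub>R A (?p y t) b)) (at y)"
      by (intro has_derivative_sum has_derivative_scaleR) (auto intro!: derivative_eq_intros)
    have "(\<Sum>b\<in>Basis. ((y - x0) \<bullet> b) *\<^sub>R A' (?p y t) (t *\<^sub>R h) b + (h \<bullet> b) *\<^sub>R A (?p y t) b) = D y t h" for h
      unfolding sum.distrib A'_exp[OF pU[OF y t], symmetric] A_exp[OF pU[OF y t], symmetric] D_def
      by (simp add: linear_cmul[OF lin1[OF pU[OF y t]]])
    then have e: "(\<lambda>h. \<Sum>b\<in>Basis. ((y - x0) \<bullet> b) *\<^sub>R A' (?p y t) (t *\<^sub>R h) b + (h \<bullet> b) *\<^sub>R A (?p y t) b) = D y t"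
      by blast
    note d[unfolded e]
    then have "((\<lambda>y. A (?p y t) (y - x0)) has_derivative D y t) (at y)"
      by (rule has_derivative_transform_within_open[OF _ U(1) y]) (rule A_exp[OF pU[OF _ t], symmetric])
    then show "((\<lambda>y. A (?p y t) (y - x0)) has_derivative blinfun_apply (Blinfun (D y t))) (at y within U)"
      unfolding bounded_linear_Blinfun_apply[OF blD[OF y t]] by (rule has_derivative_at_withinI)
  next
    fix y assume y: "y \<in> U"
    have p: "continuous_on {0..1} (?p y)" by (intro continuous_intros)
    have pim: "?p y ` {0..1} \<subseteq> U" using pU y by auto
    show "(\<lambda>t. A (?p y t) (y - x0)) integrable_on cbox 0 1"
      by (auto intro!: integrable_continuous_real continuous_on_compose2[OF contA p pim])
  next
    show "continuous_on (U \<times> cbox 0 1) (\<lambda>(y, t). Blinfun (D y t))"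
    proof (rule continuous_on_blinfun_componentwise)
      fix i :: 'a
      show "continuous_on (U \<times> cbox 0 1) (\<lambda>z. blinfun_apply (case z of (y, t) \<Rightarrow> Blinfun (D y t)) i)"
        unfolding cbox_interval
        by (rule continuous_on_eq[OF contD[of i]]) (auto simp: bounded_linear_Blinfun_apply[OF blD])
    qed
  qed
  have "blinfun_apply (integral (cbox 0 1) (\<lambda>t. Blinfun (D y t))) h = A y h" for h
  proof -
    have "(\<lambda>t. Blinfun (D y t)) integrable_on cbox 0 1"
    proof (intro integrable_continuous continuous_on_blinfun_componentwise)
      fix i :: 'a
      have "continuous_on {0..1::real} (\<lambda>t. (y, t))" by (rule continuous_on_Pair continuous_on_const continuous_on_id)+
      then have "continuous_on {0..1} (\<lambda>t. (case (y,t) of (y,t) \<Rightarrow> D y t i))"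
        by (rule continuous_on_compose2[OF contD[of i]]) (use U(4) in auto)
      then show "continuous_on (cbox 0 1) (\<lambda>t. blinfun_apply (Blinfun (D y t)) i)"
        by (auto simp: bounded_linear_Blinfun_apply[OF blD[OF U(4)]] elim!: continuous_on_eq)
    qed
    then have "blinfun_apply (integral (cbox 0 1) (\<lambda>t. Blinfun (D y t))) h = integral (cbox 0 1) (\<lambda>t. blinfun_apply (Blinfun (D y t)) h)"
      by (rule blinfun_apply_integral)
    also have "\<dots> = integral {0..1} (\<lambda>t. D y t h)"
      by (auto intro!: integral_cong simp: bounded_linear_Blinfun_apply[OF blD[OF U(4)]])
    also have "\<dots> = A y h"
    proof (rule integral_unique)
      have "((\<lambda>t. D y t h) has_integral (1 *\<^sub>R A (?p y 1) h - 0 *\<^sub>R A (?p y 0) h)) {0..1}"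
      proof (rule fundamental_theorem_of_calculus[where f = "\<lambda>t. t *\<^sub>R A (?p y t) h"])
        fix t :: real assume t: "t \<in> {0..1}"
        have "((\<lambda>t. A (?p y t) h) has_vector_derivative A' (?p y t) (y - x0) h) (at t within {0..1})"
          by (rule has_vector_derivative_segment[OF der[OF pU[OF U(4) t]]])
        from has_vector_derivative_scaleR[OF DERIV_ident this]
        show "((\<lambda>t. t *\<^sub>R A (?p y t) h) has_vector_derivative D y t h) (at t within {0..1})"
          using sym[OF pU[OF U(4) t]] by (simp add: D_def add.commute)
      qed simp
      then show "((\<lambda>t. D y t h) has_integral A y h) {0..1}" by simp
    qed
    finally show ?thesis .
  qed
  then have R: "blinfun_apply (integral (cbox 0 1) (\<lambda>t. Blinfun (D y t))) = A y" by (rule ext)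
  show ?thesis
    using L[unfolded R at_within_open[OF U(4,1)]] unfolding segment_integral_def[abs_def] cbox_interval .
qed

text \<open>On a ball, segment integrals are differences of a local potential and hence add up.
  Their global potential agrees near x with a constant plus the segment integral from x, whose
  derivative is known.\<close>

theorem closed_form_exact:
  fixes A :: "'a::euclidean_space \<Rightarrow> 'a \<Rightarrow> 'b::euclidean_space"
  assumes D: "open D" "simply_connected D"
    and lin: "\<And>x. x \<in> D \<Longrightarrow> linear (A x)"
    and der: "\<And>x v. x \<in> D \<Longrightarrow> ((\<lambda>z. A z v) has_derivative (\<lambda>h. A' x h v)) (at x)"
    and sym: "\<And>x h v. x \<in> D \<Longrightarrow> A' x h v = A' x v h"
    and cont: "\<And>h v. continuous_on D (\<lambda>x. A' x h v)"
  shows "\<exists>f. \<forall>x\<in>D. (f has_derivative A x) (at x)"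
proof -
  have loc: "(segment_integral A x has_derivative A y) (at y)" if "ball c r \<subseteq> D" "x \<in> ball c r" "y \<in> ball c r" for c r x y
  proof (rule segment_integral_has_derivative[of "ball c r" _ _ _ A'])
    show "continuous_on (ball c r) (\<lambda>x. A' x h v)" for h v
      by (rule continuous_on_subset[OF cont that(1)])
    show "((\<lambda>z. A z v) has_derivative (\<lambda>h. A' x h v)) (at x)" if "x \<in> ball c r" for x v
      using der that \<open>ball c r \<subseteq> D\<close> by blast
    show "A' x h v = A' x v h" if "x \<in> ball c r" for x h v
      using sym that \<open>ball c r \<subseteq> D\<close> by blast
    show "linear (A x)" if "x \<in> ball c r" for x
      using lin that \<open>ball c r \<subseteq> D\<close> by blast
  qed (use that in auto)
  have seg: "segment_integral A y z = segment_integral A x z - segment_integral A x y"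
    if "ball c r \<subseteq> D" "x \<in> ball c r" "y \<in> ball c r" "z \<in> ball c r" for c r x y z
    by (rule segment_integral_eq[of "ball c r"]) (use that loc in auto)
  have "local_cocycle D (segment_integral A)"
    unfolding local_cocycle_def
  proof (intro allI impI ballI)
    fix c r x y z assume "ball c r \<subseteq> D" "x \<in> ball c r" "y \<in> ball c r" "z \<in> ball c r"
    from seg[OF this] show "segment_integral A x y + segment_integral A y z = segment_integral A x z" by simp
  qed
  from local_cocycle_trivial[OF this D] obtain f where
    f: "\<And>c r x y. ball c r \<subseteq> D \<Longrightarrow> x \<in> ball c r \<Longrightarrow> y \<in> ball c r \<Longrightarrow> f y - f x = segment_integral A x y" by blast
  have "(f has_derivative A x) (at x)" if x: "x \<in> D" for x
  proof -
    obtain r where r: "r > 0" "ball x r \<subseteq> D" by (rule openE[OF D(1) x])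
    have "((\<lambda>y. f x + segment_integral A x y) has_derivative A x) (at x)"
      using has_derivative_add[OF has_derivative_const loc[OF r(2), of x x]] r by simp
    moreover have "f x + segment_integral A x y = f y" if "y \<in> ball x r" for y
      using f[OF r(2) _ that, of x] r(1) by (metis add.commute centre_in_ball diff_add_cancel)
    ultimately show ?thesis
      using has_derivative_transform_within_open[of _ _ x UNIV "ball x r" f] r(1) by fastforce
  qed
  then show ?thesis by (intro exI ballI)
qed

subsection \<open>Iterated primitives\<close>

lemma bounded_bilinear_matrix_mult:
  "bounded_bilinear ((**) :: 'a::{euclidean_space,real_normed_algebra_1}^'m^'k \<Rightarrow> 'a^'l^'m \<Rightarrow> 'a^'l^'k)"
  unfolding bilinear_conv_bounded_bilinear[symmetric] bilinear_def
  by (intro conjI allI linearI)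
     (simp_all add: vec_eq_iff matrix_matrix_mult_def sum.distrib algebra_simps scaleR_sum_right)

interpretation matrix_mult: bounded_bilinear "(**) :: 'a::{euclidean_space,real_normed_algebra_1}^'m^'k \<Rightarrow> 'a^'l^'m \<Rightarrow> 'a^'l^'k"
  by (rule bounded_bilinear_matrix_mult)

text \<open>Derivatives on the product of D with the \<lambda>-plane are taken over the reals, so
  complex scaling enters as a real bilinear map obeying the product rule.\<close>

definition cscale :: "complex \<Rightarrow> complex^'n^'m \<Rightarrow> complex^'n^'m" where
  "cscale l = map_matrix ((*) l)"

definition cscale_real :: "complex \<Rightarrow> real^'n^'m \<Rightarrow> complex^'n^'m" where
  "cscale_real l A = cscale l (cmat A)"

lemma cscale_nth [simp]: "cscale l A $ i $ j = l * A $ i $ j"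
  by (simp add: cscale_def)

lemma cmat_nth [simp]: "cmat A $ i $ j = complex_of_real (A $ i $ j)"
  by (simp add: cmat_def)

lemma cscale_real_nth [simp]: "cscale_real l A $ i $ j = l * complex_of_real (A $ i $ j)"
  by (simp add: cscale_real_def)

lemma bounded_bilinear_cscale: "bounded_bilinear (cscale :: complex \<Rightarrow> complex^'n^'m \<Rightarrow> _)"
  unfolding bilinear_conv_bounded_bilinear[symmetric] bilinear_def
  by (intro conjI allI linearI) (simp_all add: vec_eq_iff algebra_simps)

lemma bounded_bilinear_cscale_real: "bounded_bilinear (cscale_real :: complex \<Rightarrow> real^'n^'m \<Rightarrow> _)"
  unfolding bilinear_conv_bounded_bilinear[symmetric] bilinear_def
  by (intro conjI allI linearI) (simp_all add: vec_eq_iff algebra_simps scaleR_conv_of_real[where 'a = complex])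

lemma bounded_linear_cmat: "bounded_linear (cmat :: real^'n^'m \<Rightarrow> _)"
  unfolding linear_conv_bounded_linear[symmetric]
  by (intro linearI) (simp_all add: vec_eq_iff scaleR_conv_of_real[where 'a = complex])

interpretation cscale: bounded_bilinear "cscale :: complex \<Rightarrow> complex^'n^'m \<Rightarrow> _"
  by (rule bounded_bilinear_cscale)

interpretation cscale_real: bounded_bilinear "cscale_real :: complex \<Rightarrow> real^'n^'m \<Rightarrow> _"
  by (rule bounded_bilinear_cscale_real)

lemma cmat_mult: "cmat (A ** B) = cmat A ** cmat B"
  by (simp add: vec_eq_iff matrix_matrix_mult_def)

lemma cscale_mult_left: "cscale l A ** B = cscale l (A ** B)"
  by (simp add: vec_eq_iff matrix_matrix_mult_def sum_distrib_left mult.assoc)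

lemma cscale_mult_right: "A ** cscale l B = cscale l (A ** B)"
  by (simp add: vec_eq_iff matrix_matrix_mult_def sum_distrib_left mult.left_commute)

text \<open>If df = g dZ, the form f dZ is closed: its derivative consists of f times the second
  derivative of Z, symmetric for every smooth map, and of g times a product of two values of dZ,
  symmetric by commutation. The primitive then satisfies the same hypothesis, with f in the role of
  g.\<close>

lemma path_ordered_sequence_exists:
  fixes Z :: "'a::euclidean_space \<Rightarrow> real^'m^'m"
  assumes D: "open D" "simply_connected D" "x0 \<in> D"
    and Z: "smooth_on D Z"
    and comm: "\<And>x h v. x \<in> D \<Longrightarrow> frechet_derivative Z (at x) h ** frechet_derivative Z (at x) v
                = frechet_derivative Z (at x) v ** frechet_derivative Z (at x) h"
  shows "\<exists>P. (P 0 = (\<lambda>x. mat 1)) \<and> (\<forall>m. P (Suc m) x0 = 0) \<and>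
    (\<forall>m. \<forall>x\<in>D. (P (Suc m) has_derivative (\<lambda>h. P m x ** frechet_derivative Z (at x) h)) (at x))"
proof -
  define DZ where "DZ x = frechet_derivative Z (at x)" for x
  define D2 where "D2 x h v = frechet_derivative (\<lambda>y. DZ y v) (at x) h" for x h v
  have step: "\<exists>f'. f' x0 = 0 \<and> (\<forall>x\<in>D. (f' has_derivative (\<lambda>h. f x ** DZ x h)) (at x))"
    if g: "continuous_on D g" "\<And>x. x \<in> D \<Longrightarrow> (f has_derivative (\<lambda>h. g x ** DZ x h)) (at x)" for f g :: "'a \<Rightarrow> real^'m^'m"
  proof -
    have sm: "smooth_on D (\<lambda>x. DZ x v)" for v unfolding DZ_def by (rule smooth_on_frechet_derivative[OF Z])
    have "\<exists>f'. \<forall>x\<in>D. (f' has_derivative (\<lambda>h. f x ** DZ x h)) (at x)"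
    proof (rule closed_form_exact[OF D(1,2), where A' = "\<lambda>x h v. f x ** D2 x h v + (g x ** DZ x h) ** DZ x v"])
      fix x assume x: "x \<in> D"
      have lin: "linear (DZ x)"
        unfolding DZ_def by (rule has_derivative_linear[OF smooth_on_has_derivative[OF D(1) Z x]])
      show "linear (\<lambda>h. f x ** DZ x h)"
        using linear_compose[OF lin bounded_linear.linear[OF matrix_mult.bounded_linear_right[of "f x"]]] by (simp add: o_def)
    next
      fix x v assume x: "x \<in> D"
      have "((\<lambda>z. DZ z v) has_derivative (\<lambda>h. D2 x h v)) (at x)"
        unfolding D2_def by (rule smooth_on_has_derivative[OF D(1) sm x])
      from matrix_mult.FDERIV[OF g(2)[OF x] this]
      show "((\<lambda>z. f z ** DZ z v) has_derivative (\<lambda>h. f x ** D2 x h v + (g x ** DZ x h) ** DZ x v)) (at x)" .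
    next
      fix x h v assume x: "x \<in> D"
      have "D2 x h v = D2 x v h"
        unfolding D2_def DZ_def by (rule second_derivative_symmetric[OF D(1) x smooth_on_Ck[OF Z]])
      moreover have "(g x ** DZ x h) ** DZ x v = (g x ** DZ x v) ** DZ x h"
        using comm[OF x, of h v] unfolding DZ_def by (simp add: matrix_mul_assoc[symmetric])
      ultimately show "f x ** D2 x h v + (g x ** DZ x h) ** DZ x v = f x ** D2 x v h + (g x ** DZ x v) ** DZ x h" by simp
    next
      fix h v
      have "continuous_on D f" using g(2) by (meson continuous_at_imp_continuous_on has_derivative_continuous)
      moreover have "continuous_on D (\<lambda>x. DZ x v)" for v
        using Ck_on_continuous_on smooth_on_Ck[OF sm] by blast
      moreover have "continuous_on D (\<lambda>x. D2 x h v)"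
        unfolding D2_def using Ck_on_continuous_on smooth_on_Ck[OF smooth_on_frechet_derivative[OF sm]] by blast
      ultimately show "continuous_on D (\<lambda>x. f x ** D2 x h v + (g x ** DZ x h) ** DZ x v)"
        using g(1) by (intro continuous_on_add matrix_mult.continuous_on)
    qed
    then obtain f' where f': "\<And>x. x \<in> D \<Longrightarrow> (f' has_derivative (\<lambda>h. f x ** DZ x h)) (at x)" by blast
    have "((\<lambda>y. f' y - f' x0) has_derivative (\<lambda>h. f x ** DZ x h)) (at x)" if "x \<in> D" for x
      using has_derivative_diff[OF f'[OF that] has_derivative_const[of "f' x0"]] by simp
    then show ?thesis by (intro exI[of _ "\<lambda>y. f' y - f' x0"]) simp
  qed
  \<comment> \<open>The invariant carries the predecessor \<open>g\<close> along, since the next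
    closedness check needs to know the derivative of \<open>f\<close>; for the constant start one
    takes g = 0.\<close>
  define I where "I n f \<longleftrightarrow> (n = 0 \<longrightarrow> f = (\<lambda>x. mat 1)) \<and> 
     (\<exists>g. continuous_on D g \<and> (\<forall>x\<in>D. (f has_derivative (\<lambda>h. g x ** DZ x h)) (at x)))" for n :: nat and f :: "'a \<Rightarrow> real^'m^'m"
  define Q where "Q n f f' \<longleftrightarrow> f' x0 = 0 \<and> (\<forall>x\<in>D. (f' has_derivative (\<lambda>h. f x ** DZ x h)) (at x))" for n :: nat and f f' :: "'a \<Rightarrow> real^'m^'m"
  have "\<exists>P. \<forall>n. I n (P n) \<and> Q n (P n) (P (Suc n))"
  proof (rule dependent_nat_choice)
    have "I 0 (\<lambda>x. mat 1)"
      unfolding I_def by (auto intro!: exI[of _ "\<lambda>x. 0"] simp: matrix_mult.zero_left)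
    then show "\<exists>f. I 0 f" by blast
  next
    fix f n assume "I n f"
    then obtain g where g: "continuous_on D g" "\<And>x. x \<in> D \<Longrightarrow> (f has_derivative (\<lambda>h. g x ** DZ x h)) (at x)"
      unfolding I_def by blast
    then have "continuous_on D f" by (meson continuous_at_imp_continuous_on has_derivative_continuous)
    moreover obtain f' where "f' x0 = 0" "\<forall>x\<in>D. (f' has_derivative (\<lambda>h. f x ** DZ x h)) (at x)"
      using step[OF g] by blast
    ultimately show "\<exists>f'. I (Suc n) f' \<and> Q n f f'" unfolding I_def Q_def by blast
  qed
  then show ?thesis unfolding I_def Q_def DZ_def by metis
qed

text \<open>The sum of the norms on basis vectors dominates the operator norm and is continuous,
  hence bounded near x.\<close>

lemma derivative_locally_bounded:
  fixes Z :: "'a::euclidean_space \<Rightarrow> 'b::real_normed_vector"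
  assumes D: "open D" "x \<in> D" and Z: "smooth_on D Z"
  shows "\<exists>r>0. \<exists>L\<ge>0. ball x r \<subseteq> D \<and> (\<forall>y\<in>ball x r. \<forall>h. norm (frechet_derivative Z (at y) h) \<le> L * norm h)"
proof -
  define s where "s y = (\<Sum>b\<in>Basis. norm (frechet_derivative Z (at y) b))" for y
  have "continuous_on D s"
    unfolding s_def using Ck_on_continuous_on smooth_on_Ck[OF smooth_on_frechet_derivative[OF Z]]
    by (intro continuous_on_sum continuous_on_norm) blast
  then obtain d where d: "d > 0" "\<And>y. y \<in> D \<Longrightarrow> dist y x < d \<Longrightarrow> dist (s y) (s x) < 1"
    using D(2) unfolding continuous_on_iff by (metis zero_less_one)
  obtain r where r: "r > 0" "ball x r \<subseteq> D" by (rule openE[OF D])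
  have spos: "s y \<ge> 0" for y unfolding s_def by (intro sum_nonneg) auto
  have "norm (frechet_derivative Z (at y) h) \<le> (s x + 1) * norm h" if y: "y \<in> ball x (min d r)" for y h
  proof -
    have yD: "y \<in> D" using y r by auto
    have lin: "linear (frechet_derivative Z (at y))"
      by (rule has_derivative_linear[OF smooth_on_has_derivative[OF D(1) Z yD]])
    have "norm (frechet_derivative Z (at y) h) = norm (\<Sum>b\<in>Basis. (h \<bullet> b) *\<^sub>R frechet_derivative Z (at y) b)"
      using linear_basis_expansion[OF lin, of h] by simp
    also have "\<dots> \<le> (\<Sum>b\<in>Basis. norm h * norm (frechet_derivative Z (at y) b))"
      by (intro sum_norm_le) (auto intro!: mult_right_mono Basis_le_norm)
    also have "\<dots> = s y * norm h" by (simp add: s_def sum_distrib_left mult.commute)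
    also have "\<dots> \<le> (s x + 1) * norm h"
      using d(2)[OF yD] y by (intro mult_right_mono) (auto simp: dist_commute dist_real_def)
    finally show ?thesis .
  qed
  then show ?thesis using d(1) r spos[of x] by (intro exI[of _ "min d r"] exI[of _ "s x + 1"] conjI) auto
qed

subsection \<open>Power series in the spectral parameter\<close>

text \<open>The Weierstrass test for termwise differentiation: tails of the derivative series are
  bounded, uniformly in x and relative to \<open>norm h\<close>, by tails of
  \<open>M\<close>.\<close>

proposition has_derivative_suminf:
  fixes f :: "nat \<Rightarrow> 'a::real_normed_vector \<Rightarrow> 'b::banach"
  assumes S: "convex S" "open S"
    and f: "\<And>n x. x \<in> S \<Longrightarrow> (f n has_derivative f' n x) (at x)"
    and bound: "\<And>n x h. x \<in> S \<Longrightarrow> norm (f' n x h) \<le> M n * norm h"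
    and M: "summable M"
    and x0: "x0 \<in> S" "summable (\<lambda>n. f n x0)"
    and x: "x \<in> S"
  shows "summable (\<lambda>n. f n x)"
    and "((\<lambda>x. \<Sum>n. f n x) has_derivative (\<lambda>h. \<Sum>n. f' n x h)) (at x)"
proof -
  have sf': "summable (\<lambda>n. f' n x h)" if "x \<in> S" for x h
    by (rule summable_comparison_test'[where N = 0, OF summable_mult2[OF M, of "norm h"]]) (use bound[OF that] in auto)
  have "\<forall>\<^sub>F n in sequentially. \<forall>x\<in>S. \<forall>h. norm (sum (\<lambda>i. f' i x h) {..<n} - (\<Sum>n. f' n x h)) \<le> e * norm h"
    if e: "e > 0" for e
  proof -
    have "\<exists>N. \<forall>n\<ge>N. norm (\<Sum>i. M (i + n)) < e" by (rule suminf_exist_split[OF e M])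
    then obtain N where N: "\<And>n. n \<ge> N \<Longrightarrow> norm (\<Sum>i. M (i + n)) < e" by blast
    show ?thesis unfolding eventually_sequentially
    proof (intro exI allI impI ballI)
      fix n x and h :: 'a assume n: "N \<le> n" and x: "x \<in> S"
      have sM: "summable (\<lambda>i. M (i + n) * norm h)" by (intro summable_mult2 summable_ignore_initial_segment[OF M])
      have "(\<Sum>n. f' n x h) = (\<Sum>i. f' (i + n) x h) + sum (\<lambda>i. f' i x h) {..<n}"
        by (rule suminf_split_initial_segment[OF sf'[OF x]])
      then have "norm (sum (\<lambda>i. f' i x h) {..<n} - (\<Sum>n. f' n x h)) = norm (\<Sum>i. f' (i + n) x h)" by simp
      also have "\<dots> \<le> (\<Sum>i. M (i + n) * norm h)"
        by (rule norm_suminf_le[OF bound[OF x] sM])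
      also have "\<dots> = (\<Sum>i. M (i + n)) * norm h"
        by (rule suminf_mult2[symmetric, OF summable_ignore_initial_segment[OF M]])
      also have "\<dots> \<le> e * norm h" using N[OF n] by (intro mult_right_mono) auto
      finally show "norm (sum (\<lambda>i. f' i x h) {..<n} - (\<Sum>n. f' n x h)) \<le> e * norm h" .
    qed
  qed
  from has_derivative_series[OF S(1) has_derivative_at_withinI[OF f] this x0(1) summable_sums[OF x0(2)]]
  obtain g where g: "\<And>x. x \<in> S \<Longrightarrow> (\<lambda>n. f n x) sums g x \<and> (g has_derivative (\<lambda>h. \<Sum>n. f' n x h)) (at x within S)"
    by blast
  show "summable (\<lambda>n. f n x)" using g[OF x] sums_summable by blast
  have "(g has_derivative (\<lambda>h. \<Sum>n. f' n x h)) (at x)" using g[OF x] at_within_open[OF x S(2)] by simp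
  then show "((\<lambda>x. \<Sum>n. f n x) has_derivative (\<lambda>h. \<Sum>n. f' n x h)) (at x)"
    by (rule has_derivative_transform_within_open[OF _ S(2) x]) (use g sums_unique in blast)
qed

text \<open>The \<open>P m\<close> are the iterated path integrals of dZ from x0, that is, the
  Picard (Dyson) coefficients of dT = \<lambda> T dZ.\<close>

locale path_ordered_sequence =
  fixes D :: "'a::euclidean_space set" and Z :: "'a \<Rightarrow> real^'m^'m" and x0 :: 'a
    and P :: "nat \<Rightarrow> 'a \<Rightarrow> real^'m^'m"
  assumes D: "open D" "connected D" "x0 \<in> D"
    and Z: "smooth_on D Z"
    and P_0: "P 0 = (\<lambda>x. mat 1)"
    and P_Suc_base: "P (Suc m) x0 = 0"
    and P_Suc: "x \<in> D \<Longrightarrow> (P (Suc m) has_derivative (\<lambda>h. P m x ** frechet_derivative Z (at x) h)) (at x)"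
begin

abbreviation DZ :: "'a \<Rightarrow> 'a \<Rightarrow> real^'m^'m" where
  "DZ x \<equiv> frechet_derivative Z (at x)"

text \<open>If \<open>norm (P m y) \<le> A \<rho>^m\<close> at one point \<open>y\<close> of a ball, Gronwall's argument gives
  \<open>norm (P m z) \<le> A \<rho>^m exp (M |z - y| / \<rho>)\<close> on the ball, so decay faster than
  every geometric sequence propagates along \<open>D\<close>.\<close>

lemma decay_in_ball:
  assumes r: "ball x r \<subseteq> D" and M: "M \<ge> 0" "\<And>y (A::real^'m^'m) h. y \<in> ball x r \<Longrightarrow> norm (A ** DZ y h) \<le> M * norm A * norm h"
    and y: "y \<in> ball x r" and z: "z \<in> ball x r" and \<rho>: "\<rho> > 0"
    and A: "\<And>m. norm (P m y) \<le> A * \<rho> ^ m"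
  shows "norm (P m z) \<le> A * \<rho> ^ m * exp (M * norm (z - y) / \<rho>)"
  using z
proof (induction m arbitrary: z)
  case 0
  have "norm (P 0 z) \<le> A" using A[of 0] by (simp add: P_0)
  moreover have "A \<ge> 0" using A[of 0] by (simp add: order_trans[OF norm_ge_zero])
  then have "A * 1 \<le> A * exp (M * norm (z - y) / \<rho>)" using M(1) \<rho> by (intro mult_left_mono) auto
  ultimately show ?case by simp
next
  case (Suc m)
  define v where "v = z - y"
  have A0: "A \<ge> 0" using A[of 0] by (simp add: order_trans[OF norm_ge_zero])
  have seg: "y + t *\<^sub>R v \<in> ball x r" if "t \<in> {0..1}" for t
    unfolding v_def by (rule segment_in_convex[OF convex_ball y Suc.prems that])
  have der: "((\<lambda>t. P (Suc m) (y + t *\<^sub>R v)) has_vector_derivative P m (y + t *\<^sub>R v) ** DZ (y + t *\<^sub>R v) v) (at t within T)"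
    if "t \<in> {0..1}" for t T
    by (rule has_vector_derivative_segment[OF P_Suc]) (use seg[OF that] r in blast)
  \<comment> \<open>With this rate, M * (A * \<rho>^m * exp(c t)) * norm v equals A * \<rho>^(m+1) *
    c * exp(c t): the bound from the induction hypothesis is exactly the derivative of the next
    comparison function.\<close>
  let ?c = "M * norm v / \<rho>"
  have "norm (P (Suc m) (y + 1 *\<^sub>R v) - P (Suc m) (y + 0 *\<^sub>R v)) \<le> A * \<rho> ^ Suc m * exp (?c * 1) - A * \<rho> ^ Suc m * exp (?c * 0)"
  proof (rule differentiable_bound_general[OF zero_less_one, where f' = "\<lambda>t. P m (y + t *\<^sub>R v) ** DZ (y + t *\<^sub>R v) v"
      and f = "\<lambda>t. P (Suc m) (y + t *\<^sub>R v)"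
      and \<phi> = "\<lambda>t. A * \<rho> ^ Suc m * exp (?c * t)" and \<phi>' = "\<lambda>t. A * \<rho> ^ Suc m * (exp (?c * t) * ?c)"])
    show "continuous_on {0..1} (\<lambda>t. P (Suc m) (y + t *\<^sub>R v))"
      unfolding continuous_on_eq_continuous_within using has_vector_derivative_continuous[OF der] by blast
    show "continuous_on {0..1} (\<lambda>t. A * \<rho> ^ Suc m * exp (?c * t))" by (intro continuous_intros)
  next
    fix t :: real assume "0 < t" "t < 1"
    then have t: "t \<in> {0..1}" by simp
    show "((\<lambda>t. P (Suc m) (y + t *\<^sub>R v)) has_vector_derivative P m (y + t *\<^sub>R v) ** DZ (y + t *\<^sub>R v) v) (at t)"
      by (rule der[OF t])
    show "((\<lambda>t. A * \<rho> ^ Suc m * exp (?c * t)) has_vector_derivative A * \<rho> ^ Suc m * (exp (?c * t) * ?c)) (at t)"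
      unfolding has_real_derivative_iff_has_vector_derivative[symmetric] by (rule derivative_eq_intros refl | simp)+
    have "norm (P m (y + t *\<^sub>R v) ** DZ (y + t *\<^sub>R v) v) \<le> M * norm (P m (y + t *\<^sub>R v)) * norm v"
      by (rule M(2)[OF seg[OF t]])
    also have "\<dots> \<le> M * (A * \<rho> ^ m * exp (M * norm (y + t *\<^sub>R v - y) / \<rho>)) * norm v"
      by (intro mult_right_mono mult_left_mono Suc.IH seg[OF t] M(1)) auto
    also have "\<dots> = A * \<rho> ^ Suc m * (exp (?c * t) * ?c)"
      using \<rho> \<open>0 < t\<close> by (simp add: field_simps)
    finally show "norm (P m (y + t *\<^sub>R v) ** DZ (y + t *\<^sub>R v) v) \<le> A * \<rho> ^ Suc m * (exp (?c * t) * ?c)" .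
  qed
  then have "norm (P (Suc m) z - P (Suc m) y) \<le> A * \<rho> ^ Suc m * exp ?c - A * \<rho> ^ Suc m"
    by (simp add: v_def)
  then show ?case using A[of "Suc m"] norm_triangle_ineq2[of "P (Suc m) z" "P (Suc m) y"] unfolding v_def by linarith
qed

text \<open>Equivalent to an infinite radius of convergence of the power series with coefficients
  \<open>P m y\<close>.\<close>

definition decaying_at :: "'a \<Rightarrow> bool" where
  "decaying_at y \<longleftrightarrow> (\<forall>\<rho>>0. \<exists>A. \<forall>m. norm (P m y) \<le> A * \<rho> ^ m)"

text \<open>The ball is fixed before y, so decay at any one of its points spreads to all others.
  This makes decay a locally constant property and at the same time provides the uniform bounds for
  convergence.\<close>

lemma decaying_near:
  assumes x: "x \<in> D"
  shows "\<exists>r>0. ball x r \<subseteq> D \<and> (\<forall>y\<in>ball x r. decaying_at y \<longrightarrow>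
     (\<forall>\<rho>>0. \<exists>A. \<forall>m. \<forall>z\<in>ball x r. norm (P m z) \<le> A * \<rho> ^ m))"
proof -
  obtain r L where r: "r > 0" "ball x r \<subseteq> D" and L: "L \<ge> 0" "\<And>y h. y \<in> ball x r \<Longrightarrow> norm (DZ y h) \<le> L * norm h"
    using derivative_locally_bounded[OF D(1) x Z] by blast
  obtain K where K: "K > 0" "\<And>(A::real^'m^'m) (B::real^'m^'m). norm (A ** B) \<le> norm A * norm B * K"
    using matrix_mult.pos_bounded by blast
  have M: "norm (A ** DZ y h) \<le> (K * L) * norm A * norm h" if "y \<in> ball x r" for y h and A :: "real^'m^'m"
  proof -
    have "norm (A ** DZ y h) \<le> norm A * norm (DZ y h) * K" by (rule K(2))
    also have "\<dots> \<le> norm A * (L * norm h) * K" using L(2)[OF that] K(1) by (intro mult_right_mono mult_left_mono) auto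
    finally show ?thesis by (simp add: mult_ac)
  qed
  have KL: "K * L \<ge> 0" using K(1) L(1) by simp
  have "\<exists>A. \<forall>m. \<forall>z\<in>ball x r. norm (P m z) \<le> A * \<rho> ^ m" if y: "y \<in> ball x r" "decaying_at y" and \<rho>: "\<rho> > 0" for y \<rho>
  proof -
    obtain A where A: "\<And>m. norm (P m y) \<le> A * \<rho> ^ m" using y(2) \<rho> unfolding decaying_at_def by blast
    have A0: "A \<ge> 0" using A[of 0] by (simp add: order_trans[OF norm_ge_zero])
    \<comment> \<open>Two points of the ball are at most 2 r apart, so the growth factor of
      \<open>decay_in_ball\<close> is bounded independently of z and m.\<close>
    have "norm (P m z) \<le> (A * exp ((K * L) * (2 * r) / \<rho>)) * \<rho> ^ m" if z: "z \<in> ball x r" for m z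
    proof -
      have "norm (z - y) \<le> 2 * r"
        using y(1) z dist_triangle[of z y x] by (simp add: dist_norm[symmetric] dist_commute)
      then have "exp (K * L * norm (z - y) / \<rho>) \<le> exp ((K * L) * (2 * r) / \<rho>)"
        using KL \<rho> by (simp add: divide_right_mono mult_left_mono)
      then have "A * \<rho> ^ m * exp (K * L * norm (z - y) / \<rho>) \<le> A * \<rho> ^ m * exp ((K * L) * (2 * r) / \<rho>)"
        using A0 \<rho> by (intro mult_left_mono) auto
      with decay_in_ball[OF r(2) KL M y(1) z \<rho> A, of m] show ?thesis by (simp add: mult_ac)
    qed
    then show ?thesis by blast
  qed
  then show ?thesis using r by blast
qed

lemma decaying_base: "decaying_at x0"
  unfolding decaying_at_def
proof (intro allI impI exI)
  fix \<rho> :: real and m assume "\<rho> > 0"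
  then show "norm (P m x0) \<le> norm (mat 1 :: real^'m^'m) * \<rho> ^ m"
    by (cases m) (auto simp: P_0 P_Suc_base)
qed

lemma decaying:
  assumes "x \<in> D"
  shows "decaying_at x"
proof (rule connected_induction_simple[where P = decaying_at, OF D(2,3) assms decaying_base])
  fix a assume "a \<in> D"
  then obtain r where r: "r > 0" "ball a r \<subseteq> D" "\<And>y \<rho>. y \<in> ball a r \<Longrightarrow> decaying_at y \<Longrightarrow> \<rho> > 0 \<Longrightarrow>
     \<exists>A. \<forall>m. \<forall>z\<in>ball a r. norm (P m z) \<le> A * \<rho> ^ m"
    using decaying_near[of a] by metis
  have "decaying_at z" if "y \<in> ball a r" "z \<in> ball a r" "decaying_at y" for y z
    unfolding decaying_at_def using r(3)[OF that(1,3)] that(2) by metis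
  moreover have "openin (top_of_set D) (ball a r)" using r(2) by (simp add: open_openin_trans[OF D(1)])
  ultimately show "\<exists>T. openin (top_of_set D) T \<and> a \<in> T \<and> (\<forall>x\<in>T. \<forall>y\<in>T. decaying_at x \<longrightarrow> decaying_at y)"
    using centre_in_ball[of a r] r(1) by blast
qed

lemma locally_decaying:
  assumes "x \<in> D"
  shows "\<exists>r>0. ball x r \<subseteq> D \<and> (\<forall>\<rho>>0. \<exists>A\<ge>0. \<forall>m. \<forall>y\<in>ball x r. norm (P m y) \<le> A * \<rho> ^ m)"
proof -
  obtain r where r: "r > 0" "ball x r \<subseteq> D" "\<And>y \<rho>. y \<in> ball x r \<Longrightarrow> decaying_at y \<Longrightarrow> \<rho> > 0 \<Longrightarrow>
     \<exists>A. \<forall>m. \<forall>z\<in>ball x r. norm (P m z) \<le> A * \<rho> ^ m"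
    using decaying_near[OF assms] by metis
  have "\<exists>A\<ge>0. \<forall>m. \<forall>y\<in>ball x r. norm (P m y) \<le> A * \<rho> ^ m" if \<rho>: "\<rho> > 0" for \<rho>
  proof -
    obtain A where A: "\<And>m y. y \<in> ball x r \<Longrightarrow> norm (P m y) \<le> A * \<rho> ^ m"
      using r(3)[OF _ decaying[OF assms] \<rho>] r(1) by (meson centre_in_ball)
    have "A \<ge> 0" using A[of x 0] r(1) by (simp add: order_trans[OF norm_ge_zero])
    then show ?thesis using A by blast
  qed
  then show ?thesis using r(1,2) by blast
qed

text \<open>\<open>coef i j m\<close> is the coefficient of \<open>\<lambda>\<^sup>m\<close> in the \<open>i\<close>-th \<open>\<lambda>\<close>-derivative of \<open>\<lambda>\<^sup>j T\<close>. This family of series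
  is closed under differentiation in both variables, so smoothness follows by induction.\<close>

fun coef :: "nat \<Rightarrow> nat \<Rightarrow> nat \<Rightarrow> 'a \<Rightarrow> real^'m^'m" where
  "coef 0 j m x = (if m < j then 0 else P (m - j) x)"
| "coef (Suc i) j m x = real (Suc m) *\<^sub>R coef i j (Suc m) x"

text \<open>Coefficientwise form of d(\<lambda>^j T) = \<lambda>^(j+1) T dZ, which is why a
  derivative in x raises \<open>j\<close>.\<close>

lemma coef_has_derivative:
  assumes "x \<in> D"
  shows "(coef i j m has_derivative (\<lambda>h. coef i (Suc j) m x ** DZ x h)) (at x)"
proof (induction i arbitrary: m)
  case 0
  \<comment> \<open>The coefficient vanishes for m < j and is the constant \<open>P 0\<close> for m
    = j; only beyond that does the recursion for \<open>P\<close> act.\<close>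
  consider "m < j" | "m = j" | k where "m = Suc (j + k)" by (metis less_imp_Suc_add linorder_neqE_nat)
  then show ?case
  proof cases
    case 3
    then have "coef 0 j m = P (Suc k)" "coef 0 (Suc j) m x = P k x" by (auto intro!: ext)
    then show ?thesis using P_Suc[OF assms] by simp
  next
    case 1
    then have "coef 0 j m = (\<lambda>x. 0)" "coef 0 (Suc j) m x = 0" by (auto intro!: ext)
    then show ?thesis by (simp add: matrix_mult.zero_left)
  next
    case 2
    then have "coef 0 j m = (\<lambda>x. mat 1)" "coef 0 (Suc j) m x = 0" by (auto intro!: ext simp: P_0)
    then show ?thesis by (simp add: matrix_mult.zero_left)
  qed
next
  case (Suc i)
  have "coef (Suc i) j m = (\<lambda>x. real (Suc m) *\<^sub>R coef i j (Suc m) x)" by auto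
  then show ?case
    using has_derivative_scaleR_right[OF Suc, of "real (Suc m)" "Suc m"]
    by (simp add: matrix_mult.scaleR_left del: of_nat_Suc)
qed

text \<open>A \<lambda>-derivative multiplies the coefficient by m + 1 <= 2^(m+1), which is absorbed
  by using the bound for \<rho>/2; a factor \<lambda>^j shifts the index and costs the constant
  \<rho>^j.\<close>

lemma coef_locally_decaying:
  assumes P: "\<And>\<rho>. \<rho> > 0 \<Longrightarrow> \<exists>A\<ge>0. \<forall>m. \<forall>y\<in>U. norm (P m y) \<le> A * \<rho> ^ m" and \<rho>: "\<rho> > 0"
  shows "\<exists>A\<ge>0. \<forall>m. \<forall>y\<in>U. norm (coef i j m y) \<le> A * \<rho> ^ m"
  using \<rho>
proof (induction i arbitrary: \<rho>)
  case 0
  then obtain A where A: "A \<ge> 0" "\<And>m y. y \<in> U \<Longrightarrow> norm (P m y) \<le> A * \<rho> ^ m" using P by blast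
  have "norm (coef 0 j m y) \<le> (A / \<rho> ^ j) * \<rho> ^ m" if "y \<in> U" for m y
  proof (cases "m < j")
    case False
    then have "\<rho> ^ m = \<rho> ^ j * \<rho> ^ (m - j)" by (simp flip: power_add)
    then show ?thesis using A(2)[OF that, of "m - j"] False 0 by simp
  qed (use A(1) 0 in auto)
  then show ?case using A(1) 0 by (intro exI[of _ "A / \<rho> ^ j"]) auto
next
  case (Suc i)
  then obtain A where A: "A \<ge> 0" "\<And>m y. y \<in> U \<Longrightarrow> norm (coef i j m y) \<le> A * (\<rho>/2) ^ m"
    using Suc.IH[of "\<rho>/2"] by (metis half_gt_zero)
  have "norm (coef (Suc i) j m y) \<le> (A * \<rho>) * \<rho> ^ m" if "y \<in> U" for m y
  proof -
    have "real (Suc m) \<le> 2 ^ Suc m" by (metis less_imp_le of_nat_less_two_power)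
    have "norm (coef (Suc i) j m y) = real (Suc m) * norm (coef i j (Suc m) y)" by simp
    also have "\<dots> \<le> 2 ^ Suc m * (A * (\<rho>/2) ^ Suc m)"
      using \<open>real (Suc m) \<le> 2 ^ Suc m\<close> by (intro mult_mono A(2) that) auto
    also have "\<dots> = (A * \<rho>) * \<rho> ^ m" by (simp add: power_divide)
    finally show ?thesis .
  qed
  then show ?case using A(1) Suc.prems by (intro exI[of _ "A * \<rho>"]) auto
qed

definition series :: "nat \<Rightarrow> nat \<Rightarrow> 'a \<times> complex \<Rightarrow> complex^'m^'m" where
  "series i j z = (\<Sum>m. cscale_real (snd z ^ m) (coef i j m (fst z)))"

text \<open>Near (x, l) the x-derivatives and \<lambda>-derivatives of the m-th term are dominated
  by a constant times (1/2)^m, and the Weierstrass test applies.\<close>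

lemma series_summable_has_derivative:
  assumes z: "z \<in> D \<times> UNIV"
  shows "summable (\<lambda>m. cscale_real (snd z ^ m) (coef i j m (fst z)))"
    and "(series i j has_derivative (\<lambda>v. \<Sum>m. cscale_real (snd z ^ m) (coef i (Suc j) m (fst z) ** DZ (fst z) (fst v))
            + cscale_real (of_nat m * snd v * snd z ^ (m - 1)) (coef i j m (fst z)))) (at z)"
proof -
  obtain x l where xl: "z = (x, l)" "x \<in> D" using z by auto
  obtain r1 where r1: "r1 > 0" "ball x r1 \<subseteq> D" "\<And>\<rho>. \<rho> > 0 \<Longrightarrow> \<exists>A\<ge>0. \<forall>m. \<forall>y\<in>ball x r1. norm (P m y) \<le> A * \<rho> ^ m"
    using locally_decaying[OF xl(2)] by blast
  obtain r2 L where r2: "r2 > 0" "L \<ge> 0" "\<And>y h. y \<in> ball x r2 \<Longrightarrow> norm (DZ y h) \<le> L * norm h"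
    using derivative_locally_bounded[OF D(1) xl(2) Z] by blast
  define U where "U = ball x (min r1 r2)"
  \<comment> \<open>The disc of radius R contains l, and R >= 1 allows raising an exponent from m -
    1 to m.\<close>
  define R where "R = norm l + 1"
  have R: "R \<ge> 1" by (simp add: R_def)
  define S where "S = U \<times> ball (0::complex) R"
  have S: "convex S" "open S" "z \<in> S" "(x,0) \<in> S"
    using r1(1) r2(1) norm_ge_zero[of l] unfolding S_def U_def xl R_def
    by (auto intro: convex_Times open_Times simp: add_nonneg_pos)
  have US: "U \<subseteq> D" using r1(2) by (auto simp: U_def)
  have PU: "\<exists>A\<ge>0. \<forall>m. \<forall>y\<in>U. norm (P m y) \<le> A * \<rho> ^ m" if "\<rho> > 0" for \<rho>
    using r1(3)[OF that] unfolding U_def by auto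
  obtain K where K: "K > 0" "\<And>(A::real^'m^'m) (B::real^'m^'m). norm (A ** B) \<le> norm A * norm B * K"
    using matrix_mult.pos_bounded by blast
  obtain C where C: "C > 0" "\<And>a (B::real^'m^'m). norm (cscale_real a B) \<le> norm a * norm B * C"
    using cscale_real.pos_bounded by blast
  \<comment> \<open>The decay rate beats both R^m and the factor m <= 2^m of the
    \<lambda>-derivative: 2 R / (4 R) = 1/2.\<close>
  have \<rho>: "1 / (4 * R) > 0" using R by simp
  obtain A where A: "A \<ge> 0" "\<And>m y. y \<in> U \<Longrightarrow> norm (coef i j m y) \<le> A * (1 / (4 * R)) ^ m"
    using coef_locally_decaying[OF PU \<rho>] by blast
  obtain A' where A': "A' \<ge> 0" "\<And>m y. y \<in> U \<Longrightarrow> norm (coef i (Suc j) m y) \<le> A' * (1 / (4 * R)) ^ m"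
    using coef_locally_decaying[OF PU \<rho>] by blast
  define t where "t m = (\<lambda>z. cscale_real (snd z ^ m) (coef i j m (fst z)))" for m
  define t' where "t' m z v = cscale_real (snd z ^ m) (coef i (Suc j) m (fst z) ** DZ (fst z) (fst v))
            + cscale_real (of_nat m * snd v * snd z ^ (m - 1)) (coef i j m (fst z))" for m and z v :: "'a \<times> complex"
  have der: "(t m has_derivative t' m z) (at z)" if "z \<in> S" for m z
  proof -
    have c: "((\<lambda>z. coef i j m (fst z)) has_derivative (\<lambda>v. coef i (Suc j) m (fst z) ** DZ (fst z) (fst v))) (at z)"
      by (rule has_derivative_compose[OF has_derivative_fst[OF has_derivative_ident] coef_has_derivative])
         (use that US in \<open>auto simp: S_def\<close>)
    have p: "((\<lambda>z. snd z ^ m) has_derivative (\<lambda>v. of_nat m * snd v * snd z ^ (m - 1))) (at z)"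
      by (rule has_derivative_power[OF has_derivative_snd[OF has_derivative_ident]])
    show ?thesis unfolding t_def t'_def by (rule cscale_real.FDERIV[OF p c])
  qed
  have bound: "norm (t' m z v) \<le> (C * (A' * K * L + A)) * (1/2) ^ m * norm v" if zS: "z \<in> S" for m z v
  proof -
    have zU: "fst z \<in> U" "norm (snd z) \<le> R" using zS by (auto simp: S_def)
    have fs: "norm (fst v) \<le> norm v" "norm (snd v) \<le> norm v" 
      using norm_fst_le[of "fst v" "snd v"] norm_snd_le[of "snd v" "fst v"] by simp_all
    have le1: "R ^ m * (1 / (4 * R)) ^ m \<le> (1/2) ^ m"
    proof -
      have "R ^ m * (1 / (4 * R)) ^ m = (R * (1 / (4 * R))) ^ m" by (simp only: power_mult_distrib)
      also have "\<dots> = (1/4) ^ m" using R by simp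
      also have "\<dots> \<le> (1/2) ^ m" by (intro power_mono) auto
      finally show ?thesis .
    qed
    have le2: "real m * R ^ (m - 1) * (1 / (4 * R)) ^ m \<le> (1/2) ^ m"
    proof -
      have "R ^ (m - 1) \<le> R ^ m" using R by (intro power_increasing) auto
      then have "real m * R ^ (m - 1) * (1 / (4 * R)) ^ m \<le> 2 ^ m * R ^ m * (1 / (4 * R)) ^ m"
        using R by (intro mult_right_mono mult_mono) (auto intro: less_imp_le of_nat_less_two_power)
      also have "\<dots> = (2 * R * (1 / (4 * R))) ^ m" by (simp only: power_mult_distrib)
      also have "\<dots> = (1/2) ^ m" using R by simp
      finally show ?thesis .
    qed
    have "norm (cscale_real (snd z ^ m) (coef i (Suc j) m (fst z) ** DZ (fst z) (fst v)))
        \<le> norm (snd z ^ m) * norm (coef i (Suc j) m (fst z) ** DZ (fst z) (fst v)) * C" by (rule C(2))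
    also have "\<dots> \<le> R ^ m * ((A' * (1 / (4 * R)) ^ m) * (L * norm v) * K) * C"
    proof -
      have "norm (coef i (Suc j) m (fst z) ** DZ (fst z) (fst v)) \<le> norm (coef i (Suc j) m (fst z)) * norm (DZ (fst z) (fst v)) * K"
        by (rule K(2))
      also have "\<dots> \<le> (A' * (1 / (4 * R)) ^ m) * (L * norm v) * K"
      proof -
        have "norm (DZ (fst z) (fst v)) \<le> L * norm (fst v)" using r2(3) zU(1) by (simp add: U_def)
        also have "\<dots> \<le> L * norm v" using fs r2(2) by (intro mult_left_mono)
        finally show ?thesis using A' zU(1) K(1) R by (intro mult_right_mono mult_mono) auto
      qed
      finally show ?thesis using zU(2) C(1) R by (intro mult_right_mono mult_mono) (auto simp: norm_power power_mono)
    qed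
    also have "\<dots> = (R ^ m * (1 / (4 * R)) ^ m) * (C * (A' * K * L) * norm v)" by (simp only: mult_ac)
    also have "\<dots> \<le> (1/2) ^ m * (C * (A' * K * L) * norm v)"
      using le1 C(1) A'(1) K(1) r2(2) by (intro mult_right_mono) auto
    finally have 1: "norm (cscale_real (snd z ^ m) (coef i (Suc j) m (fst z) ** DZ (fst z) (fst v))) \<le> (1/2) ^ m * (C * (A' * K * L) * norm v)" .
    have "norm (cscale_real (of_nat m * snd v * snd z ^ (m - 1)) (coef i j m (fst z)))
        \<le> norm (of_nat m * snd v * snd z ^ (m - 1)) * norm (coef i j m (fst z)) * C" by (rule C(2))
    also have "\<dots> \<le> (real m * norm v * R ^ (m - 1)) * (A * (1 / (4 * R)) ^ m) * C"
    proof -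
      have "norm (of_nat m * snd v * snd z ^ (m - 1)) = real m * norm (snd v) * norm (snd z) ^ (m - 1)"
        by (simp add: norm_mult norm_power)
      also have "\<dots> \<le> real m * norm v * R ^ (m - 1)"
        by (intro mult_mono mult_left_mono power_mono mult_nonneg_nonneg zero_le_power) (use zU fs R in auto)
      finally show ?thesis using A(2)[OF zU(1), of m] C(1) R by (intro mult_right_mono mult_mono) auto
    qed
    also have "\<dots> = (real m * R ^ (m - 1) * (1 / (4 * R)) ^ m) * (C * A * norm v)" by (simp only: mult_ac)
    also have "\<dots> \<le> (1/2) ^ m * (C * A * norm v)"
      using le2 C(1) A(1) by (intro mult_right_mono) auto
    finally have 2: "norm (cscale_real (of_nat m * snd v * snd z ^ (m - 1)) (coef i j m (fst z))) \<le> (1/2) ^ m * (C * A * norm v)" .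
    have "norm (t' m z v) \<le> (1/2) ^ m * (C * (A' * K * L) * norm v) + (1/2) ^ m * (C * A * norm v)"
      unfolding t'_def using 1 2 by (rule norm_triangle_mono)
    also have "\<dots> = (C * (A' * K * L + A)) * (1/2) ^ m * norm v" by (simp add: algebra_simps)
    finally show ?thesis .
  qed
  have sM: "summable (\<lambda>m. (C * (A' * K * L + A)) * (1/2) ^ m)" by (intro summable_mult summable_geometric) simp
  \<comment> \<open>Convergence at a single point is enough to start; at \<lambda> = 0 only the term
    m = 0 survives.\<close>
  have s0: "summable (\<lambda>m. t m (x, 0))"
    by (rule summable_finite[of "{0}"]) (auto simp: t_def power_0_left cscale_real.zero_left)
  note * = has_derivative_suminf[where f = t and f' = t', OF S(1,2) der bound sM S(4) s0 S(3)]
  show "summable (\<lambda>m. cscale_real (snd z ^ m) (coef i j m (fst z)))" using *(1) by (simp add: t_def)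
  show "(series i j has_derivative (\<lambda>v. \<Sum>m. cscale_real (snd z ^ m) (coef i (Suc j) m (fst z) ** DZ (fst z) (fst v))
            + cscale_real (of_nat m * snd v * snd z ^ (m - 1)) (coef i j m (fst z)))) (at z)"
    using *(2) unfolding series_def[abs_def] t_def t'_def .
qed

end

context path_ordered_sequence
begin

lemma series_sums:
  assumes "z \<in> D \<times> UNIV"
  shows "(\<lambda>m. cscale_real (snd z ^ m) (coef i j m (fst z))) sums series i j z"
  unfolding series_def by (rule summable_sums[OF series_summable_has_derivative(1)[OF assms]])

lemma series_has_derivative:
  assumes z: "z \<in> D \<times> UNIV"
  shows "(series i j has_derivative
    (\<lambda>v. series i (Suc j) z ** cmat (DZ (fst z) (fst v)) + cscale (snd v) (series (Suc i) j z))) (at z)"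
proof -
  define a where "a v m = cscale_real (snd z ^ m) (coef i (Suc j) m (fst z) ** DZ (fst z) (fst v))" for m and v :: "'a \<times> complex"
  define b where "b v m = cscale_real (of_nat m * snd v * snd z ^ (m - 1)) (coef i j m (fst z))" for m and v :: "'a \<times> complex"
  have "(\<Sum>m. a v m + b v m) = series i (Suc j) z ** cmat (DZ (fst z) (fst v)) + cscale (snd v) (series (Suc i) j z)" for v
  proof -
    have "a v = (\<lambda>m. cscale_real (snd z ^ m) (coef i (Suc j) m (fst z)) ** cmat (DZ (fst z) (fst v)))"
      by (rule ext) (simp add: a_def cscale_real_def cmat_mult cscale_mult_left)
    then have a: "a v sums (series i (Suc j) z ** cmat (DZ (fst z) (fst v)))"
      using bounded_linear.sums[OF matrix_mult.bounded_linear_left series_sums[OF z]] by (simp only:)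
    have "b v (Suc m) = cscale (snd v) (cscale_real (snd z ^ m) (coef (Suc i) j m (fst z)))" for m
      by (simp add: b_def vec_eq_iff algebra_simps)
    then have "(\<lambda>m. b v (Suc m)) sums cscale (snd v) (series (Suc i) j z)"
      using bounded_linear.sums[OF cscale.bounded_linear_right series_sums[OF z]] by (simp only:)
    \<comment> \<open>Differentiating a power lowers its exponent, so the series is compared after
      an index shift; its term m = 0 vanishes because of the factor m.\<close>
    then have "b v sums (cscale (snd v) (series (Suc i) j z) + b v 0)" by (rule sums_Suc)
    moreover have "b v 0 = 0" by (simp add: b_def cscale_real.zero_left)
    ultimately have "b v sums cscale (snd v) (series (Suc i) j z)" by simp
    from sums_unique[OF sums_add[OF a this]] show ?thesis by simp
  qed
  then show ?thesis using series_summable_has_derivative(2)[OF z, of i j] unfolding a_def b_def by simp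
qed

lemma open_product: "open (D \<times> (UNIV :: complex set))"
  using D(1) by (intro open_Times) auto

lemma Ck_on_series: "Ck_on n (D \<times> UNIV) (series i j)"
proof (induction n arbitrary: i j)
  case 0
  then show ?case
    unfolding Ck_on.simps by (rule has_derivative_continuous_on[OF has_derivative_at_withinI[OF series_has_derivative]])
next
  case (Suc n)
  show ?case
  proof (rule Ck_on_SucI[OF open_product series_has_derivative])
    fix v :: "'a \<times> complex"
    have "Ck_on n D (\<lambda>x. cmat (DZ x (fst v)))"
      by (intro Ck_on_bounded_linear[OF D(1) bounded_linear_cmat] smooth_on_Ck smooth_on_frechet_derivative Z)
    then have "Ck_on n (D \<times> UNIV) (\<lambda>z :: 'a \<times> complex. cmat (DZ (fst z) (fst v)))"
      by (rule Ck_on_fst[OF D(1)])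
    then show "Ck_on n (D \<times> UNIV) (\<lambda>z. series i (Suc j) z ** cmat (DZ (fst z) (fst v)) + cscale (snd v) (series (Suc i) j z))"
      using Suc by (intro Ck_on_add[OF open_product] Ck_on_bounded_bilinear[OF open_product bounded_bilinear_matrix_mult]
        Ck_on_bounded_linear[OF open_product cscale.bounded_linear_right])
  qed
qed

text \<open>Turns the x-derivative of T, obtained as the series with \<open>j\<close> = 1, into
  \<lambda> T dZ and thus closes the equation.\<close>

lemma series_Suc_shift:
  assumes z: "z \<in> D \<times> UNIV"
  shows "series 0 (Suc j) z = cscale (snd z) (series 0 j z)"
proof -
  have "(\<lambda>m. cscale (snd z) (cscale_real (snd z ^ m) (coef 0 j m (fst z)))) sums cscale (snd z) (series 0 j z)"
    by (rule bounded_linear.sums[OF cscale.bounded_linear_right series_sums[OF z]])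
  moreover have "cscale (snd z) (cscale_real (snd z ^ m) (coef 0 j m (fst z))) = cscale_real (snd z ^ Suc m) (coef 0 (Suc j) (Suc m) (fst z))" for m
    by (simp add: vec_eq_iff)
  ultimately have "(\<lambda>m. cscale_real (snd z ^ Suc m) (coef 0 (Suc j) (Suc m) (fst z))) sums cscale (snd z) (series 0 j z)" by simp
  from sums_Suc[OF this] have "(\<lambda>m. cscale_real (snd z ^ m) (coef 0 (Suc j) m (fst z))) sums cscale (snd z) (series 0 j z)"
    by (simp add: cscale_real.zero_right)
  then show ?thesis using series_sums[OF z] sums_unique2 by blast
qed

lemma series_at_0: "series i j (x, 0) = cmat (coef i j 0 x)"
proof -
  have "(\<lambda>m. cscale_real (0 ^ m) (coef i j m x)) sums (\<Sum>m\<in>{0}. cscale_real (0 ^ m) (coef i j m x))"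
    by (rule sums_finite) (auto simp: cscale_real.zero_left power_0_left)
  then show ?thesis unfolding series_def by (simp add: sums_unique[symmetric] vec_eq_iff cscale_real_def)
qed

lemma series_base: "series 0 0 (x0, l) = mat 1"
proof -
  have "(\<lambda>m. cscale_real (l ^ m) (coef 0 0 m x0)) sums (\<Sum>m\<in>{0}. cscale_real (l ^ m) (coef 0 0 m x0))"
  proof (rule sums_finite)
    fix m :: nat assume "m \<notin> {0}"
    then show "cscale_real (l ^ m) (coef 0 0 m x0) = 0"
      by (cases m) (auto simp: P_Suc_base cscale_real.zero_right)
  qed simp
  then show ?thesis unfolding series_def by (simp add: sums_unique[symmetric] vec_eq_iff P_0 mat_def)
qed

lemma series_entry_has_field_derivative:
  assumes "x \<in> D"
  shows "((\<lambda>l. series i j (x, l) $ a $ b) has_field_derivative series (Suc i) j (x, l) $ a $ b) (at l)"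
proof -
  have "((\<lambda>l. (x, l)) has_derivative (\<lambda>h. (0, h))) (at l)"
    by (intro has_derivative_Pair has_derivative_const has_derivative_ident)
  moreover have "(series i j has_derivative
    (\<lambda>v. series i (Suc j) (x,l) ** cmat (DZ x (fst v)) + cscale (snd v) (series (Suc i) j (x,l)))) (at (x, l))"
    using series_has_derivative[of "(x,l)"] assms by simp
  ultimately have "((\<lambda>l. series i j (x, l)) has_derivative
    (\<lambda>h. series i (Suc j) (x,l) ** cmat (DZ x 0) + cscale h (series (Suc i) j (x,l)))) (at l)"
    using has_derivative_compose[of "\<lambda>l. (x, l)" _ l UNIV "series i j"] by fastforce
  moreover have "DZ x 0 = 0"
    using linear_0[OF has_derivative_linear[OF smooth_on_has_derivative[OF D(1) Z assms]]] .
  moreover have "cmat (0 :: real^'m^'m) = 0" by (simp add: vec_eq_iff)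
  ultimately have d: "((\<lambda>l. series i j (x, l)) has_derivative (\<lambda>h. cscale h (series (Suc i) j (x,l)))) (at l)"
    by (simp add: matrix_mult.zero_right)
  have "bounded_linear (\<lambda>A :: complex^'m^'m. A $ a $ b)"
    using bounded_linear_compose[OF bounded_linear_vec_nth bounded_linear_vec_nth] by blast
  from bounded_linear.has_derivative[OF this d] show ?thesis
    by (simp add: has_field_derivative_def mult_commute_abs)
qed

lemma series_has_derivative_fst:
  assumes "x \<in> D"
  shows "((\<lambda>y. series 0 0 (y, l)) has_derivative (\<lambda>h. cscale l (series 0 0 (x, l) ** cmat (DZ x h)))) (at x)"
proof -
  have "((\<lambda>y. (y, l)) has_derivative (\<lambda>h. (h, 0))) (at x)"
    by (intro has_derivative_Pair has_derivative_const has_derivative_ident)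
  moreover have "(series 0 0 has_derivative
    (\<lambda>v. series 0 (Suc 0) (x,l) ** cmat (DZ x (fst v)) + cscale (snd v) (series (Suc 0) 0 (x,l)))) (at (x, l))"
    using series_has_derivative[of "(x,l)"] assms by simp
  ultimately have "((\<lambda>y. series 0 0 (y, l)) has_derivative
    (\<lambda>h. series 0 (Suc 0) (x,l) ** cmat (DZ x h) + cscale 0 (series (Suc 0) 0 (x,l)))) (at x)"
    using has_derivative_compose[of "\<lambda>y. (y, l)" _ x UNIV "series 0 0"] by fastforce
  then show ?thesis using series_Suc_shift[of "(x,l)" 0] assms by (simp add: cscale_mult_left cscale.zero_left)
qed

text \<open>The coefficients are real, so conjugation acts on the powers of \<lambda> alone.\<close>

lemma series_cnj:
  assumes "x \<in> D"
  shows "map_matrix cnj (series 0 0 (x, cnj l)) = series 0 0 (x, l)"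
proof -
  have "bounded_linear (map_matrix cnj :: complex^'m^'m \<Rightarrow> _)"
    unfolding linear_conv_bounded_linear[symmetric] by (intro linearI) (simp_all add: vec_eq_iff)
  from bounded_linear.sums[OF this series_sums[of "(x, cnj l)" 0 0]] assms
  have "(\<lambda>m. map_matrix cnj (cscale_real (cnj l ^ m) (coef 0 0 m x))) sums map_matrix cnj (series 0 0 (x, cnj l))" by simp
  moreover have "map_matrix cnj (cscale_real (cnj l ^ m) (coef 0 0 m x)) = cscale_real (l ^ m) (coef 0 0 m x)" for m
    by (simp add: vec_eq_iff)
  ultimately have "(\<lambda>m. cscale_real (l ^ m) (coef 0 0 m x)) sums map_matrix cnj (series 0 0 (x, cnj l))" by simp
  then show ?thesis using series_sums[of "(x, l)" 0 0] assms sums_unique2 by fastforce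
qed

text \<open>Conjugation by I reverses dZ, and \<open>P m\<close> is an m-fold integral of dZ.
  Formally, by induction both sides have the same derivative and agree at x0.\<close>

lemma P_involution:
  assumes I: "I ** I = mat 1" "\<And>x. x \<in> D \<Longrightarrow> I ** Z x ** I = - Z x" and x: "x \<in> D"
  shows "I ** P m x ** I = (-1) ^ m *\<^sub>R P m x"
  using x
proof (induction m arbitrary: x)
  case 0
  then show ?case using I(1) by (simp add: P_0)
next
  case (Suc m)
  have bl: "bounded_linear (\<lambda>A. I ** A ** I)"
    using bounded_linear_compose[OF matrix_mult.bounded_linear_left matrix_mult.bounded_linear_right] by blast
  have IDZ: "I ** DZ x h ** I = - DZ x h" if x: "x \<in> D" for x h
  proof -
    note d = smooth_on_has_derivative[OF D(1) Z x]
    have "((\<lambda>x. - Z x) has_derivative (\<lambda>h. I ** DZ x h ** I)) (at x)"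
      by (rule has_derivative_transform_within_open[OF bounded_linear.has_derivative[OF bl d] D(1) x I(2)])
    with has_derivative_minus[OF d] have "(\<lambda>h. I ** DZ x h ** I) = (\<lambda>h. - DZ x h)"
      using has_derivative_unique by blast
    then show ?thesis by metis
  qed
  define f where "f x = I ** P (Suc m) x ** I - (-1) ^ Suc m *\<^sub>R P (Suc m) x" for x
  have "(f has_derivative (\<lambda>h. 0)) (at y)" if y: "y \<in> D" for y
  proof -
    have "(f has_derivative (\<lambda>h. I ** (P m y ** DZ y h) ** I - (-1) ^ Suc m *\<^sub>R (P m y ** DZ y h))) (at y)"
      unfolding f_def[abs_def]
      by (intro has_derivative_diff bounded_linear.has_derivative[OF bl] has_derivative_scaleR_right P_Suc y)
    moreover have "I ** (P m y ** DZ y h) ** I - (-1) ^ Suc m *\<^sub>R (P m y ** DZ y h) = 0" for h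
    proof -
      \<comment> \<open>Inserting I I = 1 between the factors lets the induction hypothesis and the
        sign change of dZ act separately.\<close>
      have "I ** (P m y ** DZ y h) ** I = (I ** P m y) ** (mat 1) ** (DZ y h ** I)" by (simp add: matrix_mul_assoc)
      also have "\<dots> = (I ** P m y ** I) ** (I ** DZ y h ** I)" by (simp add: I(1)[symmetric] matrix_mul_assoc)
      also have "\<dots> = (-1) ^ Suc m *\<^sub>R (P m y ** DZ y h)"
        by (simp add: Suc.IH[OF y] IDZ[OF y] matrix_mult.scaleR_left matrix_mult.minus_right)
      finally show ?thesis by simp
    qed
    ultimately show ?thesis by simp
  qed
  from has_derivative_zero_unique_connected[OF D(1,2) this Suc.prems D(3)]
  show ?case by (simp add: f_def P_Suc_base matrix_mult.zero_right matrix_mult.zero_left eq_neg_iff_add_eq_0)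
qed

lemma series_involution:
  assumes I: "I ** I = mat 1" "\<And>x. x \<in> D \<Longrightarrow> I ** Z x ** I = - Z x" and x: "x \<in> D"
  shows "cmat I ** series 0 0 (x, - l) ** cmat I = series 0 0 (x, l)"
proof -
  have bl: "bounded_linear (\<lambda>A. cmat I ** A ** cmat I)"
    using bounded_linear_compose[OF matrix_mult.bounded_linear_left matrix_mult.bounded_linear_right] by blast
  have "cmat I ** cscale_real ((- l) ^ m) (coef 0 0 m x) ** cmat I = cscale_real (l ^ m) (coef 0 0 m x)" for m
  proof -
    have "cmat I ** cscale_real ((- l) ^ m) (coef 0 0 m x) ** cmat I = cscale_real ((- l) ^ m) (I ** P m x ** I)"
      by (simp add: cscale_real_def cscale_mult_left cscale_mult_right cmat_mult)
    also have "\<dots> = cscale_real (l ^ m) (P m x)"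
    proof -
      have "I ** P m x ** I = (-1) ^ m *\<^sub>R P m x" by (rule P_involution[OF I x])
      then show ?thesis by (cases "even m") (simp_all add: vec_eq_iff)
    qed
    finally show ?thesis by simp
  qed
  then have "(\<lambda>m. cscale_real (l ^ m) (coef 0 0 m x)) sums (cmat I ** series 0 0 (x, - l) ** cmat I)"
    using bounded_linear.sums[OF bl series_sums[of "(x, - l)" 0 0]] x by simp
  then show ?thesis using series_sums[of "(x, l)" 0 0] x sums_unique2 by fastforce
qed

end

text \<open>\<Phi> is the solution of the gauged equation with value 1 at x0. The normalisation Z x0
  = 0 makes the first coefficient \<open>P 1\<close> equal to Z itself and not only up to a
  constant.\<close>

theorem spectral_transport_exists:
  fixes Z :: "'a::euclidean_space \<Rightarrow> real^'m^'m"
  assumes dom: "open D" "simply_connected D" "x0 \<in> D"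
    and Z: "smooth_on D Z" "Z x0 = 0"
    and comm: "\<And>x h v. x \<in> D \<Longrightarrow> frechet_derivative Z (at x) h ** frechet_derivative Z (at x) v
                = frechet_derivative Z (at x) v ** frechet_derivative Z (at x) h"
  obtains \<Phi> \<Phi>' :: "'a \<Rightarrow> complex \<Rightarrow> complex^'m^'m"
  where "smooth_on (D \<times> UNIV) (\<lambda>z. \<Phi> (fst z) (snd z))"
    and "\<And>x l. x \<in> D \<Longrightarrow>
      ((\<lambda>y. \<Phi> y l) has_derivative (\<lambda>h. cscale l (\<Phi> x l ** cmat (frechet_derivative Z (at x) h)))) (at x)"
    and "\<And>x l a b. x \<in> D \<Longrightarrow> ((\<lambda>l. \<Phi> x l $ a $ b) has_field_derivative \<Phi>' x l $ a $ b) (at l)"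
    and "\<And>x. x \<in> D \<Longrightarrow> \<Phi>' x 0 = cmat (Z x)"
    and "\<And>x. x \<in> D \<Longrightarrow> \<Phi> x 0 = mat 1"
    and "\<And>l. \<Phi> x0 l = mat 1"
    and "\<And>x l. x \<in> D \<Longrightarrow> map_matrix cnj (\<Phi> x (cnj l)) = \<Phi> x l"
    and "\<And>I x l. I ** I = mat 1 \<Longrightarrow> (\<And>x. x \<in> D \<Longrightarrow> I ** Z x ** I = - Z x) \<Longrightarrow> x \<in> D \<Longrightarrow>
      cmat I ** \<Phi> x (- l) ** cmat I = \<Phi> x l"
proof -
  obtain P where P: "P 0 = (\<lambda>x. mat 1)" "\<And>m. P (Suc m) x0 = 0"
    "\<And>m x. x \<in> D \<Longrightarrow> (P (Suc m) has_derivative (\<lambda>h. P m x ** frechet_derivative Z (at x) h)) (at x)"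
    using path_ordered_sequence_exists[OF dom Z(1) comm] by blast
  interpret path_ordered_sequence D Z x0 P
    by unfold_locales (use dom Z P simply_connected_imp_connected in auto)
  have P1: "P 1 x = Z x" if x: "x \<in> D" for x
  proof -
    have "((\<lambda>y. P 1 y - Z y) has_derivative (\<lambda>h. 0)) (at y)" if y: "y \<in> D" for y
      using has_derivative_diff[OF P(3)[OF y, of 0] smooth_on_has_derivative[OF dom(1) assms(4) y]] by (simp add: P(1))
    from has_derivative_zero_unique_connected[OF dom(1) simply_connected_imp_connected[OF dom(2)] this x dom(3)]
    show ?thesis using P(2)[of 0] assms(5) by simp
  qed
  show ?thesis
  proof (rule that[of "\<lambda>x l. series 0 0 (x, l)" "\<lambda>x l. series 1 0 (x, l)"])
    show "smooth_on (D \<times> UNIV) (\<lambda>z. series 0 0 (fst z, snd z))"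
      by (simp add: smooth_on_def Ck_on_series)
    show "series 1 0 (x, 0) = cmat (Z x)" if "x \<in> D" for x
      using P1[OF that] by (simp add: series_at_0)
    show "series 0 0 (x, 0) = mat 1" for x
      by (simp add: series_at_0 P(1) vec_eq_iff mat_def)
    show "((\<lambda>l. series 0 0 (x, l) $ a $ b) has_field_derivative series 1 0 (x, l) $ a $ b) (at l)" if "x \<in> D" for x l a b
      using series_entry_has_field_derivative[OF that, of 0 0] by simp
  qed (use series_has_derivative_fst series_base series_cnj series_involution in auto)
qed

subsection \<open>Block matrices and flat connections\<close>

lemma matrix_inv_eq:
  fixes A :: "'a::field^'n^'n"
  assumes "A ** B = mat 1"
  shows "matrix_inv A = B"
proof -
  have BA: "B ** A = mat 1" using assms matrix_left_right_inverse by blast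
  with assms have "\<exists>B. A ** B = mat 1 \<and> B ** A = mat 1" by blast
  from someI_ex[OF this] have "A ** matrix_inv A = mat 1" unfolding matrix_inv_def by (rule conjunct1)
  then show ?thesis using BA by (metis matrix_mul_assoc matrix_mul_lid matrix_mul_rid)
qed

lemma sum_UNIV_Plus: "(\<Sum>k\<in>UNIV. f k) = (\<Sum>k\<in>UNIV. f (Inl k)) + (\<Sum>k\<in>UNIV. f (Inr k))"
  for f :: "'a::finite + 'b::finite \<Rightarrow> 'c::comm_monoid_add"
  unfolding UNIV_Plus_UNIV[symmetric] by (subst sum.Plus) auto

lemma block_mat_mult:
  "block_mat A B C E ** block_mat A' B' C' E' =
     block_mat (A ** A' + B ** C') (A ** B' + B ** E') (C ** A' + E ** C') (C ** B' + E ** E')"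
  by (simp add: vec_eq_iff block_mat_def matrix_matrix_mult_def sum_UNIV_Plus split: sum.split)

lemma block_mat_transpose:
  "transpose (block_mat A B C E) = block_mat (transpose A) (transpose C) (transpose B) (transpose E)"
  by (simp add: vec_eq_iff block_mat_def transpose_def split: sum.split)

lemma block_mat_add:
  "block_mat A B C E + block_mat A' B' C' E' = block_mat (A + A') (B + B') (C + C') (E + E')"
  by (simp add: vec_eq_iff block_mat_def split: sum.split)

lemma block_mat_uminus:
  "- block_mat A B C E = block_mat (- A) (- B) (- C) (- E :: 'a::group_add^'n^'n)"
  by (simp add: vec_eq_iff block_mat_def split: sum.split)

lemma block_mat_one: "block_mat (mat 1) 0 0 (mat 1) = mat 1"
  by (auto simp: vec_eq_iff block_mat_def mat_def split: sum.split)

lemma block_mat_zero: "block_mat 0 0 0 0 = 0"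
  by (simp add: vec_eq_iff block_mat_def split: sum.split)

lemma cmat_block_mat: "cmat (block_mat A B C E) = block_mat (cmat A) (cmat B) (cmat C) (cmat E)"
  by (simp add: vec_eq_iff block_mat_def split: sum.split)

lemma cmat_one: "cmat (mat 1) = mat 1"
  by (simp add: vec_eq_iff mat_def)

lemma cmat_zero: "cmat 0 = 0"
  by (simp add: vec_eq_iff)

lemma cmat_uminus: "cmat (- A) = - cmat A"
  by (simp add: vec_eq_iff)

lemma cmat_add: "cmat (A + B) = cmat A + cmat B"
  by (simp add: vec_eq_iff)

lemma cmat_transpose: "cmat (transpose A) = transpose (cmat A)"
  by (simp add: vec_eq_iff transpose_def)

lemma bounded_linear_transpose: "bounded_linear (transpose :: 'a::euclidean_space^'n^'m \<Rightarrow> _)"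
  unfolding linear_conv_bounded_linear[symmetric]
  by (intro linearI) (simp_all add: vec_eq_iff transpose_def)

lemma bounded_linear_block_diag:
  "bounded_linear (\<lambda>p :: (real^'n^'n) \<times> (real^'n^'n). block_mat (fst p) 0 0 (snd p))"
  unfolding linear_conv_bounded_linear[symmetric]
  by (intro linearI) (simp_all add: vec_eq_iff block_mat_def split: sum.split)

lemma bounded_linear_block_off_diag:
  "bounded_linear (\<lambda>p :: (real^'n^'n) \<times> (real^'n^'n). block_mat 0 (fst p) (snd p) 0)"
  unfolding linear_conv_bounded_linear[symmetric]
  by (intro linearI) (simp_all add: vec_eq_iff block_mat_def split: sum.split)

lemma transpose_mult: "transpose (A ** B) = transpose B ** transpose (A :: 'a::comm_semiring_1^'n^'m)"
  by (rule matrix_transpose_mul)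

lemma transpose_uminus: "transpose (- A) = - transpose (A :: 'a::group_add^'n^'m)"
  by (simp add: vec_eq_iff transpose_def)

lemma smooth_on_Pair:
  assumes "open S" "smooth_on S f" "smooth_on S g"
  shows "smooth_on S (\<lambda>x. (f x, g x))"
proof -
  have 1: "bounded_linear (\<lambda>a. (a, 0))" and 2: "bounded_linear (\<lambda>b. (0, b))"
    by (intro bounded_linear_Pair bounded_linear_ident bounded_linear_zero)+
  have "smooth_on S (\<lambda>x. (f x, 0) + (0, g x))"
    by (intro smooth_on_add smooth_on_bounded_linear[OF assms(1) 1] smooth_on_bounded_linear[OF assms(1) 2] assms)
  then show ?thesis by simp
qed

lemma pd_eq: "(f has_derivative f') (at x) \<Longrightarrow> pd f i x = f' (axis i 1)"
  unfolding pd_def by (simp add: frechet_derivative_at[symmetric])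

lemma derivative_sum_pd:
  fixes f :: "real^'n \<Rightarrow> 'b::real_normed_vector"
  assumes "(f has_derivative f') (at x)"
  shows "f' h = (\<Sum>i\<in>UNIV. h $ i *\<^sub>R pd f i x)"
proof -
  have lin: "linear f'" by (rule has_derivative_linear[OF assms])
  have "f' h = f' (\<Sum>i\<in>UNIV. h $ i *\<^sub>R axis i 1)" by (simp add: basis_expansion flip: scalar_mult_eq_scaleR)
  also have "\<dots> = (\<Sum>i\<in>UNIV. h $ i *\<^sub>R pd f i x)"
    by (simp add: linear_sum[OF lin] linear_cmul[OF lin] pd_eq[OF assms])
  finally show ?thesis .
qed

lemma pd_cong:
  assumes "open S" "x \<in> S" "smooth_on S f" "\<And>y. y \<in> S \<Longrightarrow> f y = g y"
  shows "pd f i x = pd g i x"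
  unfolding pd_def
  by (simp add: frechet_derivative_cong_open(2)[OF assms(1,2,4) differentiableI[OF smooth_on_has_derivative[OF assms(1,3,2)]]])

lemma has_derivative_vec_lambda:
  assumes "\<And>i. ((\<lambda>x. f x i) has_derivative (\<lambda>h. f' h i)) F"
  shows "((\<lambda>x. \<chi> i. f x i) has_derivative (\<lambda>h. \<chi> i. f' h i)) F"
  unfolding vec_lambda_sum_axis
  by (intro has_derivative_sum bounded_linear.has_derivative[OF bounded_linear_axis] assms)

text \<open>Flatness of \<open>A\<close> is the symmetry of the second partial derivatives of a frame \<open>M\<close>
  with \<open>dM = M A\<close>.\<close>

lemma flat_on_if_frame:
  fixes M :: "real^'n \<Rightarrow> real^'m^'m"
  assumes D: "open D" and M: "smooth_on D M" and A: "\<And>h. smooth_on D (\<lambda>x. A x h)"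
    and der: "\<And>x. x \<in> D \<Longrightarrow> (M has_derivative (\<lambda>h. M x ** A x h)) (at x)"
    and inv: "\<And>x. x \<in> D \<Longrightarrow> M' x ** M x = mat 1"
  shows "flat_on D A"
  unfolding flat_on_def
proof (intro ballI allI)
  fix x i j assume x: "x \<in> D"
  have pdM: "pd M j y = M y ** A y (axis j 1)" if "y \<in> D" for y j by (rule pd_eq[OF der[OF that]])
  have 1: "pd (pd M j) i x = M x ** pd (\<lambda>y. A y (axis j 1)) i x + M x ** A x (axis i 1) ** A x (axis j 1)" for i j
  proof -
    have "pd (pd M j) i x = pd (\<lambda>y. M y ** A y (axis j 1)) i x"
      by (rule pd_cong[OF D x smooth_on_pd[OF M] pdM])
    also have "\<dots> = M x ** frechet_derivative (\<lambda>y. A y (axis j 1)) (at x) (axis i 1) + M x ** A x (axis i 1) ** A x (axis j 1)"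
      by (rule pd_eq[OF matrix_mult.FDERIV[OF der[OF x] smooth_on_has_derivative[OF D A x]]])
    finally show ?thesis by (simp add: pd_def)
  qed
  have "M x ** (pd (\<lambda>y. A y (axis j 1)) i x - pd (\<lambda>y. A y (axis i 1)) j x
     + (A x (axis i 1) ** A x (axis j 1) - A x (axis j 1) ** A x (axis i 1))) = pd (pd M j) i x - pd (pd M i) j x"
    unfolding 1 matrix_mult.add_right matrix_mult.diff_right by (simp add: matrix_mul_assoc)
  also have "\<dots> = 0" using pd_commute[OF D x M] by simp
  finally have "M' x ** (M x ** (pd (\<lambda>y. A y (axis j 1)) i x - pd (\<lambda>y. A y (axis i 1)) j x
     + (A x (axis i 1) ** A x (axis j 1) - A x (axis j 1) ** A x (axis i 1)))) = 0"
    by (simp add: matrix_mult.zero_right)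
  then show "pd (\<lambda>y. A y (axis j 1)) i x - pd (\<lambda>y. A y (axis i 1)) j x
     + (A x (axis i 1) ** A x (axis j 1) - A x (axis j 1) ** A x (axis i 1)) = 0"
    by (simp add: matrix_mul_assoc inv[OF x])
qed

section \<open>Entries and symmetries of the connection forms\<close>

lemma eps_square [simp]: "eps k i * eps k i = 1"
  by (simp add: eps_def)

lemma eps_square_left [simp]: "eps k i * (eps k i * z) = z"
  by (simp add: eps_def)

lemma diag_mult_nth: "(\<Sum>j\<in>UNIV. (if i = j then a j else 0) * b j) = a i * (b i :: real)"
  "(\<Sum>j\<in>UNIV. b j * (if j = i then a j else 0)) = b i * a i" for i :: "'i::finite"
  by (simp_all add: if_distrib[of "\<lambda>z. z * _"] if_distrib[of "\<lambda>z. _ * z"] cong: if_cong)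

lemma Jmat_mult_nth: "(Jmat k ** A) $ i $ j = eps k i * A $ i $ j" "(A ** Jmat k) $ i $ j = A $ i $ j * eps k j"
  by (simp_all add: matrix_matrix_mult_def Jmat_def diag_mult_nth)

lemma diagv_mult_nth: "(diagv h ** A) $ i $ j = h $ i * A $ i $ j" "(A ** diagv h) $ i $ j = A $ i $ j * h $ j"
  by (simp_all add: matrix_matrix_mult_def diagv_def diag_mult_nth)

lemma Jmat_square: "Jmat k ** Jmat k = mat 1"
  by (auto simp: vec_eq_iff Jmat_mult_nth) (auto simp: Jmat_def mat_def)

lemma transpose_Jmat: "transpose (Jmat k) = Jmat k"
  by (auto simp: vec_eq_iff Jmat_def transpose_def)

lemma transpose_diagv: "transpose (diagv h) = diagv h"
  by (auto simp: vec_eq_iff diagv_def transpose_def)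

lemma omega_nth: "omega k F x h $ m $ j = - (h $ m * eps k m * F x $ m $ j) + F x $ j $ m * eps k j * h $ j"
proof -
  have "diagv h ** Jmat k ** F x = diagv h ** (Jmat k ** F x)" by (simp add: matrix_mul_assoc)
  then show ?thesis by (simp add: omega_def Jmat_mult_nth diagv_mult_nth) (simp add: transpose_def)
qed

lemma tau_nth: "tau k F x h $ m $ j = - (h $ m * F x $ j $ m * eps k j) + F x $ m $ j * h $ j * eps k j"
  by (simp add: tau_def Jmat_mult_nth diagv_mult_nth) (simp add: transpose_def)

text \<open>\<tau> takes values in the Lie algebra of the isometries of J; this is the infinitesimal
  form of B J B^T = J.\<close>

lemma tau_skew: "Jmat k ** transpose (tau k F x h) ** Jmat k = - tau k F x h"
  by (simp add: vec_eq_iff Jmat_mult_nth transpose_def tau_nth algebra_simps)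

subsection \<open>The geometry of a Combescure sequence\<close>

text \<open>The sequence is indexed by the coordinate type, so that the signed lengths
  \<open>w l j\<close> of the partials along the common unit tangents form a square matrix;
  \<open>W\<close> is its inverse at 0.\<close>

locale combescure_frame =
  fixes D :: "(real, 'n::{finite,linorder}) vec set" and k :: nat
    and \<phi> :: "'n \<Rightarrow> (real, 'n) vec \<Rightarrow> (real, 'n) vec"
    and v :: "'n \<Rightarrow> (real, 'n) vec \<Rightarrow> (real, 'n) vec"
    and w :: "'n \<Rightarrow> 'n \<Rightarrow> (real, 'n) vec \<Rightarrow> real"
    and W :: "((real, 'n) vec, 'n) vec"
  assumes D: "open D" "simply_connected D" "0 \<in> D"
    and smooth_\<phi>: "smooth_on D (\<phi> l)"
    and smooth_v: "smooth_on D (v j)"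
    and smooth_w: "smooth_on D (w l j)"
    and orthonormal: "x \<in> D \<Longrightarrow> v i x \<bullet> v j x = (if i = j then 1 else 0)"
    and pd_\<phi>: "x \<in> D \<Longrightarrow> pd (\<phi> l) j x = w l j x *\<^sub>R v j x"
    and w_nonzero: "x \<in> D \<Longrightarrow> w l j x \<noteq> 0"
    and w_null: "x \<in> D \<Longrightarrow> (\<Sum>j\<in>UNIV. eps k j * (w l j x)\<^sup>2) = 0"
    and W: "(\<chi> j l. w l j 0) ** W = mat 1"
    and \<phi>_0: "\<phi> l 0 = 0"
begin

text \<open>The connection coefficients of the orthonormal frame \<open>v\<close>.\<close>

definition a :: "'n \<Rightarrow> 'n \<Rightarrow> 'n \<Rightarrow> (real, 'n) vec \<Rightarrow> real" where
  "a i j m x = pd (v j) i x \<bullet> v m x"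

text \<open>The inner products of the frame vectors are constant; differentiate them.\<close>

lemma a_antisym:
  assumes x: "x \<in> D"
  shows "a i j m x = - a i m j x"
proof -
  have "((\<lambda>y. v j y \<bullet> v m y) has_derivative (\<lambda>h. v j x \<bullet> frechet_derivative (v m) (at x) h + frechet_derivative (v j) (at x) h \<bullet> v m x)) (at x)"
    by (intro has_derivative_inner smooth_on_has_derivative[OF D(1) smooth_v x])
  moreover have "((\<lambda>y. v j y \<bullet> v m y) has_derivative (\<lambda>h. 0)) (at x)"
    by (rule has_derivative_transform_within_open[OF has_derivative_const[of "if j = m then 1 else 0"] D(1) x]) (simp add: orthonormal)
  ultimately have "(\<lambda>h. v j x \<bullet> frechet_derivative (v m) (at x) h + frechet_derivative (v j) (at x) h \<bullet> v m x) = (\<lambda>h. 0)"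
    by (rule has_derivative_unique)
  from fun_cong[OF this, of "axis i 1"] show ?thesis by (simp add: a_def pd_def inner_commute)
qed

lemma a_same: "x \<in> D \<Longrightarrow> a i j j x = 0"
  using a_antisym[of x i j j] by simp

lemma pd_symmetry:
  assumes x: "x \<in> D"
  shows "w l j x *\<^sub>R pd (v j) i x + pd (w l j) i x *\<^sub>R v j x = w l i x *\<^sub>R pd (v i) j x + pd (w l i) j x *\<^sub>R v i x"
proof -
  have "pd (pd (\<phi> l) j) i x = w l j x *\<^sub>R pd (v j) i x + pd (w l j) i x *\<^sub>R v j x" for i j
  proof -
    have "pd (pd (\<phi> l) j) i x = pd (\<lambda>y. w l j y *\<^sub>R v j y) i x"
      by (rule pd_cong[OF D(1) x smooth_on_pd[OF smooth_\<phi>] pd_\<phi>])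
    also have "\<dots> = w l j x *\<^sub>R pd (v j) i x + pd (w l j) i x *\<^sub>R v j x"
      unfolding pd_def[of "v j"] pd_def[of "w l j"]
      by (rule pd_eq[OF has_derivative_scaleR[OF smooth_on_has_derivative[OF D(1) smooth_w x] smooth_on_has_derivative[OF D(1) smooth_v x]]])
    finally show ?thesis .
  qed
  then show ?thesis using pd_commute[OF D(1) x smooth_\<phi>] by metis
qed

lemma inner_pd_symmetry:
  assumes x: "x \<in> D"
  shows "w l j x * a i j m x + pd (w l j) i x * (if j = m then 1 else 0) = w l i x * a j i m x + pd (w l i) j x * (if i = m then 1 else 0)"
  using arg_cong[OF pd_symmetry[OF x, of l j i], of "\<lambda>z. z \<bullet> v m x"] orthonormal[OF x]
  by (simp add: a_def inner_add_left)

text \<open>The coefficient with three distinct indices is, up to the nonzero factors \<open>w\<close>, symmetric in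
  the first pair of indices and antisymmetric in the last pair.\<close>

lemma a_distinct:
  assumes x: "x \<in> D" and "i \<noteq> j" "j \<noteq> m" "i \<noteq> m"
  shows "a i j m x = 0"
proof -
  fix l
  define b where "b i j m = w l j x * w l m x * a i j m x" for i j m
  have sym: "b i j m = b j i m" if "i \<noteq> m" "j \<noteq> m" for i j m
    using inner_pd_symmetry[OF x, of l j i m] that by (simp add: b_def mult.assoc mult.left_commute)
  have anti: "b i j m = - b i m j" for i j m
    using a_antisym[OF x, of i j m] by (simp add: b_def)
  \<comment> \<open>Alternating the swap of the first pair and the swap of the last pair three times
    each returns to the start; the three swaps of the last pair leave the sign -1.\<close>
  have "b i j m = b j i m" using sym assms by blast
  also have "\<dots> = - b j m i" by (rule anti)
  also have "\<dots> = - b m j i" using sym[of j i m] assms by simp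
  also have "\<dots> = b m i j" using anti[of m j i] by simp
  also have "\<dots> = b i m j" using sym[of m j i] assms by simp
  also have "\<dots> = - b i j m" by (rule anti)
  finally have "b i j m = 0" by simp
  then show ?thesis using w_nonzero[OF x] by (simp add: b_def)
qed

lemma pd_w:
  assumes x: "x \<in> D" and "i \<noteq> j"
  shows "pd (w l i) j x = a i j i x * w l j x"
  using inner_pd_symmetry[OF x, of l j i i] a_same[OF x, of j i] assms(2) by (simp add: mult.commute)

text \<open>Comparing mixed partials says nothing about the derivative of \<open>w l m\<close> in
  its own direction. It is recovered by differentiating the null condition in direction m and
  inserting the other derivatives from \<open>pd_w\<close>.\<close>

lemma pd_w_diagonal:
  assumes x: "x \<in> D"
  shows "pd (w l m) m x = - (\<Sum>j\<in>UNIV. eps k m * eps k j * a j m j x * w l j x)"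
proof -
  have "((\<lambda>y. \<Sum>j\<in>UNIV. eps k j * (w l j y * w l j y)) has_derivative
     (\<lambda>h. \<Sum>j\<in>UNIV. eps k j * (w l j x * frechet_derivative (w l j) (at x) h + frechet_derivative (w l j) (at x) h * w l j x))) (at x)"
    by (intro has_derivative_sum has_derivative_mult_right has_derivative_mult smooth_on_has_derivative[OF D(1) smooth_w x])
  moreover have "((\<lambda>y. \<Sum>j\<in>UNIV. eps k j * (w l j y * w l j y)) has_derivative (\<lambda>h. 0)) (at x)"
    by (rule has_derivative_transform_within_open[OF has_derivative_const[of 0] D(1) x]) (simp add: w_null flip: power2_eq_square)
  ultimately have "(\<lambda>h. \<Sum>j\<in>UNIV. eps k j * (w l j x * frechet_derivative (w l j) (at x) h + frechet_derivative (w l j) (at x) h * w l j x)) = (\<lambda>h. 0)"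
    by (rule has_derivative_unique)
  from fun_cong[OF this, of "axis m 1"] have "2 * (\<Sum>j\<in>UNIV. eps k j * w l j x * pd (w l j) m x) = 0"
    by (simp add: pd_def sum_distrib_left algebra_simps)
  then have "0 = (\<Sum>j\<in>UNIV. eps k j * w l j x * pd (w l j) m x)" by simp
  also have "\<dots> = eps k m * w l m x * pd (w l m) m x + (\<Sum>j\<in>UNIV - {m}. eps k j * w l j x * pd (w l j) m x)"
    by (rule sum.remove) auto
  also have "(\<Sum>j\<in>UNIV - {m}. eps k j * w l j x * pd (w l j) m x) = (\<Sum>j\<in>UNIV - {m}. w l m x * (eps k j * a j m j x * w l j x))"
    by (intro sum.cong) (simp_all add: pd_w[OF x])
  \<comment> \<open>The missing summand j = m may be put back because \<open>a m m m\<close>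
    vanishes.\<close>
  also have "\<dots> = (\<Sum>j\<in>UNIV. w l m x * (eps k j * a j m j x * w l j x))"
    by (subst (2) sum.remove[of _ m]) (simp_all add: a_same[OF x])
  finally have "w l m x * (eps k m * pd (w l m) m x + (\<Sum>j\<in>UNIV. eps k j * a j m j x * w l j x)) = 0"
    by (simp add: sum_distrib_left algebra_simps)
  then have "eps k m * (eps k m * pd (w l m) m x + (\<Sum>j\<in>UNIV. eps k j * a j m j x * w l j x)) = 0"
    using w_nonzero[OF x] by simp
  then have "pd (w l m) m x + (\<Sum>j\<in>UNIV. eps k m * eps k j * a j m j x * w l j x) = 0"
    by (simp add: distrib_left sum_distrib_left mult.assoc)
  then show ?thesis by simp
qed

text \<open>Read off from \<open>omega_nth\<close>: the coefficient of \<open>h $ m\<close> in entry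
  (m, j) of V^T dV must be \<open>a m j m\<close>, which fixes the sign and the factor
  \<open>eps\<close>.\<close>

definition F :: "(real, 'n) vec \<Rightarrow> ((real, 'n) vec, 'n) vec" where
  "F x = (\<chi> i j. - (eps k i * a i j i x))"

definition V :: "(real, 'n) vec \<Rightarrow> ((real, 'n) vec, 'n) vec" where
  "V x = (\<chi> r j. v j x $ r)"

definition U :: "(real, 'n) vec \<Rightarrow> ((real, 'n) vec, 'n) vec" where
  "U x = (\<chi> j l. w l j x)"

definition B :: "(real, 'n) vec \<Rightarrow> ((real, 'n) vec, 'n) vec" where
  "B x = transpose (U x ** W)"

lemma smooth_a: "smooth_on D (a i j m)"
  unfolding a_def[abs_def]
  by (intro smooth_on_bounded_bilinear[OF D(1) bounded_bilinear_inner] smooth_on_pd smooth_v)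

lemma smooth_F: "smooth_on D F"
proof -
  have "smooth_on D (\<lambda>x. (- eps k i) * a i j i x)" for i j
    by (intro smooth_on_bounded_linear[OF D(1) bounded_linear_mult_right] smooth_a)
  then have "smooth_on D (\<lambda>x. \<chi> i j. (- eps k i) * a i j i x)"
    by (intro smooth_on_vec_lambda[OF D(1)])
  then show ?thesis by (simp add: F_def[abs_def])
qed

lemma smooth_V: "smooth_on D V"
  unfolding V_def[abs_def] by (intro smooth_on_vec_lambda[OF D(1)] smooth_on_vec_nth[OF D(1)] smooth_v)

lemma smooth_U: "smooth_on D U"
  unfolding U_def[abs_def] by (intro smooth_on_vec_lambda[OF D(1)] smooth_w)

lemma smooth_B: "smooth_on D B"
  unfolding B_def[abs_def]
  by (intro smooth_on_bounded_linear[OF D(1) bounded_linear_transpose]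
      smooth_on_bounded_linear[OF D(1) matrix_mult.bounded_linear_left] smooth_U)

lemma F_diagonal: "x \<in> D \<Longrightarrow> F x $ i $ i = 0"
  by (simp add: F_def a_same)

lemma V_orthogonal:
  assumes "x \<in> D"
  shows "transpose (V x) ** V x = mat 1" "V x ** transpose (V x) = mat 1"
proof -
  show "transpose (V x) ** V x = mat 1"
    using orthonormal[OF assms]
    by (simp add: vec_eq_iff matrix_matrix_mult_def transpose_def V_def mat_def inner_vec_def)
  then show "V x ** transpose (V x) = mat 1" using matrix_left_right_inverse by blast
qed

text \<open>By \<open>a_distinct\<close> only the directions i = m and i = j contribute to an
  off-diagonal entry, and they give the two terms of \<omega>.\<close>

lemma a_sum:
  assumes x: "x \<in> D"
  shows "(\<Sum>i\<in>UNIV. h $ i * a i j m x) = omega k F x h $ m $ j"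
proof (cases "m = j")
  case True
  then show ?thesis using a_same[OF x] by (simp add: omega_nth)
next
  case False
  have "(\<Sum>i\<in>UNIV. h $ i * a i j m x) = (\<Sum>i\<in>{m, j}. h $ i * a i j m x)"
    by (rule sum.mono_neutral_right) (use a_distinct[OF x] False in auto)
  also have "\<dots> = h $ m * a m j m x + h $ j * a j j m x" using False by simp
  also have "a j j m x = - a j m j x" by (rule a_antisym[OF x])
  finally show ?thesis by (simp add: omega_nth F_def algebra_simps)
qed

lemma V_has_derivative:
  assumes x: "x \<in> D"
  shows "(V has_derivative (\<lambda>h. V x ** omega k F x h)) (at x)"
proof -
  note d = smooth_on_has_derivative[OF D(1) smooth_v x]
  have "(V has_derivative (\<lambda>h. \<chi> r j. frechet_derivative (v j) (at x) h $ r)) (at x)"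
    unfolding V_def[abs_def]
    by (intro has_derivative_vec_lambda bounded_linear.has_derivative[OF bounded_linear_vec_nth] d)
  moreover have "(\<chi> r j. frechet_derivative (v j) (at x) h $ r) = V x ** omega k F x h" for h
  proof -
    have "transpose (V x) ** (\<chi> r j. frechet_derivative (v j) (at x) h $ r) = omega k F x h"
    proof -
      have "frechet_derivative (v j) (at x) h \<bullet> v m x = omega k F x h $ m $ j" for m j
        by (simp add: derivative_sum_pd[OF d] inner_sum_left a_sum[OF x, symmetric] a_def)
      then show ?thesis
        by (simp add: vec_eq_iff matrix_matrix_mult_def transpose_def V_def inner_vec_def mult.commute)
    qed
    then show ?thesis using V_orthogonal(2)[OF x] by (metis matrix_mul_assoc matrix_mul_lid)
  qed
  ultimately show ?thesis by simp
qed

text \<open>The diagonal and the off-diagonal derivatives of the metric fields produce the two terms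
  of \<open>tau_nth\<close>; the outer factors J carry the signs \<open>eps k m\<close> and
  \<open>eps k j\<close>.\<close>

lemma U_has_derivative:
  assumes x: "x \<in> D"
  shows "(U has_derivative (\<lambda>h. - (Jmat k ** tau k F x h ** Jmat k ** U x))) (at x)"
proof -
  note d = smooth_on_has_derivative[OF D(1) smooth_w x]
  have "(U has_derivative (\<lambda>h. \<chi> j l. frechet_derivative (w l j) (at x) h)) (at x)"
    unfolding U_def[abs_def] by (intro has_derivative_vec_lambda d)
  moreover have "(\<chi> j l. frechet_derivative (w l j) (at x) h) = - (Jmat k ** tau k F x h ** Jmat k ** U x)" for h
  proof -
    have "frechet_derivative (w l m) (at x) h = (- (Jmat k ** tau k F x h ** Jmat k ** U x)) $ m $ l" for m l
    proof -
      have "frechet_derivative (w l m) (at x) h = (\<Sum>i\<in>UNIV. h $ i * pd (w l m) i x)"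
        using derivative_sum_pd[OF d] by simp
      also have "\<dots> = h $ m * pd (w l m) m x + (\<Sum>i\<in>UNIV - {m}. h $ i * pd (w l m) i x)"
        by (rule sum.remove) auto
      also have "(\<Sum>i\<in>UNIV - {m}. h $ i * pd (w l m) i x) = (\<Sum>i\<in>UNIV - {m}. h $ i * (a m i m x * w l i x))"
        by (intro sum.cong) (simp_all add: pd_w[OF x])
      also have "\<dots> = (\<Sum>i\<in>UNIV. h $ i * (a m i m x * w l i x))"
        by (subst (2) sum.remove[of _ m]) (simp_all add: a_same[OF x])
      also have "h $ m * pd (w l m) m x = (\<Sum>j\<in>UNIV. - (h $ m * (eps k m * eps k j * a j m j x * w l j x)))"
        by (simp add: pd_w_diagonal[OF x] sum_distrib_left sum_negf)
      finally have "frechet_derivative (w l m) (at x) h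
         = (\<Sum>j\<in>UNIV. - (h $ m * (eps k m * eps k j * a j m j x * w l j x)) + h $ j * (a m j m x * w l j x))"
        by (simp only: sum.distrib)
      also have "\<dots> = (\<Sum>j\<in>UNIV. - (eps k m * tau k F x h $ m $ j * eps k j * w l j x))"
        by (intro sum.cong refl) (simp add: tau_nth F_def algebra_simps)
      also have "\<dots> = (- (Jmat k ** tau k F x h ** Jmat k ** U x)) $ m $ l"
      proof -
        have "(Jmat k ** tau k F x h ** Jmat k ** U x) $ m $ l = (\<Sum>j\<in>UNIV. (Jmat k ** tau k F x h ** Jmat k) $ m $ j * U x $ j $ l)"
          by (simp add: matrix_matrix_mult_def)
        then show ?thesis by (simp add: Jmat_mult_nth U_def sum_negf)
      qed
      finally show ?thesis .
    qed
    then show ?thesis by (simp add: vec_eq_iff)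
  qed
  ultimately show ?thesis by simp
qed

text \<open>Transposition moves \<tau> from the left to the right, as a frame requires, and
  \<open>tau_skew\<close> cancels the signs and the factors J.\<close>

lemma B_has_derivative:
  assumes x: "x \<in> D"
  shows "(B has_derivative (\<lambda>h. B x ** tau k F x h)) (at x)"
proof -
  have "(B has_derivative (\<lambda>h. transpose (- (Jmat k ** tau k F x h ** Jmat k ** U x) ** W))) (at x)"
    unfolding B_def[abs_def]
    by (intro bounded_linear.has_derivative[OF bounded_linear_transpose]
       bounded_linear.has_derivative[OF matrix_mult.bounded_linear_left] U_has_derivative x)
  moreover have "transpose (- (Jmat k ** tau k F x h ** Jmat k ** U x) ** W) = B x ** tau k F x h" for h
  proof -
    have "transpose (- (Jmat k ** tau k F x h ** Jmat k ** U x) ** W)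
      = - (B x ** (Jmat k ** transpose (tau k F x h) ** Jmat k))"
      by (simp add: B_def transpose_mult transpose_uminus transpose_Jmat matrix_mult.minus_left matrix_mult.minus_right matrix_mul_assoc)
    then show ?thesis by (simp add: tau_skew matrix_mult.minus_right)
  qed
  ultimately show ?thesis by simp
qed

lemma B_0: "B 0 = mat 1"
  using W by (simp add: B_def U_def)

text \<open>By \<open>tau_skew\<close> the product B J B^T has derivative zero, and it equals J at
  0.\<close>

lemma B_isometry:
  assumes x: "x \<in> D"
  shows "B x ** Jmat k ** transpose (B x) = Jmat k" "transpose (B x) ** Jmat k ** B x = Jmat k"
proof -
  have "((\<lambda>x. B x ** Jmat k ** transpose (B x)) has_derivative (\<lambda>h. 0)) (at x)" if x: "x \<in> D" for x
  proof -
    have 1: "((\<lambda>x. B x ** Jmat k) has_derivative (\<lambda>h. B x ** tau k F x h ** Jmat k)) (at x)"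
      by (rule bounded_linear.has_derivative[OF matrix_mult.bounded_linear_left B_has_derivative[OF x]])
    have 2: "((\<lambda>x. transpose (B x)) has_derivative (\<lambda>h. transpose (B x ** tau k F x h))) (at x)"
      by (rule bounded_linear.has_derivative[OF bounded_linear_transpose B_has_derivative[OF x]])
    have "B x ** Jmat k ** transpose (B x ** tau k F x h) + B x ** tau k F x h ** Jmat k ** transpose (B x) = 0" for h
    proof -
      have "Jmat k ** transpose (tau k F x h) = Jmat k ** transpose (tau k F x h) ** Jmat k ** Jmat k"
        by (simp add: Jmat_square matrix_mul_assoc[symmetric])
      also have "\<dots> = - (tau k F x h ** Jmat k)" by (simp add: tau_skew matrix_mult.minus_left)
      finally have s: "Jmat k ** transpose (tau k F x h) = - (tau k F x h ** Jmat k)" .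
      have "B x ** Jmat k ** transpose (B x ** tau k F x h) = B x ** (Jmat k ** transpose (tau k F x h)) ** transpose (B x)"
        by (simp add: transpose_mult matrix_mul_assoc)
      also have "\<dots> = - (B x ** tau k F x h ** Jmat k ** transpose (B x))"
        unfolding s by (simp add: matrix_mult.minus_left matrix_mult.minus_right matrix_mul_assoc)
      finally show ?thesis by simp
    qed
    with matrix_mult.FDERIV[OF 1 2] show ?thesis by simp
  qed
  from has_derivative_zero_unique_connected[OF D(1) simply_connected_imp_connected[OF D(2)] this x D(3)]
  show *: "B x ** Jmat k ** transpose (B x) = Jmat k" by (simp add: B_0)
  \<comment> \<open>The first identity says that J B^T J is a right inverse of B; as a left inverse
    it gives the second.\<close>
  have "B x ** (Jmat k ** transpose (B x) ** Jmat k) = mat 1"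
    using * by (simp add: matrix_mul_assoc Jmat_square)
  then have "(Jmat k ** transpose (B x) ** Jmat k) ** B x = mat 1" using matrix_left_right_inverse by blast
  then have "Jmat k ** ((Jmat k ** transpose (B x) ** Jmat k) ** B x) = Jmat k" by simp
  then show "transpose (B x) ** Jmat k ** B x = Jmat k" by (simp add: matrix_mul_assoc Jmat_square)
qed

lemma smooth_omega: "smooth_on D (\<lambda>x. omega k F x h)"
proof -
  have "smooth_on D (\<lambda>x. F x $ i $ j)" for i j by (intro smooth_on_vec_nth[OF D(1)] smooth_F)
  then have "smooth_on D (\<lambda>x. \<chi> m j. (- (h $ m * eps k m)) * F x $ m $ j + (eps k j * h $ j) * F x $ j $ m)"
    by (intro smooth_on_vec_lambda[OF D(1)] smooth_on_add[OF D(1)] smooth_on_bounded_linear[OF D(1) bounded_linear_mult_right])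
  moreover have "(\<chi> m j. (- (h $ m * eps k m)) * F x $ m $ j + (eps k j * h $ j) * F x $ j $ m) = omega k F x h" for x
    by (simp add: vec_eq_iff omega_nth)
  ultimately show ?thesis by simp
qed

lemma smooth_tau: "smooth_on D (\<lambda>x. tau k F x h)"
proof -
  have "smooth_on D (\<lambda>x. F x $ i $ j)" for i j by (intro smooth_on_vec_nth[OF D(1)] smooth_F)
  then have "smooth_on D (\<lambda>x. \<chi> m j. (- (h $ m * eps k j)) * F x $ j $ m + (h $ j * eps k j) * F x $ m $ j)"
    by (intro smooth_on_vec_lambda[OF D(1)] smooth_on_add[OF D(1)] smooth_on_bounded_linear[OF D(1) bounded_linear_mult_right])
  moreover have "(\<chi> m j. (- (h $ m * eps k j)) * F x $ j $ m + (h $ j * eps k j) * F x $ m $ j) = tau k F x h" for x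
    by (simp add: vec_eq_iff tau_nth)
  ultimately show ?thesis by simp
qed

lemma B_left_inverse:
  assumes "x \<in> D"
  shows "(Jmat k ** transpose (B x) ** Jmat k) ** B x = mat 1"
  using arg_cong[OF B_isometry(2)[OF assms], of "\<lambda>A. Jmat k ** A"] by (simp add: matrix_mul_assoc Jmat_square)

lemma system_solution_F: "system_solution k D F"
  unfolding system_solution_def
  using smooth_F F_diagonal
    flat_on_if_frame[OF D(1) smooth_V smooth_omega V_has_derivative V_orthogonal(1)]
    flat_on_if_frame[OF D(1) smooth_B smooth_tau B_has_derivative B_left_inverse]
  by blast

end

section \<open>The gauged connection and the extended frame\<close>

lemma diagv_transposed_product:
  "diagv h ** diagv h' = diagv h' ** diagv h" "diagv h ** Jmat k ** diagv h' = diagv h' ** Jmat k ** diagv h"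
  by (simp_all add: vec_eq_iff diagv_mult_nth Jmat_mult_nth mult.commute) (simp_all add: diagv_def)

lemma transpose_zero [simp]: "transpose (0 :: 'a::zero^'n^'m) = 0"
  by (simp add: vec_eq_iff transpose_def)

lemma minus_matrix_vector_mult_minus: "(- A) *v (- b) = A *v (b :: 'a::ring_1^'n)"
  by (simp add: vec_eq_iff matrix_vector_mult_def)

lemma Gmat_eq: "Gmat k = cmat (block_mat (mat 1) 0 0 (Jmat k))"
  by (simp add: Gmat_def cmat_block_mat cmat_one cmat_zero)

lemma Inn_eq: "Inn = cmat (block_mat (mat 1) 0 0 (- mat 1))"
  by (simp add: Inn_def cmat_block_mat cmat_one cmat_zero cmat_uminus)

context combescure_frame
begin

definition \<Phi> :: "(real, 'n) vec \<Rightarrow> ((real, 'n) vec, 'n) vec" where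
  "\<Phi> x = (\<chi> r l. \<phi> l x $ r)"

text \<open>Solves \<phi> = Y c for all members at once: the columns \<open>c l\<close> form the
  matrix - J U(0), whose inverse is - W J.\<close>

definition Y :: "(real, 'n) vec \<Rightarrow> ((real, 'n) vec, 'n) vec" where
  "Y x = - (\<Phi> x ** W ** Jmat k)"

definition c :: "'n \<Rightarrow> (real, 'n) vec" where
  "c l = - (Jmat k *v (\<chi> j. w l j 0))"

definition Z :: "(real, 'n) vec \<Rightarrow> ((real, 'n + 'n) vec, 'n + 'n) vec" where
  "Z x = block_mat 0 (Y x) (- (Jmat k ** transpose (Y x))) 0"

definition frame :: "(real, 'n) vec \<Rightarrow> ((real, 'n + 'n) vec, 'n + 'n) vec" where
  "frame x = block_mat (V x) 0 0 (B x)"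

text \<open>The coefficient of \<lambda> in \<open>theta\<close>.\<close>

definition principal :: "(real, 'n) vec \<Rightarrow> ((real, 'n + 'n) vec, 'n + 'n) vec" where
  "principal h = block_mat 0 (- (diagv h ** Jmat k)) (diagv h) 0"

lemma \<phi>_eq_Y: "\<phi> l x = Y x *v c l"
proof -
  let ?U0 = "\<chi> j l. w l j 0"
  have "W ** ?U0 = mat 1" using W matrix_left_right_inverse by blast
  have "Y x *v c l = (\<Phi> x ** W ** Jmat k ** Jmat k) *v (\<chi> j. w l j 0)"
    by (simp add: Y_def c_def minus_matrix_vector_mult_minus matrix_vector_mul_assoc)
  also have "(\<chi> j. w l j 0) = ?U0 *v axis l 1"
    by (simp add: vec_eq_iff matrix_vector_mult_def axis_def if_distrib cong: if_cong)
  also have "(\<Phi> x ** W ** Jmat k ** Jmat k) *v (?U0 *v axis l 1) = (\<Phi> x ** W ** (Jmat k ** Jmat k) ** ?U0) *v axis l 1"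
    by (simp add: matrix_vector_mul_assoc matrix_mul_assoc)
  also have "\<dots> = \<Phi> x *v axis l 1"
    using \<open>W ** ?U0 = mat 1\<close> by (simp add: Jmat_square flip: matrix_mul_assoc)
  also have "\<dots> = \<phi> l x"
    by (simp add: \<Phi>_def vec_eq_iff matrix_vector_mult_def axis_def if_distrib cong: if_cong)
  finally show ?thesis by simp
qed

lemma smooth_Y: "smooth_on D Y"
proof -
  have "smooth_on D \<Phi>"
    unfolding \<Phi>_def[abs_def] by (intro smooth_on_vec_lambda[OF D(1)] smooth_on_vec_nth[OF D(1)] smooth_\<phi>)
  then show ?thesis unfolding Y_def[abs_def]
    by (intro smooth_on_bounded_linear[OF D(1) bounded_linear_minus[OF bounded_linear_ident]]
        smooth_on_bounded_linear[OF D(1) matrix_mult.bounded_linear_left])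
qed

text \<open>The differential of \<Phi> is V \<delta> U because the partials are multiples of the
  columns of V, and U W is B^T.\<close>

lemma Y_has_derivative:
  assumes x: "x \<in> D"
  shows "(Y has_derivative (\<lambda>h. - (V x ** diagv h ** transpose (B x) ** Jmat k))) (at x)"
proof -
  note d = smooth_on_has_derivative[OF D(1) smooth_\<phi> x]
  have "(\<Phi> has_derivative (\<lambda>h. \<chi> r l. frechet_derivative (\<phi> l) (at x) h $ r)) (at x)"
    unfolding \<Phi>_def[abs_def]
    by (intro has_derivative_vec_lambda bounded_linear.has_derivative[OF bounded_linear_vec_nth] d)
  moreover have "(\<chi> r l. frechet_derivative (\<phi> l) (at x) h $ r) = V x ** diagv h ** U x" for h
  proof -
    have "(V x ** diagv h ** U x) $ r $ l = (\<Sum>j\<in>UNIV. (V x ** diagv h) $ r $ j * U x $ j $ l)" for r l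
      by (simp add: matrix_matrix_mult_def)
    then show ?thesis
      by (simp add: vec_eq_iff diagv_mult_nth derivative_sum_pd[OF d] pd_\<phi>[OF x] V_def U_def mult_ac)
  qed
  ultimately have "(\<Phi> has_derivative (\<lambda>h. V x ** diagv h ** U x)) (at x)" by simp
  then have "(Y has_derivative (\<lambda>h. - (V x ** diagv h ** U x ** W ** Jmat k))) (at x)"
    unfolding Y_def[abs_def]
    by (intro has_derivative_minus bounded_linear.has_derivative[OF matrix_mult.bounded_linear_left])
  then show ?thesis by (simp add: B_def matrix_mul_assoc)
qed

lemma smooth_Z: "smooth_on D Z"
proof -
  have "smooth_on D (\<lambda>x. - (Jmat k ** transpose (Y x)))"
    by (intro smooth_on_bounded_linear[OF D(1) bounded_linear_minus[OF bounded_linear_ident]]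
        smooth_on_bounded_linear[OF D(1) matrix_mult.bounded_linear_right]
        smooth_on_bounded_linear[OF D(1) bounded_linear_transpose] smooth_Y)
  from smooth_on_bounded_linear[OF D(1) bounded_linear_block_off_diag smooth_on_Pair[OF D(1) smooth_Y this]]
  show ?thesis by (simp add: Z_def[abs_def])
qed

lemma Z_has_derivative:
  assumes x: "x \<in> D"
  shows "(Z has_derivative (\<lambda>h. block_mat 0 (- (V x ** diagv h ** transpose (B x) ** Jmat k)) (B x ** diagv h ** transpose (V x)) 0)) (at x)"
proof -
  note dY = Y_has_derivative[OF x]
  have "((\<lambda>x. - (Jmat k ** transpose (Y x))) has_derivative
     (\<lambda>h. - (Jmat k ** transpose (- (V x ** diagv h ** transpose (B x) ** Jmat k))))) (at x)"
    by (intro has_derivative_minus bounded_linear.has_derivative[OF matrix_mult.bounded_linear_right]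
        bounded_linear.has_derivative[OF bounded_linear_transpose] dY)
  moreover have "- (Jmat k ** transpose (- (V x ** diagv h ** transpose (B x) ** Jmat k))) = B x ** diagv h ** transpose (V x)" for h
  proof -
    have "- (Jmat k ** transpose (- (V x ** diagv h ** transpose (B x) ** Jmat k)))
      = Jmat k ** Jmat k ** (B x ** diagv h ** transpose (V x))"
      by (simp add: transpose_uminus transpose_mult transpose_Jmat transpose_diagv matrix_mult.minus_right matrix_mul_assoc)
    then show ?thesis by (simp add: Jmat_square)
  qed
  ultimately have d: "((\<lambda>x. - (Jmat k ** transpose (Y x))) has_derivative (\<lambda>h. B x ** diagv h ** transpose (V x))) (at x)" by simp
  from bounded_linear.has_derivative[OF bounded_linear_block_off_diag has_derivative_Pair[OF dY d]]
  show ?thesis by (simp add: Z_def[abs_def])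
qed

lemma frechet_derivative_Z:
  assumes x: "x \<in> D"
  shows "frechet_derivative Z (at x) h = block_mat 0 (- (V x ** diagv h ** transpose (B x) ** Jmat k)) (B x ** diagv h ** transpose (V x)) 0"
  by (rule fun_cong[OF frechet_derivative_at[OF Z_has_derivative[OF x], symmetric]])

text \<open>In the product of two values the inner factors collapse through B^T J B = J and V^T V =
  1; what remains between the outer factors are diagonal matrices, which commute.\<close>

lemma frechet_derivative_Z_commute:
  assumes x: "x \<in> D"
  shows "frechet_derivative Z (at x) h ** frechet_derivative Z (at x) h' = frechet_derivative Z (at x) h' ** frechet_derivative Z (at x) h"
proof -
  have "frechet_derivative Z (at x) h ** frechet_derivative Z (at x) h'
    = block_mat (- (V x ** (diagv h ** Jmat k ** diagv h') ** transpose (V x))) 0 0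
       (- (B x ** (diagv h ** diagv h') ** transpose (B x) ** Jmat k))" for h h'
  proof -
    have "- (V x ** diagv h ** transpose (B x) ** Jmat k) ** (B x ** diagv h' ** transpose (V x))
      = - (V x ** diagv h ** (transpose (B x) ** Jmat k ** B x) ** diagv h' ** transpose (V x))"
      by (simp add: matrix_mult.minus_left matrix_mul_assoc)
    moreover have "B x ** diagv h ** transpose (V x) ** (- (V x ** diagv h' ** transpose (B x) ** Jmat k))
      = - (B x ** diagv h ** (transpose (V x) ** V x) ** diagv h' ** transpose (B x) ** Jmat k)"
      by (simp add: matrix_mult.minus_right matrix_mul_assoc)
    ultimately show ?thesis
      by (simp add: frechet_derivative_Z[OF x] block_mat_mult B_isometry(2)[OF x] V_orthogonal(1)[OF x]
          matrix_mult.zero_left matrix_mult.zero_right matrix_mul_assoc)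
  qed
  then show ?thesis using diagv_transposed_product by metis
qed

text \<open>Conjugation by the frame carries the \<lambda>-part of \<open>theta\<close> to dZ; this
  is what makes the gauge work.\<close>

lemma frechet_derivative_Z_frame:
  assumes x: "x \<in> D"
  shows "frechet_derivative Z (at x) h ** frame x = frame x ** principal h"
proof -
  have "V x ** diagv h ** transpose (B x) ** Jmat k ** B x = V x ** diagv h ** (transpose (B x) ** Jmat k ** B x)"
    and "B x ** diagv h ** transpose (V x) ** V x = B x ** diagv h ** (transpose (V x) ** V x)"
    by (simp_all add: matrix_mul_assoc)
  then show ?thesis
    by (simp add: frechet_derivative_Z[OF x] frame_def principal_def block_mat_mult matrix_mult.zero_left matrix_mult.zero_right
        matrix_mult.minus_left matrix_mult.minus_right B_isometry(2)[OF x] V_orthogonal(1)[OF x] matrix_mul_assoc)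
qed

text \<open>dZ takes values in the Lie algebra of the isometries of G, so its transport T preserves
  G.\<close>

lemma frechet_derivative_Z_skew:
  assumes x: "x \<in> D"
  shows "frechet_derivative Z (at x) h ** block_mat (mat 1) 0 0 (Jmat k) + block_mat (mat 1) 0 0 (Jmat k) ** transpose (frechet_derivative Z (at x) h) = 0"
proof -
  have "V x ** diagv h ** transpose (B x) ** Jmat k ** Jmat k = V x ** diagv h ** transpose (B x) ** (Jmat k ** Jmat k)"
    and "Jmat k ** (Jmat k ** B x ** diagv h ** transpose (V x)) = (Jmat k ** Jmat k) ** B x ** diagv h ** transpose (V x)"
    by (simp_all add: matrix_mul_assoc)
  then show ?thesis
    by (simp add: frechet_derivative_Z[OF x] block_mat_transpose block_mat_mult block_mat_add block_mat_zero[symmetric]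
        transpose_uminus transpose_mult transpose_Jmat transpose_diagv Jmat_square
        matrix_mult.zero_left matrix_mult.zero_right matrix_mult.minus_left matrix_mult.minus_right matrix_mul_assoc)
qed

lemma frame_isometry:
  assumes x: "x \<in> D"
  shows "transpose (frame x) ** block_mat (mat 1) 0 0 (Jmat k) ** frame x = block_mat (mat 1) 0 0 (Jmat k)"
  by (simp add: frame_def block_mat_transpose block_mat_mult B_isometry(2)[OF x] V_orthogonal(1)[OF x]
      matrix_mult.zero_left matrix_mult.zero_right)

lemma frame_has_derivative:
  assumes x: "x \<in> D"
  shows "(frame has_derivative (\<lambda>h. frame x ** block_mat (omega k F x h) 0 0 (tau k F x h))) (at x)"
  using bounded_linear.has_derivative[OF bounded_linear_block_diag has_derivative_Pair[OF V_has_derivative[OF x] B_has_derivative[OF x]]]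
  by (simp add: frame_def[abs_def] block_mat_mult matrix_mult.zero_left matrix_mult.zero_right)

lemma smooth_frame: "smooth_on D frame"
  using smooth_on_bounded_linear[OF D(1) bounded_linear_block_diag smooth_on_Pair[OF D(1) smooth_V smooth_B]]
  by (simp add: frame_def[abs_def])

lemma Z_0: "Z 0 = 0"
proof -
  have "\<Phi> 0 = 0" by (simp add: \<Phi>_def \<phi>_0 vec_eq_iff)
  then have "Y 0 = 0" by (simp add: Y_def matrix_mult.zero_left)
  then show ?thesis
    by (simp add: Z_def block_mat_zero matrix_mult.zero_right)
qed

lemma theta_eq:
  "theta k F x l h = cscale l (cmat (principal h)) + cmat (block_mat (omega k F x h) 0 0 (tau k F x h))"
  by (simp add: theta_def principal_def vec_eq_iff block_mat_def split: sum.split)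

text \<open>E inherits its properties factorwise: both factors preserve G and are real at real
  \<lambda>; Inn commutes with the block-diagonal frame and reverses the off-diagonal Z, hence the
  parity in \<lambda>.\<close>

theorem extended_frame_exists:
  "\<exists>E. extended_frame k D F E \<and>
     (\<forall>x\<in>D. dlambda0 (E x) ** matrix_inv (E x 0) = block_mat 0 (cmat (Y x)) (- cmat (Jmat k ** transpose (Y x))) 0)"
proof -
  define G :: "((real, 'n + 'n) vec, 'n + 'n) vec" where "G = block_mat (mat 1) 0 0 (Jmat k)"
  define I :: "((real, 'n + 'n) vec, 'n + 'n) vec" where "I = block_mat (mat 1) 0 0 (- mat 1)"
  have GG: "G ** G = mat 1"
    by (simp add: G_def block_mat_mult Jmat_square matrix_mult.zero_left matrix_mult.zero_right block_mat_one)
  have II: "I ** I = mat 1"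
    by (simp add: I_def block_mat_mult matrix_mult.zero_left matrix_mult.zero_right matrix_mult.minus_left matrix_mult.minus_right block_mat_one)
  have IZ: "I ** Z x ** I = - Z x" for x
    by (simp add: I_def Z_def block_mat_mult block_mat_uminus matrix_mult.zero_left matrix_mult.zero_right matrix_mult.minus_left matrix_mult.minus_right)
  have Iframe: "I ** frame x ** I = frame x" for x
    by (simp add: I_def frame_def block_mat_mult matrix_mult.zero_left matrix_mult.zero_right matrix_mult.minus_left matrix_mult.minus_right)
  obtain T T' :: "(real, 'n) vec \<Rightarrow> complex \<Rightarrow> ((complex, 'n + 'n) vec, 'n + 'n) vec"
    where T_smooth: "smooth_on (D \<times> UNIV) (\<lambda>z. T (fst z) (snd z))"
      and T_der: "\<And>x l. x \<in> D \<Longrightarrow>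
        ((\<lambda>y. T y l) has_derivative (\<lambda>h. cscale l (T x l ** cmat (frechet_derivative Z (at x) h)))) (at x)"
      and T_hol: "\<And>x l a b. x \<in> D \<Longrightarrow> ((\<lambda>l. T x l $ a $ b) has_field_derivative T' x l $ a $ b) (at l)"
      and T'_0: "\<And>x. x \<in> D \<Longrightarrow> T' x 0 = cmat (Z x)"
      and T_0: "\<And>x. x \<in> D \<Longrightarrow> T x 0 = mat 1"
      and T_base: "\<And>l. T 0 l = mat 1"
      and T_cnj: "\<And>x l. x \<in> D \<Longrightarrow> map_matrix cnj (T x (cnj l)) = T x l"
      and T_inv: "\<And>I x l. I ** I = mat 1 \<Longrightarrow> (\<And>x. x \<in> D \<Longrightarrow> I ** Z x ** I = - Z x) \<Longrightarrow> x \<in> D \<Longrightarrow>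
        cmat I ** T x (- l) ** cmat I = T x l"
    by (rule spectral_transport_exists[OF D smooth_Z Z_0 frechet_derivative_Z_commute]) blast+
  define E where "E x l = T x l ** cmat (frame x)" for x l
  have T_isometry: "transpose (T x l) ** cmat G ** T x l = cmat G" if x: "x \<in> D" for x l
  proof -
    \<comment> \<open>Since T solves an equation with right multiplication, it is T G T^T whose
      derivative contains the vanishing skew expression; the order needed is recovered afterwards
      from invertibility.\<close>
    have "((\<lambda>y. T y l ** cmat G ** transpose (T y l)) has_derivative (\<lambda>h. 0)) (at y)" if y: "y \<in> D" for y
    proof -
      let ?d = "\<lambda>h. cmat (frechet_derivative Z (at y) h)"
      have 1: "((\<lambda>y. T y l ** cmat G) has_derivative (\<lambda>h. cscale l (T y l ** ?d h) ** cmat G)) (at y)"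
        by (rule bounded_linear.has_derivative[OF matrix_mult.bounded_linear_left T_der[OF y]])
      have 2: "((\<lambda>y. transpose (T y l)) has_derivative (\<lambda>h. transpose (cscale l (T y l ** ?d h)))) (at y)"
        by (rule bounded_linear.has_derivative[OF bounded_linear_transpose T_der[OF y]])
      have "T y l ** cmat G ** transpose (cscale l (T y l ** ?d h)) + cscale l (T y l ** ?d h) ** cmat G ** transpose (T y l) = 0" for h
      proof -
        have tr: "transpose (cscale l A) = cscale l (transpose A)" for A :: "((complex, 'n + 'n) vec, 'n + 'n) vec"
          by (simp add: vec_eq_iff transpose_def)
        have sk: "?d h ** cmat G + cmat G ** transpose (?d h) = 0"
          using arg_cong[OF frechet_derivative_Z_skew[OF y, of h], of cmat]
          by (simp add: G_def cmat_add cmat_mult cmat_transpose cmat_zero)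
        have "T y l ** cmat G ** transpose (cscale l (T y l ** ?d h)) + cscale l (T y l ** ?d h) ** cmat G ** transpose (T y l)
           = cscale l (T y l ** (?d h ** cmat G + cmat G ** transpose (?d h)) ** transpose (T y l))"
          by (simp add: tr transpose_mult cscale_mult_left cscale_mult_right matrix_mult.add_left matrix_mult.add_right
              cscale.add_right matrix_mul_assoc add.commute)
        then show ?thesis unfolding sk by (simp add: matrix_mult.zero_left matrix_mult.zero_right cscale.zero_right)
      qed
      with matrix_mult.FDERIV[OF 1 2] show ?thesis by simp
    qed
    from has_derivative_zero_unique_connected[OF D(1) simply_connected_imp_connected[OF D(2)] this x D(3)]
    have 3: "T x l ** cmat G ** transpose (T x l) = cmat G" by (simp add: T_base)
    have cGG: "cmat G ** cmat G = mat 1" using arg_cong[OF GG, of cmat] by (simp add: cmat_mult cmat_one)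
    have "T x l ** (cmat G ** transpose (T x l) ** cmat G) = mat 1"
      using arg_cong[OF 3, of "\<lambda>A. A ** cmat G"] by (simp add: matrix_mul_assoc cGG)
    then have "(cmat G ** transpose (T x l) ** cmat G) ** T x l = mat 1" using matrix_left_right_inverse by blast
    from arg_cong[OF this, of "\<lambda>A. cmat G ** A"] show ?thesis by (simp add: matrix_mul_assoc cGG)
  qed
  have E_isometry: "transpose (E x l) ** cmat G ** E x l = cmat G" if x: "x \<in> D" for x l
  proof -
    have "transpose (E x l) ** cmat G ** E x l = transpose (cmat (frame x)) ** (transpose (T x l) ** cmat G ** T x l) ** cmat (frame x)"
      by (simp add: E_def transpose_mult matrix_mul_assoc)
    also have "\<dots> = cmat (transpose (frame x) ** G ** frame x)"
      by (simp add: T_isometry[OF x] cmat_mult cmat_transpose)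
    finally show ?thesis using frame_isometry[OF x] by (simp add: G_def)
  qed
  have E_inv: "matrix_inv (E x l) ** E x l = mat 1" if x: "x \<in> D" for x l
  proof -
    have cGG: "cmat G ** cmat G = mat 1" using arg_cong[OF GG, of cmat] by (simp add: cmat_mult cmat_one)
    have "(cmat G ** transpose (E x l) ** cmat G) ** E x l = mat 1"
      using arg_cong[OF E_isometry[OF x], of "\<lambda>A. cmat G ** A"] by (simp add: matrix_mul_assoc cGG)
    then have "E x l ** (cmat G ** transpose (E x l) ** cmat G) = mat 1" using matrix_left_right_inverse by blast
    from matrix_inv_eq[OF this] show ?thesis using \<open>_ ** E x l = mat 1\<close> by simp
  qed
  have E_der: "((\<lambda>y. E y l) has_derivative (\<lambda>h. E x l ** theta k F x l h)) (at x)" if x: "x \<in> D" for x l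
  proof -
    let ?d = "\<lambda>h. cmat (frechet_derivative Z (at x) h)" and ?\<omega> = "\<lambda>h. block_mat (omega k F x h) 0 0 (tau k F x h)"
    have "((\<lambda>y. E y l) has_derivative (\<lambda>h. T x l ** cmat (frame x ** ?\<omega> h) + cscale l (T x l ** ?d h) ** cmat (frame x))) (at x)"
      unfolding E_def
      by (rule matrix_mult.FDERIV[OF T_der[OF x] bounded_linear.has_derivative[OF bounded_linear_cmat frame_has_derivative[OF x]]])
    moreover have "T x l ** cmat (frame x ** ?\<omega> h) + cscale l (T x l ** ?d h) ** cmat (frame x) = E x l ** theta k F x l h" for h
    proof -
      have "cscale l (T x l ** ?d h) ** cmat (frame x) = cscale l (T x l ** cmat (frechet_derivative Z (at x) h ** frame x))"
        by (simp add: cscale_mult_left cmat_mult matrix_mul_assoc)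
      then show ?thesis
        by (simp add: frechet_derivative_Z_frame[OF x] theta_eq E_def cmat_mult cscale_mult_right matrix_mult.add_right matrix_mul_assoc add.commute)
    qed
    ultimately show ?thesis by simp
  qed
  have o: "open (D \<times> (UNIV :: complex set))" using D(1) by (intro open_Times) auto
  have "smooth_on (D \<times> UNIV) (\<lambda>z. E (fst z) (snd z))"
    unfolding E_def
    by (intro smooth_on_bounded_bilinear[OF o bounded_bilinear_matrix_mult T_smooth] smooth_on_fst[OF D(1)]
        smooth_on_bounded_linear[OF D(1) bounded_linear_cmat] smooth_frame)
  then have e1: "smooth_on (D \<times> UNIV) (\<lambda>(x, l). E x l)" by (simp add: split_beta')
  have entry: "((\<lambda>l. E x l $ a $ b) has_field_derivative (T' x l ** cmat (frame x)) $ a $ b) (at l)" if x: "x \<in> D" for x l a b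
    unfolding E_def matrix_matrix_mult_def vec_lambda_beta
    by (intro DERIV_sum DERIV_cmult_right T_hol[OF x])
  have e2: "(\<lambda>l. E x l $ a $ b) holomorphic_on UNIV" if "x \<in> D" for x a b
    using entry[OF that] by (auto simp: holomorphic_on_open)
  have e4: "matrix_inv (E x l) ** frechet_derivative (\<lambda>y. E y l) (at x) h = theta k F x l h" if x: "x \<in> D" for x l h
    unfolding frechet_derivative_at[OF E_der[OF x], symmetric] by (simp add: matrix_mul_assoc E_inv[OF x])
  have e5: "map_matrix cnj (E x (cnj l)) = E x l" if x: "x \<in> D" for x l
  proof -
    have "map_matrix cnj (E x (cnj l)) = map_matrix cnj (T x (cnj l)) ** cmat (frame x)"
      by (simp add: E_def vec_eq_iff matrix_matrix_mult_def)
    then show ?thesis by (simp add: T_cnj[OF x] E_def)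
  qed
  have Inn_I: "Inn = cmat I" by (simp add: I_def Inn_eq)
  have cII: "cmat I ** cmat I = mat 1" using arg_cong[OF II, of cmat] by (simp add: cmat_mult cmat_one)
  have e6: "Inn ** E x (- l) ** matrix_inv Inn = E x l" if x: "x \<in> D" for x l
  proof -
    \<comment> \<open>The factor 1 is kept in the middle so that it can be replaced by I I, which
      splits the conjugation between T and the frame.\<close>
    have "Inn ** E x (- l) ** matrix_inv Inn = cmat I ** T x (- l) ** mat 1 ** cmat (frame x) ** cmat I"
      by (simp add: Inn_I matrix_inv_eq[OF cII] E_def matrix_mul_assoc)
    also have "\<dots> = (cmat I ** T x (- l) ** cmat I) ** (cmat (I ** frame x ** I))"
      unfolding cII[symmetric] by (simp add: cmat_mult matrix_mul_assoc)
    also have "\<dots> = E x l" unfolding T_inv[OF II IZ x] Iframe E_def by simp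
    finally show ?thesis .
  qed
  have e7: "dlambda0 (E x) ** matrix_inv (E x 0) = block_mat 0 (cmat (Y x)) (- cmat (Jmat k ** transpose (Y x))) 0" if x: "x \<in> D" for x
  proof -
    have "dlambda0 (E x) = T' x 0 ** cmat (frame x)"
      by (simp add: dlambda0_def vec_eq_iff DERIV_imp_deriv[OF entry[OF x]])
    \<comment> \<open>At \<lambda> = 0 the transport is 1, so \<open>E x 0\<close> is the frame
      itself and cancels against its inverse.\<close>
    also have "\<dots> = cmat (Z x) ** E x 0" by (simp add: T'_0[OF x] E_def T_0[OF x])
    finally have "dlambda0 (E x) ** matrix_inv (E x 0) = cmat (Z x) ** (E x 0 ** matrix_inv (E x 0))"
      by (simp add: matrix_mul_assoc)
    also have "E x 0 ** matrix_inv (E x 0) = mat 1" using E_inv[OF x] matrix_left_right_inverse by blast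
    finally show ?thesis by (simp add: Z_def cmat_block_mat cmat_zero cmat_uminus)
  qed
  have "extended_frame k D F E"
    unfolding extended_frame_def in_O_complex_def Gmat_eq
    using e1 e2 e4 e5 e6 E_isometry unfolding G_def by blast
  then show ?thesis using e7 by blast
qed

end

section \<open>The null basis\<close>

context combescure_frame
begin

text \<open>J preserves the form, so this is the null condition for the metric field at 0.\<close>

lemma c_null: "kform k (c l) (c l) = 0"
proof -
  have "c l $ j = - (eps k j * w l j 0)" for j
    by (simp add: c_def Jmat_def matrix_vector_mult_def if_distrib[of "\<lambda>z. z * _"] cong: if_cong)
  moreover have "(Jmat k *v c l) $ j = eps k j * c l $ j" for j
    by (simp add: Jmat_def matrix_vector_mult_def if_distrib[of "\<lambda>z. z * _"] cong: if_cong)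
  ultimately have "kform k (c l) (c l) = (\<Sum>j\<in>UNIV. eps k j * (w l j 0)\<^sup>2)"
    by (simp add: kform_def inner_vec_def power2_eq_square algebra_simps)
  then show ?thesis using w_null[OF D(3)] by simp
qed

text \<open>The vectors \<open>c l\<close> are the columns of the invertible matrix - J
  U(0).\<close>

lemma c_basis: "inj c" "independent (range c)" "span (range c) = UNIV"
proof -
  define A where "A = - (Jmat k ** (\<chi> j l. w l j 0))"
  have "A ** (- (W ** Jmat k)) = Jmat k ** ((\<chi> j l. w l j 0) ** W) ** Jmat k"
    by (simp add: A_def matrix_mult.minus_left matrix_mult.minus_right matrix_mul_assoc)
  then have "A ** (- (W ** Jmat k)) = mat 1" by (simp add: W Jmat_square)
  then have "- (W ** Jmat k) ** A = mat 1" using matrix_left_right_inverse by blast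
  then have injA: "inj ((*v) A)" using matrix_left_invertible_injective by blast
  have c: "c l = A *v axis l 1" for l
  proof -
    have "A *v axis l 1 = - (Jmat k *v ((\<chi> j l. w l j 0) *v axis l 1))"
      by (simp add: A_def matrix_vector_mul_assoc) (simp add: vec_eq_iff matrix_vector_mult_def sum_negf)
    also have "(\<chi> j l. w l j 0) *v axis l 1 = (\<chi> j. w l j 0)"
      by (simp add: vec_eq_iff matrix_vector_mult_def axis_def if_distrib cong: if_cong)
    finally show ?thesis by (simp add: c_def)
  qed
  show inj: "inj c"
  proof (rule injI)
    fix l l' assume "c l = c l'"
    then have "axis l 1 = (axis l' 1 :: (real, 'n) vec)" unfolding c by (rule injD[OF injA])
    then show "l = l'" by (simp add: axis_eq_axis)
  qed
  have "range (\<lambda>l :: 'n. axis l (1::real)) \<subseteq> Basis" by (auto simp: Basis_vec_def)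
  then have "independent (range (\<lambda>l :: 'n. axis l (1::real)))" using independent_Basis independent_mono by blast
  then have "independent ((*v) A ` range (\<lambda>l. axis l 1))"
    by (rule linear_independent_injective_image[OF matrix_vector_mul_linear _ inj_on_subset[OF injA subset_UNIV]])
  then show ind: "independent (range c)" by (simp add: image_image c[abs_def])
  have "card (range c) = CARD('n)" using inj by (rule card_image)
  then have "UNIV \<subseteq> span (range c)" using ind by (intro card_ge_dim_independent) (auto simp: dim_UNIV)
  then show "span (range c) = UNIV" by blast
qed

end

section \<open>From a Combescure sequence to an orthonormal frame\<close>

lemma metric_field_component:
  assumes "metric_field U \<phi> u" "x \<in> U"
  shows "(u x $ j)\<^sup>2 = (norm (pd \<phi> j x))\<^sup>2"
proof -
  have "(norm (pd \<phi> j x))\<^sup>2 = (\<Sum>i\<in>UNIV. (u x $ i)\<^sup>2 * (axis j 1 $ i)\<^sup>2)"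
    using assms unfolding metric_field_def pd_def by blast
  also have "\<dots> = (\<Sum>i\<in>UNIV. if i = j then (u x $ i)\<^sup>2 else 0)"
    by (intro sum.cong) (auto simp: axis_def)
  finally show ?thesis by simp
qed

text \<open>The metric field witnessing the Guichard condition need not be the one chosen for the
  sequence. Both have the same squares, so the condition is expressed by norms of partials.\<close>

lemma guichard_null:
  fixes \<phi> :: "(real, 'n::{finite,linorder}) vec \<Rightarrow> (real, 'n) vec"
  assumes "guichard k U \<phi>" "x \<in> U"
  shows "(\<Sum>j\<in>UNIV. eps k j * (norm (pd \<phi> j x))\<^sup>2) = 0"
proof -
  let ?A = "{i :: 'n. rank_idx i < CARD('n) - k}"
  obtain u where u: "metric_field U \<phi> u"
    "(\<Sum>i\<in>?A. (u x $ i)\<^sup>2) = (\<Sum>i\<in>{i. \<not> rank_idx i < CARD('n) - k}. (u x $ i)\<^sup>2)"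
    using assms unfolding guichard_def by blast
  have "(\<Sum>j\<in>UNIV. eps k j * (norm (pd \<phi> j x))\<^sup>2) = (\<Sum>j\<in>UNIV. eps k j * (u x $ j)\<^sup>2)"
    by (simp add: metric_field_component[OF u(1) assms(2)])
  also have "\<dots> = (\<Sum>j\<in>?A. eps k j * (u x $ j)\<^sup>2) + (\<Sum>j\<in>- ?A. eps k j * (u x $ j)\<^sup>2)"
    by (subst sum.union_disjoint[symmetric]) auto
  also have "(\<Sum>j\<in>?A. eps k j * (u x $ j)\<^sup>2) = (\<Sum>j\<in>?A. (u x $ j)\<^sup>2)"
    by (intro sum.cong) (auto simp: eps_def)
  also have "(\<Sum>j\<in>- ?A. eps k j * (u x $ j)\<^sup>2) = - (\<Sum>j\<in>{i. \<not> rank_idx i < CARD('n) - k}. (u x $ j)\<^sup>2)"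
    unfolding sum_negf[symmetric] by (intro sum.cong) (auto simp: eps_def)
  finally show ?thesis using u(2) by simp
qed

text \<open>The metric fields of a Combescure sequence may change sign from point to point, so the frame
  \<open>v\<close> is normalised by norms instead; at each point this flips the rows of \<open>u\<close> simultaneously.\<close>

proposition combescure_frame_exists:
  fixes D :: "(real, 'n::{finite,linorder}) vec set" and \<sigma> :: "'n \<Rightarrow> nat"
  assumes D: "open D" "simply_connected D" "0 \<in> D"
    and cs: "combescure_sequence k D \<phi>" and \<phi>_0: "\<forall>l\<in>{1..CARD('n)}. \<phi> l 0 = 0"
    and \<sigma>: "bij_betw \<sigma> UNIV {1..CARD('n)}"
  shows "\<exists>v w W. combescure_frame D k (\<lambda>l. \<phi> (\<sigma> l)) v w W"
proof -
  have \<sigma>_in: "\<sigma> l \<in> {1..CARD('n)}" for l using \<sigma> by (auto simp: bij_betw_def)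
  have one: "1 \<in> {1..CARD('n)}" using \<sigma>_in by force
  have gui: "guichard k D (\<phi> l)" if "l \<in> {1..CARD('n)}" for l
    using cs that unfolding combescure_sequence_def by blast
  obtain u where mf: "\<And>l. l \<in> {1..CARD('n)} \<Longrightarrow> metric_field D (\<phi> l) (u l)"
    and ratio: "\<And>l x j. l \<in> {1..CARD('n)} \<Longrightarrow> x \<in> D \<Longrightarrow>
       (1 / (u l x $ j)) *\<^sub>R pd (\<phi> l) j x = (1 / (u 1 x $ j)) *\<^sub>R pd (\<phi> 1) j x"
    and ind: "\<And>x. x \<in> D \<Longrightarrow> inj_on (\<lambda>l. u l x) {1..CARD('n)} \<and> independent ((\<lambda>l. u l x) ` {1..CARD('n)})"
    using cs unfolding combescure_sequence_def by blast
  have sm: "smooth_on D (\<phi> l)" and nz: "x \<in> D \<Longrightarrow> pd (\<phi> l) j x \<noteq> 0"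
    and orth: "x \<in> D \<Longrightarrow> i \<noteq> j \<Longrightarrow> pd (\<phi> l) i x \<bullet> pd (\<phi> l) j x = 0" if "l \<in> {1..CARD('n)}" for l x i j
    using gui[OF that] unfolding guichard_def orth_coords_def by blast+
  have unz: "u l x $ j \<noteq> 0" if "l \<in> {1..CARD('n)}" "x \<in> D" for l x j
    using metric_field_component[OF mf[OF that(1)] that(2), of j] nz[OF that, of j] by auto
  define p where "p j x = pd (\<phi> 1) j x" for j x
  \<comment> \<open>Normalisation through a power of the squared length, which is positive and
    smooth.\<close>
  define v where "v j x = ((p j x \<bullet> p j x) powr (- (1/2))) *\<^sub>R p j x" for j x
  define w where "w l j x = pd (\<phi> (\<sigma> l)) j x \<bullet> v j x" for l j x
  \<comment> \<open>The sign, 1 or -1, relating the unit tangent of the given metric fields to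
    \<open>v j\<close>; it is the same for every member of the sequence.\<close>
  define s where "s j x = norm (p j x) / u 1 x $ j" for j x
  have p_nz: "p j x \<noteq> 0" if "x \<in> D" for j x using nz[OF one that] by (simp add: p_def)
  have v: "v j x = (1 / norm (p j x)) *\<^sub>R p j x" if "x \<in> D" for j x
    using p_nz[OF that, of j] by (simp add: v_def powr_minus powr_half_sqrt norm_eq_sqrt_inner inverse_eq_divide)
  have p_v: "p j x = norm (p j x) *\<^sub>R v j x" if "x \<in> D" for j x
    using p_nz[OF that, of j] by (simp add: v[OF that])
  have orthonormal: "v i x \<bullet> v j x = (if i = j then 1 else 0)" if x: "x \<in> D" for i j x
    using orth[OF one x, of i j] p_nz[OF x, of i]
    by (auto simp: v[OF x] p_def dot_square_norm power2_eq_square)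
  have pd_v: "pd (\<phi> l) j x = (u l x $ j * s j x) *\<^sub>R v j x" if l: "l \<in> {1..CARD('n)}" and x: "x \<in> D" for l j x
  proof -
    have "pd (\<phi> l) j x = (u l x $ j) *\<^sub>R ((1 / u l x $ j) *\<^sub>R pd (\<phi> l) j x)" using unz[OF l x] by simp
    also have "\<dots> = (u l x $ j * (1 / u 1 x $ j)) *\<^sub>R p j x" unfolding ratio[OF l x] by (simp add: p_def)
    also have "\<dots> = (u l x $ j * (1 / u 1 x $ j)) *\<^sub>R (norm (p j x) *\<^sub>R v j x)" using p_v[OF x] by metis
    finally show ?thesis by (simp add: s_def)
  qed
  have w: "w l j x = u (\<sigma> l) x $ j * s j x" if "x \<in> D" for l j x
    unfolding w_def pd_v[OF \<sigma>_in that] by (simp add: orthonormal[OF that])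
  have s_nz: "s j x \<noteq> 0" if "x \<in> D" for j x using p_nz[OF that] unz[OF one that] by (simp add: s_def)
  have smooth_p: "smooth_on D (p j)" for j unfolding p_def[abs_def] by (rule smooth_on_pd[OF sm[OF one]])
  have smooth_v: "smooth_on D (v j)" for j
    unfolding v_def[abs_def]
    by (intro smooth_on_bounded_bilinear[OF D(1) bounded_bilinear_scaleR] smooth_on_powr[OF D(1)]
        smooth_on_bounded_bilinear[OF D(1) bounded_bilinear_inner] smooth_p) (simp add: p_nz)
  have smooth_w: "smooth_on D (w l j)" for l j
    unfolding w_def[abs_def]
    by (intro smooth_on_bounded_bilinear[OF D(1) bounded_bilinear_inner] smooth_on_pd sm[OF \<sigma>_in] smooth_v)
  \<comment> \<open>A linear relation between the columns is one between the metric fields at 0,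
    since the nonzero factor \<open>s j 0\<close> is common to row j and can be cancelled.\<close>
  have "\<exists>W. W ** (\<chi> j l. w l j 0) = mat 1"
    unfolding matrix_left_invertible_independent_columns
  proof (intro allI impI)
    fix a :: "'n \<Rightarrow> real" and l
    assume 0: "(\<Sum>l\<in>UNIV. a l *s column l (\<chi> j l. w l j 0)) = 0"
    define g where "g l = u (\<sigma> l) 0" for l
    have "(\<Sum>l\<in>UNIV. a l *\<^sub>R g l) = 0"
    proof -
      have "(\<Sum>l\<in>UNIV. a l * g l $ j) * s j 0 = 0" for j
        using arg_cong[OF 0, of "\<lambda>z. z $ j"] by (simp add: column_def w[OF D(3)] g_def sum_distrib_right mult.assoc)
      then show ?thesis using s_nz[OF D(3)] by (simp add: vec_eq_iff)
    qed
    moreover have inj: "inj g"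
      using comp_inj_on[of \<sigma> UNIV "\<lambda>l. u l 0"] ind[OF D(3)] \<sigma> by (simp add: bij_betw_def g_def[abs_def] o_def)
    have range: "range g = (\<lambda>l. u l 0) ` {1..CARD('n)}"
      unfolding bij_betw_imp_surj_on[OF \<sigma>, symmetric] g_def[abs_def] by (simp add: image_image)
    have "(\<Sum>y\<in>range g. a (inv g y) *\<^sub>R y) = (\<Sum>l\<in>UNIV. a l *\<^sub>R g l)"
      by (subst sum.reindex[OF inj]) (simp add: inv_f_f[OF inj])
    moreover have "independent (range g)" using ind[OF D(3)] range by simp
    ultimately have "a (inv g (g l)) = 0"
      by (intro independentD[of "range g" "range g" "\<lambda>y. a (inv g y)"]) auto
    then show "a l = 0" by (simp add: inv_f_f[OF inj])
  qed
  then obtain W where "W ** (\<chi> j l. w l j 0) = mat 1" by blast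
  then have W: "(\<chi> j l. w l j 0) ** W = mat 1" using matrix_left_right_inverse by blast
  have "combescure_frame D k (\<lambda>l. \<phi> (\<sigma> l)) v w W"
  proof
    fix l j x assume x: "x \<in> D"
    show 1: "pd (\<phi> (\<sigma> l)) j x = w l j x *\<^sub>R v j x" for j
      unfolding pd_v[OF \<sigma>_in x] w[OF x] ..
    show "w l j x \<noteq> 0" using s_nz[OF x] unz[OF \<sigma>_in x] by (simp add: w[OF x])
    have "norm (v j x) = 1" for j using orthonormal[OF x, of j j] by (simp add: norm_eq_1)
    then show "(\<Sum>j\<in>UNIV. eps k j * (w l j x)\<^sup>2) = 0"
      using guichard_null[OF gui[OF \<sigma>_in] x, of l] by (simp add: 1)
  qed (use D sm[OF \<sigma>_in] smooth_v smooth_w orthonormal W \<phi>_0 \<sigma>_in in auto)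
  then show ?thesis by blast
qed

theorem theorem3p3:
  fixes D :: "(real^'n::{finite,linorder}) set"
    and k :: nat
    and \<phi> :: "nat \<Rightarrow> real^'n::{finite,linorder} \<Rightarrow> real^'n::{finite,linorder}"
  assumes "CARD('n) \<ge> 2" and "1 \<le> k" and "k \<le> CARD('n) - 1"
    and "open D" and "simply_connected D" and "0 \<in> D"
    and "combescure_sequence k D \<phi>"
    and "\<forall>l\<in>{1..CARD('n)}. \<phi> l 0 = 0"
  shows "\<exists>F E c Y. system_solution k D F \<and> extended_frame k D F E \<and> null_basis k c \<and>
     (\<forall>x\<in>D. dlambda0 (E x) ** matrix_inv (E x 0)
              = block_mat 0 (cmat (Y x)) (- cmat (Jmat k ** transpose (Y x))) 0) \<and>
     (\<forall>l\<in>{1..CARD('n)}. \<forall>x\<in>D. \<phi> l x = Y x *v c l)"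
proof -
  \<comment> \<open>Any bijection will do: neither the basis property nor \<phi> = Y c depends on
    how the members are matched with coordinates, and \<tau> restores the numbering.\<close>
  obtain \<sigma> :: "'n \<Rightarrow> nat" where \<sigma>: "bij_betw \<sigma> UNIV {1..CARD('n)}"
    using finite_same_card_bij[of "UNIV :: 'n set" "{1..CARD('n)}"] by auto
  obtain v w W where "combescure_frame D k (\<lambda>l. \<phi> (\<sigma> l)) v w W"
    using combescure_frame_exists[OF assms(4-8) \<sigma>] by blast
  then interpret combescure_frame D k "\<lambda>l. \<phi> (\<sigma> l)" v w W .
  define \<tau> where "\<tau> = inv_into UNIV \<sigma>"
  have \<tau>: "bij_betw \<tau> {1..CARD('n)} UNIV" unfolding \<tau>_def by (rule bij_betw_inv_into[OF \<sigma>])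
  have \<sigma>\<tau>: "\<sigma> (\<tau> l) = l" if "l \<in> {1..CARD('n)}" for l
    using \<sigma> that unfolding \<tau>_def bij_betw_def by (simp add: f_inv_into_f)
  have img: "(\<lambda>l. c (\<tau> l)) ` {1..CARD('n)} = range c"
    using bij_betw_imp_surj_on[OF \<tau>] by (metis image_image)
  have inj: "inj_on (\<lambda>l. c (\<tau> l)) {1..CARD('n)}"
    using comp_inj_on[OF bij_betw_imp_inj_on[OF \<tau>], of c] c_basis(1) by (simp add: o_def inj_on_subset)
  have nb: "null_basis k (\<lambda>l. c (\<tau> l))"
    unfolding null_basis_def img using c_null c_basis(2,3) inj by blast
  have \<phi>Y: "\<forall>l\<in>{1..CARD('n)}. \<forall>x\<in>D. \<phi> l x = Y x *v c (\<tau> l)"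
    using \<phi>_eq_Y \<sigma>\<tau> by metis
  obtain E where "extended_frame k D F E"
    "\<forall>x\<in>D. dlambda0 (E x) ** matrix_inv (E x 0) = block_mat 0 (cmat (Y x)) (- cmat (Jmat k ** transpose (Y x))) 0"
    using extended_frame_exists by blast
  then show ?thesis using system_solution_F nb \<phi>Y
    by (intro exI[of _ F] exI[of _ E] exI[of _ "\<lambda>l. c (\<tau> l)"] exI[of _ Y] conjI)
qed

end
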